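(* Let $p\ge 3$ be a prime. Let $\mathbf G$ be one of $\mathbf{SL}_2$, $\mathbf{SL}_k$ with $k\ge 3$, or $\mathbf{Sp}_{2k}$ with $k\ge 2$, and let $h(\mathbf{SL}_2,p)=\frac12(p-1)$, $h(\mathbf{SL}_k,p)=p^{k-1}-p^{k-2}$ for $k\ge 3$, and $h(\mathbf{Sp}_{2k},p)=\frac12(p-1)p^{k-1}$ for $k\ge 2$. If $A$ is a measurable subset of the group $G=\mathbf G(\mathbb Z_p)$ with $\mu(A)>h(\mathbf G,p)^{-1/3}$, then $A^3=G$.
   Context: $\mathbb Z_p$ is the ring of $p$-adic integers, $\mathbf G(\mathbb Z_p)$ carries its profinite ($p$-adic) topology, and $\mu$ is its Haar measure normalized by $\mu(G)=1$. $A^3=\{a_1a_2a_3: a_1,a_2,a_3\in A\}$. $\mathbf{SL}_k(R)$ is the group of $k\times k$ matrices over $R$ of determinant $1$, and $\mathbf{Sp}_{2k}(R)=\{A\in \mathrm{GL}_{2k}(R): AJA^T=J\}$, where $J=\begin{pmatrix}0&I_k\\-I_k&0\end{pmatrix}$. *)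

theory Defs
  imports "HOL-Analysis.Analysis" "Berlekamp_Zassenhaus.Finite_Field"
begin

text \<open>
  The ring of \<open>p\<close>-adic integers, as the inverse limit of the rings \<open>\<int>/p\<^sup>n\<close>, where the prime \<open>p\<close> is
  \<open>CARD('p)\<close>. The \<open>n\<close>-th entry of a sequence is the representative in \<open>{0..<p\<^sup>n}\<close> of its residue
  modulo \<open>p\<^sup>n\<close>; that it lies in this range follows from the coherence condition.
\<close>

typedef (overloaded) ('p :: prime_card) padic_int =
  "{x :: nat \<Rightarrow> int. \<forall>n. x (Suc n) mod int CARD('p) ^ n = x n}"
  morphisms padic_res Abs_padic_int
  by (rule exI[of _ "\<lambda>_. 0"]) simp

setup_lifting type_definition_padic_int

lemma mod_coherent:
  fixes a b q :: int
  shows "(a mod q ^ Suc n) mod q ^ n = a mod q ^ n"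
  by (simp add: mod_mod_cancel)

lemma padic_res_mod [simp]:
  "padic_res (x :: 'p :: prime_card padic_int) n mod int CARD('p) ^ n = padic_res x n"
  by transfer (metis mod_mod_trivial)

lemma padic_int_eqI: "(\<And>n. padic_res x n = padic_res y n) \<Longrightarrow> x = y"
  by transfer auto

instantiation padic_int :: (prime_card) comm_ring_1
begin

lift_definition zero_padic_int :: "'a padic_int" is "\<lambda>_. 0"
  by simp

lift_definition one_padic_int :: "'a padic_int" is "\<lambda>n. 1 mod int CARD('a) ^ n"
  by (simp add: mod_coherent del: power_Suc)

lift_definition plus_padic_int :: "'a padic_int \<Rightarrow> 'a padic_int \<Rightarrow> 'a padic_int"
  is "\<lambda>x y n. (x n + y n) mod int CARD('a) ^ n"
  by (simp add: mod_coherent del: power_Suc) (metis mod_add_eq)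

lift_definition uminus_padic_int :: "'a padic_int \<Rightarrow> 'a padic_int"
  is "\<lambda>x n. (- x n) mod int CARD('a) ^ n"
  by (simp add: mod_coherent del: power_Suc) (metis mod_minus_eq)

lift_definition minus_padic_int :: "'a padic_int \<Rightarrow> 'a padic_int \<Rightarrow> 'a padic_int"
  is "\<lambda>x y n. (x n - y n) mod int CARD('a) ^ n"
  by (simp add: mod_coherent del: power_Suc) (metis mod_diff_eq)

lift_definition times_padic_int :: "'a padic_int \<Rightarrow> 'a padic_int \<Rightarrow> 'a padic_int"
  is "\<lambda>x y n. (x n * y n) mod int CARD('a) ^ n"
  by (simp add: mod_coherent del: power_Suc) (metis mod_mult_eq)

instance
proof
  fix a b c :: "'a padic_int"
  show "a * b * c = a * (b * c)"
    by (rule padic_int_eqI) (simp add: times_padic_int.rep_eq mod_simps mult.assoc)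
  show "a * b = b * a"
    by (rule padic_int_eqI) (simp add: times_padic_int.rep_eq mult.commute)
  show "1 * a = a"
    by (rule padic_int_eqI) (simp add: times_padic_int.rep_eq one_padic_int.rep_eq mod_simps)
  show "a + b + c = a + (b + c)"
    by (rule padic_int_eqI) (simp add: plus_padic_int.rep_eq mod_simps add.assoc)
  show "a + b = b + a"
    by (rule padic_int_eqI) (simp add: plus_padic_int.rep_eq add.commute)
  show "0 + a = a"
    by (rule padic_int_eqI) (simp add: plus_padic_int.rep_eq zero_padic_int.rep_eq)
  show "- a + a = 0"
    by (rule padic_int_eqI)
      (simp add: plus_padic_int.rep_eq uminus_padic_int.rep_eq zero_padic_int.rep_eq mod_simps)
  show "a - b = a + - b"
    by (rule padic_int_eqI)
      (simp add: plus_padic_int.rep_eq uminus_padic_int.rep_eq minus_padic_int.rep_eq mod_simps)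
  show "(a + b) * c = a * c + b * c"
    by (rule padic_int_eqI)
      (simp add: plus_padic_int.rep_eq times_padic_int.rep_eq mod_simps distrib_right)
  have "padic_res (1 :: 'a padic_int) 1 = 1"
    using prime_gt_1_nat[OF prime_card[where 'a = 'a]] by (simp add: one_padic_int.rep_eq)
  moreover have "padic_res (0 :: 'a padic_int) 1 = 0"
    by (simp add: zero_padic_int.rep_eq)
  ultimately show "(0 :: 'a padic_int) \<noteq> 1"
    by auto
qed

end

text \<open>The residue classes \<open>x + p\<^sup>n \<int>\<^sub>p\<close> form a neighbourhood base at \<open>x\<close>.\<close>

instantiation padic_int :: (prime_card) topological_space
begin

definition open_padic_int :: "'a padic_int set \<Rightarrow> bool" where
  "open_padic_int U \<longleftrightarrow> (\<forall>x\<in>U. \<exists>n. \<forall>y. padic_res y n = padic_res x n \<longrightarrow> y \<in> U)"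

instance
proof
  show "open (UNIV :: 'a padic_int set)"
    by (simp add: open_padic_int_def)
next
  fix S T :: "'a padic_int set"
  assume S: "open S" and T: "open T"
  have mono: "padic_res y m = padic_res x m"
    if "m \<le> n" "padic_res y n = padic_res x n" for x y :: "'a padic_int" and m n
    using that
  proof (induction n rule: dec_induct)
    case (step n)
    have "padic_res z (Suc n) mod int CARD('a) ^ n = padic_res z n" for z :: "'a padic_int"
      by transfer simp
    then show ?case
      using step by metis
  qed
  show "open (S \<inter> T)"
    unfolding open_padic_int_def
  proof
    fix x assume "x \<in> S \<inter> T"
    then obtain m n where "\<forall>y. padic_res y m = padic_res x m \<longrightarrow> y \<in> S"
      and "\<forall>y. padic_res y n = padic_res x n \<longrightarrow> y \<in> T"
      using S T unfolding open_padic_int_def by blast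
    then show "\<exists>k. \<forall>y. padic_res y k = padic_res x k \<longrightarrow> y \<in> S \<inter> T"
      by (intro exI[of _ "max m n"]) (meson IntI max.cobounded1 max.cobounded2 mono)
  qed
next
  fix K :: "'a padic_int set set"
  assume "\<forall>S\<in>K. open S"
  then show "open (\<Union>K)"
    unfolding open_padic_int_def by (meson Union_iff)
qed

end

definition SL :: "('a :: comm_ring_1 ^ 'n ^ 'n) set" where
  "SL = {A. det A = 1}"

text \<open>
  Rows and columns of a \<open>2k \<times> 2k\<close> matrix are indexed by \<open>'k + 'k\<close> with \<open>CARD('k) = k\<close>, so that
  \<open>Inl\<close> and \<open>Inr\<close> select the first and the last \<open>k\<close> of them.
\<close>

definition symplectic_J :: "'a :: comm_ring_1 ^ ('k :: finite + 'k) ^ ('k + 'k)" where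
  "symplectic_J = (\<chi> i j. case (i, j) of
      (Inl a, Inr b) \<Rightarrow> if a = b then 1 else 0
    | (Inr a, Inl b) \<Rightarrow> if a = b then - 1 else 0
    | _ \<Rightarrow> 0)"

definition Sp :: "('a :: comm_ring_1 ^ ('k :: finite + 'k) ^ ('k + 'k)) set" where
  "Sp = {A. invertible A \<and> A ** symplectic_J ** transpose A = symplectic_J}"

text \<open>
  For a compact matrix group \<open>G\<close> over the \<open>p\<close>-adic integers. Regularity is automatic, since
  \<open>G\<close> is then compact and metrizable.
\<close>

definition normalized_haar_measure ::
    "('a :: {topological_space, semiring_1} ^ 'n ^ 'n) set \<Rightarrow> ('a ^ 'n ^ 'n) measure \<Rightarrow> bool" where
  "normalized_haar_measure G \<mu> \<longleftrightarrow>
     space \<mu> = G \<and> sets \<mu> = sets (restrict_space borel G) \<and> emeasure \<mu> G = 1 \<and>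
     (\<forall>g\<in>G. \<forall>B\<in>sets \<mu>. emeasure \<mu> ((\<lambda>x. g ** x) ` B) = emeasure \<mu> B)"

definition triple_product :: "('a :: semiring_1 ^ 'n ^ 'n) set \<Rightarrow> ('a ^ 'n ^ 'n) set" where
  "triple_product A = {a ** b ** c | a b c. a \<in> A \<and> b \<in> A \<and> c \<in> A}"

definition h_SL :: "nat \<Rightarrow> nat \<Rightarrow> real" where
  "h_SL k p = (if k = 2 then (real p - 1) / 2 else real p ^ (k - 1) - real p ^ (k - 2))"

definition h_Sp :: "nat \<Rightarrow> nat \<Rightarrow> real" where
  "h_Sp k p = (real p - 1) / 2 * real p ^ (k - 1)"

end

theory Submission
  imports Defs
begin

text \<open>
  Gowers' argument for quasirandom groups, at each finite level. By inner regularity of Haar measure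
  one may replace \<open>A\<close> by a compact subset of almost the same measure, and by compactness it
  suffices to treat the image of the group in the matrices over \<open>\<int>/p\<^sup>n\<close>. There, left convolution
  with \<open>1\<^sub>A\<close> commutes with right translations. Take a function \<open>f\<close> of mean zero on which it attains
  its norm. Some conjugate of a group \<open>V\<close> of unipotent matrices moves \<open>f\<close>, since these conjugates
  generate the whole group; so a component of \<open>f\<close> at a nontrivial character of \<open>V\<close> is again extremal.
  Elements normalizing \<open>V\<close> conjugate this character to at least \<open>h\<close> others, which forces the square of
  the norm to be at most \<open>|\<Gamma>||A|/h\<close>. Hence if \<open>h|A|\<^sup>3 > |\<Gamma>|\<^sup>3\<close> the convolution \<open>1\<^sub>A * 1\<^sub>A * 1\<^sub>A\<close>
  vanishes nowhere. Comparing characters on \<open>V\<close> replaces the classification of the representations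
  of smallest degree.
\<close>

section \<open>Convolution operators on finite groups\<close>

text \<open>Two points shape the argument. First, the bound must be uniform in the level
  \<open>n\<close>. A nontrivial character modulo \<open>p^n\<close> may have coefficients divisible
  by \<open>p\<close> and then sees its argument only modulo a lower power of \<open>p\<close>.
  Conjugates are therefore told apart by residues modulo \<open>p\<close> alone: if
  \<open>p^n\<close> does not divide \<open>c\<close> and \<open>p\<close> does not divide
  \<open>x - y\<close>, then \<open>c * x\<close> and \<open>c * y\<close> differ modulo
  \<open>p^n\<close>. Second, the conjugating elements must realise the exact constant
  \<open>h\<close>. In \<open>SL_2\<close> the torus multiplies the root coordinate by squares,
  which leaves \<open>(p - 1) / 2\<close> values. For \<open>k \<ge> 3\<close> a third diagonal
  entry restores determinant 1, so all \<open>p - 1\<close> residues occur, and translations by the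
  other \<open>k - 2\<close> coordinates contribute \<open>p^(k - 2)\<close>. In
  \<open>Sp_2k\<close> the long root coordinate is again scaled by squares, and adding combinations
  of the \<open>k - 1\<close> other coordinates contributes \<open>p^(k - 1)\<close>; they enter
  doubled, and 2 is invertible. This handles only characters that are nontrivial on the long root
  coordinate, so for \<open>Sp\<close> only long root elements are treated directly and the rest of
  the group is reached by conjugation.\<close>

definition sq_norm_on :: "'a set \<Rightarrow> ('a \<Rightarrow> complex) \<Rightarrow> real" where
  "sq_norm_on S f = (\<Sum>x\<in>S. (cmod (f x))\<^sup>2)"

definition cinner_on :: "'a set \<Rightarrow> ('a \<Rightarrow> complex) \<Rightarrow> ('a \<Rightarrow> complex) \<Rightarrow> complex" where
  "cinner_on S f g = (\<Sum>x\<in>S. f x * cnj (g x))"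

lemma sq_norm_on_nonneg [simp]: "0 \<le> sq_norm_on S f"
  by (simp add: sq_norm_on_def sum_nonneg)

lemma sq_norm_on_eq_0_iff: "finite S \<Longrightarrow> sq_norm_on S f = 0 \<longleftrightarrow> (\<forall>x\<in>S. f x = 0)"
  by (simp add: sq_norm_on_def sum_nonneg_eq_0_iff)

lemma sq_norm_on_cong: "(\<And>x. x \<in> S \<Longrightarrow> f x = g x) \<Longrightarrow> sq_norm_on S f = sq_norm_on S g"
  by (simp add: sq_norm_on_def)

lemma cinner_on_cong:
  "(\<And>x. x \<in> S \<Longrightarrow> f x = f' x) \<Longrightarrow> (\<And>x. x \<in> S \<Longrightarrow> g x = g' x) \<Longrightarrow> cinner_on S f g = cinner_on S f' g'"
  by (simp add: cinner_on_def)

lemma sq_norm_on_cinner: "complex_of_real (sq_norm_on S f) = cinner_on S f f"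
  by (simp only: sq_norm_on_def cinner_on_def of_real_sum complex_norm_square)

lemma cinner_on_Cauchy_Schwarz:
  "(cmod (cinner_on S f g))\<^sup>2 \<le> sq_norm_on S f * sq_norm_on S g"
proof -
  have "cmod (cinner_on S f g) \<le> (\<Sum>x\<in>S. cmod (f x) * cmod (g x))"
    unfolding cinner_on_def by (rule order_trans[OF norm_sum]) (simp add: norm_mult)
  then have "(cmod (cinner_on S f g))\<^sup>2 \<le> (\<Sum>x\<in>S. cmod (f x) * cmod (g x))\<^sup>2"
    by (simp add: power_mono)
  also have "\<dots> \<le> sq_norm_on S f * sq_norm_on S g"
    unfolding sq_norm_on_def by (rule Cauchy_Schwarz_ineq_sum)
  finally show ?thesis .
qed

lemma cinner_on_sum_left: "cinner_on S (\<lambda>x. \<Sum>i\<in>I. f i x) g = (\<Sum>i\<in>I. cinner_on S (f i) g)"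
  unfolding cinner_on_def by (simp add: sum_distrib_right) (rule sum.swap)

lemma cinner_on_commute: "cinner_on S g f = cnj (cinner_on S f g)"
  by (simp add: cinner_on_def mult.commute)

locale finite_group = group G for G (structure) +
  assumes finite_carrier: "finite (carrier G)"
begin

abbreviation "\<Gamma> \<equiv> carrier G"
abbreviation "sqn \<equiv> sq_norm_on \<Gamma>"

lemma sum_right_mult:
  assumes "l \<in> \<Gamma>"
  shows "(\<Sum>y\<in>\<Gamma>. f (y \<otimes> l)) = (\<Sum>y\<in>\<Gamma>. f y)"
  by (rule sum.reindex_bij_witness[of _ "\<lambda>y. y \<otimes> inv l" "\<lambda>y. y \<otimes> l"])
    (use assms in \<open>auto simp: m_assoc\<close>)

lemma sqn_right_mult: "l \<in> \<Gamma> \<Longrightarrow> sqn (\<lambda>y. f (y \<otimes> l)) = sqn f"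
  unfolding sq_norm_on_def by (rule sum_right_mult)

section \<open>Characters of a subgroup and their isotypic projections\<close>

definition is_char :: "'a set \<Rightarrow> ('a \<Rightarrow> complex) \<Rightarrow> bool" where
  "is_char V \<psi> \<longleftrightarrow> (\<forall>u\<in>V. \<forall>v\<in>V. \<psi> (u \<otimes> v) = \<psi> u * \<psi> v) \<and> (\<forall>v\<in>V. cmod (\<psi> v) = 1)"

text \<open>Characters are total functions, arbitrary outside \<open>V\<close>, so the dual group is
  given by a set of representatives. The cardinality and the orthogonality relation at
  \<open>v \<noteq> \<one>\<close> are what Fourier inversion on \<open>V\<close> uses.\<close>

definition full_dual :: "'a set \<Rightarrow> ('a \<Rightarrow> complex) set \<Rightarrow> bool" where
  "full_dual V X \<longleftrightarrow> finite X \<and> card X = card V \<and> (\<forall>\<psi>\<in>X. is_char V \<psi>) \<and>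
     (\<forall>v\<in>V. v \<noteq> \<one> \<longrightarrow> (\<Sum>\<psi>\<in>X. \<psi> v) = 0)"

text \<open>Right translation makes the functions on \<open>\<Gamma>\<close> a representation of
  \<open>V\<close>; this is the projection onto its \<open>\<psi>\<close>-isotypic part.\<close>

definition char_proj :: "'a set \<Rightarrow> ('a \<Rightarrow> complex) \<Rightarrow> ('a \<Rightarrow> complex) \<Rightarrow> 'a \<Rightarrow> complex" where
  "char_proj V \<psi> f y = (\<Sum>v\<in>V. cnj (\<psi> v) * f (y \<otimes> v)) / of_nat (card V)"

definition left_conv :: "'a set \<Rightarrow> ('a \<Rightarrow> complex) \<Rightarrow> 'a \<Rightarrow> complex" where
  "left_conv A f x = (\<Sum>a\<in>A. f (inv a \<otimes> x))"

definition conv_kernel :: "'a set \<Rightarrow> 'a \<Rightarrow> 'a \<Rightarrow> complex" where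
  "conv_kernel A x y = of_bool (x \<otimes> inv y \<in> A)"

text \<open>\<open>L\<close> is a set of normalizing elements and need not be a subgroup: the trace
  bound only counts the distinct conjugates of \<open>\<psi>\<close> on \<open>V\<close>.\<close>

definition large_orbit :: "nat \<Rightarrow> 'a set \<Rightarrow> ('a \<Rightarrow> complex) \<Rightarrow> bool" where
  "large_orbit h V \<psi> \<longleftrightarrow> (\<exists>L\<subseteq>\<Gamma>. h \<le> card L \<and> (\<forall>l\<in>L. \<forall>v\<in>V. l \<otimes> v \<otimes> inv l \<in> V) \<and>
     (\<forall>l\<in>L. \<forall>l'\<in>L. l \<noteq> l' \<longrightarrow> (\<exists>v\<in>V. \<psi> (l \<otimes> v \<otimes> inv l) \<noteq> \<psi> (l' \<otimes> v \<otimes> inv l'))))"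

text \<open>Characters with \<open>\<psi> u = 1\<close> are exempt, since the corresponding
  components of a function are invariant under \<open>u\<close> anyway; only the other components
  have to be excluded.\<close>

definition has_large_orbits :: "nat \<Rightarrow> 'a \<Rightarrow> bool" where
  "has_large_orbits h u \<longleftrightarrow> (\<exists>V X. subgroup V G \<and> full_dual V X \<and> u \<in> V \<and>
     (\<forall>\<psi>\<in>X. \<psi> u \<noteq> 1 \<longrightarrow> large_orbit h V \<psi>))"

context
  fixes V
  assumes V: "subgroup V G"
begin

lemma subgroup_mem [simp]: "v \<in> V \<Longrightarrow> v \<in> \<Gamma>"
  using V subgroup.subset by blast

lemma subgroup_closed [simp]: "u \<in> V \<Longrightarrow> v \<in> V \<Longrightarrow> u \<otimes> v \<in> V" "u \<in> V \<Longrightarrow> inv u \<in> V" "\<one> \<in> V"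
  using V by (auto simp: subgroup.m_closed subgroup.m_inv_closed subgroup.one_closed)

lemma finite_subgroup [simp]: "finite V"
  using V finite_carrier subgroup.subset finite_subset by blast

lemma card_subgroup_pos [simp]: "card V \<noteq> 0"
  using subgroup_closed(3) finite_subgroup by (metis card_0_eq empty_iff)

lemma sum_subgroup_left: "u \<in> V \<Longrightarrow> (\<Sum>v\<in>V. f (u \<otimes> v)) = (\<Sum>v\<in>V. f v)"
  by (rule sum.reindex_bij_witness[of _ "\<lambda>y. inv u \<otimes> y" "\<lambda>y. u \<otimes> y"])
    (auto simp flip: m_assoc)

lemma sum_subgroup_inv: "(\<Sum>v\<in>V. f (inv v)) = (\<Sum>v\<in>V. f v)"
  by (rule sum.reindex_bij_witness[of _ "\<lambda>y. inv y" "\<lambda>y. inv y"]) auto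

lemma is_char_one:
  assumes "is_char V \<psi>" shows "\<psi> \<one> = 1"
proof -
  have "\<psi> \<one> * \<psi> \<one> = \<psi> \<one>" "cmod (\<psi> \<one>) = 1"
    using assms subgroup_closed(3) unfolding is_char_def by (metis one_closed r_one)+
  then show ?thesis by auto
qed

lemma is_char_inv:
  assumes "is_char V \<psi>" "v \<in> V" shows "\<psi> (inv v) = cnj (\<psi> v)"
proof -
  have "\<psi> (inv v) * \<psi> v = 1"
    using assms is_char_one[OF assms(1)] unfolding is_char_def
    by (metis subgroup_closed(2) l_inv subgroup_mem)
  moreover have "cnj (\<psi> v) * \<psi> v = 1"
    using assms unfolding is_char_def by (simp add: mult.commute flip: complex_norm_square)
  moreover have "\<psi> v \<noteq> 0"
    using assms unfolding is_char_def by force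
  ultimately show ?thesis by (metis mult_right_cancel)
qed

lemma char_proj_translate:
  assumes "is_char V \<psi>" "u \<in> V" "y \<in> \<Gamma>"
  shows "char_proj V \<psi> f (y \<otimes> u) = \<psi> u * char_proj V \<psi> f y"
proof -
  have "(\<Sum>v\<in>V. cnj (\<psi> v) * f (y \<otimes> u \<otimes> v)) = (\<Sum>v\<in>V. cnj (\<psi> (inv u \<otimes> (u \<otimes> v))) * f (y \<otimes> (u \<otimes> v)))"
    using assms by (intro sum.cong) (auto simp: m_assoc simp flip: m_assoc[of "inv u"])
  also have "\<dots> = (\<Sum>v\<in>V. cnj (\<psi> (inv u \<otimes> v)) * f (y \<otimes> v))"
    by (rule sum_subgroup_left) fact
  also have "\<dots> = \<psi> u * (\<Sum>v\<in>V. cnj (\<psi> v) * f (y \<otimes> v))"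
    unfolding sum_distrib_left
  proof (intro sum.cong refl)
    fix v assume "v \<in> V"
    then have "\<psi> (inv u \<otimes> v) = cnj (\<psi> u) * \<psi> v"
      using assms is_char_inv[OF assms(1,2)] unfolding is_char_def by simp
    then show "cnj (\<psi> (inv u \<otimes> v)) * f (y \<otimes> v) = \<psi> u * (cnj (\<psi> v) * f (y \<otimes> v))" by simp
  qed
  finally show ?thesis unfolding char_proj_def by simp
qed

text \<open>Substituting \<open>y \<otimes> inv v\<close> for \<open>y\<close> moves the translation
  to \<open>g\<close>; replacing \<open>v\<close> by its inverse and using
  \<open>\<psi> (inv v) = cnj (\<psi> v)\<close> restores the shape of the projection.\<close>

lemma char_proj_selfadjoint:
  assumes "is_char V \<psi>"
  shows "cinner_on \<Gamma> (char_proj V \<psi> f) g = cinner_on \<Gamma> f (char_proj V \<psi> g)"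
proof -
  have "(\<Sum>y\<in>\<Gamma>. (\<Sum>v\<in>V. cnj (\<psi> v) * f (y \<otimes> v)) * cnj (g y)) =
      (\<Sum>v\<in>V. \<Sum>y\<in>\<Gamma>. cnj (\<psi> v) * f (y \<otimes> v) * cnj (g y))"
    by (simp add: sum_distrib_right) (rule sum.swap)
  also have "\<dots> = (\<Sum>v\<in>V. \<Sum>y\<in>\<Gamma>. cnj (\<psi> v) * f y * cnj (g (y \<otimes> inv v)))"
  proof (rule sum.cong[OF refl])
    fix v assume v: "v \<in> V"
    have "(\<Sum>y\<in>\<Gamma>. cnj (\<psi> v) * f (y \<otimes> v) * cnj (g y)) =
      (\<Sum>y\<in>\<Gamma>. cnj (\<psi> v) * f (y \<otimes> v) * cnj (g (y \<otimes> v \<otimes> inv v)))"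
      using v by (intro sum.cong) (auto simp: m_assoc)
    also have "\<dots> = (\<Sum>y\<in>\<Gamma>. cnj (\<psi> v) * f y * cnj (g (y \<otimes> inv v)))"
      using v by (intro sum_right_mult[where f = "\<lambda>y. cnj (\<psi> v) * f y * cnj (g (y \<otimes> inv v))"]) simp
    finally show "(\<Sum>y\<in>\<Gamma>. cnj (\<psi> v) * f (y \<otimes> v) * cnj (g y)) = (\<Sum>y\<in>\<Gamma>. cnj (\<psi> v) * f y * cnj (g (y \<otimes> inv v)))" .
  qed
  also have "\<dots> = (\<Sum>v\<in>V. \<Sum>y\<in>\<Gamma>. cnj (\<psi> (inv v)) * f y * cnj (g (y \<otimes> v)))"
    by (subst sum_subgroup_inv[symmetric]) simp
  also have "\<dots> = (\<Sum>v\<in>V. \<Sum>y\<in>\<Gamma>. f y * (\<psi> v * cnj (g (y \<otimes> v))))"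
    using is_char_inv[OF assms] by (intro sum.cong refl) simp
  also have "\<dots> = (\<Sum>y\<in>\<Gamma>. f y * cnj (\<Sum>v\<in>V. cnj (\<psi> v) * g (y \<otimes> v)))"
    by (simp add: sum_distrib_left) (rule sum.swap)
  finally show ?thesis
    unfolding cinner_on_def char_proj_def by (simp flip: sum_divide_distrib)
qed

lemma char_proj_fixed:
  assumes "is_char V \<psi>" "y \<in> \<Gamma>" and f: "\<And>v. v \<in> V \<Longrightarrow> f (y \<otimes> v) = \<psi> v * f y"
  shows "char_proj V \<psi> f y = f y"
proof -
  have "(\<Sum>v\<in>V. cnj (\<psi> v) * f (y \<otimes> v)) = (\<Sum>v\<in>V. f y)"
  proof (intro sum.cong refl)
    fix v assume "v \<in> V"
    then have "cnj (\<psi> v) * \<psi> v = 1"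
      using assms unfolding is_char_def by (simp add: mult.commute flip: complex_norm_square)
    then show "cnj (\<psi> v) * f (y \<otimes> v) = f y"
      using f[OF \<open>v \<in> V\<close>] by (simp flip: mult.assoc)
  qed
  then show ?thesis by (simp add: char_proj_def)
qed

lemma char_proj_idem:
  assumes "is_char V \<psi>" "y \<in> \<Gamma>"
  shows "char_proj V \<psi> (char_proj V \<psi> f) y = char_proj V \<psi> f y"
  using assms by (intro char_proj_fixed char_proj_translate)

text \<open>Shifting the summation variable by \<open>u\<close> multiplies the sum of
  \<open>cnj (\<psi> v) * \<phi> v\<close> over \<open>V\<close> by
  \<open>cnj (\<psi> u) * \<phi> u \<noteq> 1\<close>, so that sum is zero.\<close>

lemma char_proj_orth:
  assumes \<psi>: "is_char V \<psi>" and \<phi>: "is_char V \<phi>" and u: "u \<in> V" "\<psi> u \<noteq> \<phi> u" and y: "y \<in> \<Gamma>"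
  shows "char_proj V \<psi> (char_proj V \<phi> f) y = 0"
proof -
  have "char_proj V \<psi> (char_proj V \<phi> f) y =
      (\<Sum>v\<in>V. cnj (\<psi> v) * \<phi> v) * char_proj V \<phi> f y / of_nat (card V)"
    unfolding char_proj_def[of V \<psi>] sum_distrib_right
    using char_proj_translate[OF \<phi> _ y] by (simp add: mult.assoc)
  moreover have "(\<Sum>v\<in>V. cnj (\<psi> v) * \<phi> v) = 0"
  proof -
    let ?s = "\<Sum>v\<in>V. cnj (\<psi> v) * \<phi> v"
    have "?s = (\<Sum>v\<in>V. cnj (\<psi> (u \<otimes> v)) * \<phi> (u \<otimes> v))"
      by (rule sum_subgroup_left[symmetric]) fact
    also have "\<dots> = cnj (\<psi> u) * \<phi> u * ?s"
      using \<psi> \<phi> u unfolding is_char_def sum_distrib_left by (intro sum.cong) auto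
    finally have "(1 - cnj (\<psi> u) * \<phi> u) * ?s = 0"
      by (simp add: algebra_simps)
    moreover have "1 - cnj (\<psi> u) * \<phi> u \<noteq> 0"
    proof
      assume "1 - cnj (\<psi> u) * \<phi> u = 0"
      then have "\<psi> u * (cnj (\<psi> u) * \<phi> u) = \<psi> u" by simp
      moreover have "\<psi> u * cnj (\<psi> u) = 1"
        using \<psi> u unfolding is_char_def by (simp flip: complex_norm_square)
      ultimately show False using u(2) by (simp flip: mult.assoc)
    qed
    ultimately show ?thesis by simp
  qed
  ultimately show ?thesis by simp
qed

lemma sqn_char_proj:
  assumes "is_char V \<psi>"
  shows "complex_of_real (sqn (char_proj V \<psi> f)) = cinner_on \<Gamma> (char_proj V \<psi> f) f"
  unfolding sq_norm_on_cinner char_proj_selfadjoint[OF assms]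
  using assms by (simp add: char_proj_selfadjoint[symmetric] char_proj_idem cong: cinner_on_cong)

text \<open>Fourier inversion on \<open>V\<close>: after exchanging the sums, orthogonality leaves
  only the term \<open>v = \<one>\<close>.\<close>

lemma char_proj_sum:
  assumes "full_dual V X" "y \<in> \<Gamma>"
  shows "(\<Sum>\<psi>\<in>X. char_proj V \<psi> f y) = f y"
proof -
  have X: "finite X" "\<And>\<psi>. \<psi> \<in> X \<Longrightarrow> is_char V \<psi>" "card X = card V"
    "\<And>v. v \<in> V \<Longrightarrow> v \<noteq> \<one> \<Longrightarrow> (\<Sum>\<psi>\<in>X. \<psi> v) = 0"
    using assms(1) unfolding full_dual_def by auto
  have "(\<Sum>\<psi>\<in>X. \<Sum>v\<in>V. cnj (\<psi> v) * f (y \<otimes> v)) = (\<Sum>v\<in>V. cnj (\<Sum>\<psi>\<in>X. \<psi> v) * f (y \<otimes> v))"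
    by (simp add: sum_distrib_right) (rule sum.swap)
  also have "\<dots> = (\<Sum>v\<in>V. if v = \<one> then of_nat (card V) * f y else 0)"
  proof (intro sum.cong refl)
    fix v assume v: "v \<in> V"
    show "cnj (\<Sum>\<psi>\<in>X. \<psi> v) * f (y \<otimes> v) = (if v = \<one> then of_nat (card V) * f y else 0)"
      using X(2) X(4)[OF v] assms(2) by (simp add: is_char_one X(3) del: cnj_sum)
  qed
  also have "\<dots> = of_nat (card V) * f y" by simp
  finally show ?thesis
    by (simp add: char_proj_def flip: sum_divide_distrib)
qed

lemma sqn_Parseval:
  assumes "full_dual V X"
  shows "sqn f = (\<Sum>\<psi>\<in>X. sqn (char_proj V \<psi> f))"
proof -
  have "complex_of_real (sqn f) = cinner_on \<Gamma> (\<lambda>y. \<Sum>\<psi>\<in>X. char_proj V \<psi> f y) f"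
    unfolding sq_norm_on_cinner using char_proj_sum[OF assms] by (simp cong: cinner_on_cong)
  also have "\<dots> = complex_of_real (\<Sum>\<psi>\<in>X. sqn (char_proj V \<psi> f))"
    using assms unfolding cinner_on_sum_left full_dual_def by (simp add: sqn_char_proj)
  finally show ?thesis by (simp only: of_real_eq_iff)
qed

text \<open>It will be applied to the conjugates of one character, which need not be members of the
  set in a \<open>full_dual\<close>; hence an indexed family and an inequality instead of Parseval.
  The sum \<open>g\<close> of the projections has the same inner product with \<open>f\<close> as
  with itself, so \<open>f - g\<close> has squared norm \<open>sqn f\<close> minus the left-hand
  side.\<close>

lemma sqn_Bessel:
  assumes I: "finite I" and \<psi>: "\<And>i. i \<in> I \<Longrightarrow> is_char V (\<psi> i)"
    and dist: "\<And>i j. i \<in> I \<Longrightarrow> j \<in> I \<Longrightarrow> i \<noteq> j \<Longrightarrow> \<exists>v\<in>V. \<psi> i v \<noteq> \<psi> j v"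
  shows "(\<Sum>i\<in>I. sqn (char_proj V (\<psi> i) f)) \<le> sqn f"
proof -
  define g where "g = (\<lambda>y. \<Sum>i\<in>I. char_proj V (\<psi> i) f y)"
  let ?S = "\<Sum>i\<in>I. sqn (char_proj V (\<psi> i) f)"
  have gf: "cinner_on \<Gamma> g f = complex_of_real ?S"
    unfolding g_def cinner_on_sum_left using \<psi> by (simp add: sqn_char_proj)
  have "cinner_on \<Gamma> (char_proj V (\<psi> i) f) g = complex_of_real (sqn (char_proj V (\<psi> i) f))" if i: "i \<in> I" for i
  proof -
    have "cinner_on \<Gamma> (char_proj V (\<psi> i) f) (char_proj V (\<psi> j) f) =
        (if i = j then complex_of_real (sqn (char_proj V (\<psi> i) f)) else 0)" if j: "j \<in> I" for j
    proof (cases "i = j")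
      case False
      then obtain v where v: "v \<in> V" "\<psi> i v \<noteq> \<psi> j v" using dist i j by blast
      have "cinner_on \<Gamma> (char_proj V (\<psi> i) f) (char_proj V (\<psi> j) f) =
        cinner_on \<Gamma> f (char_proj V (\<psi> i) (char_proj V (\<psi> j) f))"
        using \<psi>[OF i] by (rule char_proj_selfadjoint)
      also have "\<dots> = cinner_on \<Gamma> f (\<lambda>_. 0)"
        using char_proj_orth[OF \<psi>[OF i] \<psi>[OF j] v] by (simp cong: cinner_on_cong)
      finally show ?thesis using False by (simp add: cinner_on_def)
    qed (simp add: sq_norm_on_cinner)
    then have "(\<Sum>j\<in>I. cinner_on \<Gamma> (char_proj V (\<psi> j) f) (char_proj V (\<psi> i) f)) =
        complex_of_real (sqn (char_proj V (\<psi> i) f))"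
      using i I by (subst cinner_on_commute) (simp flip: cnj_sum)
    then show ?thesis
      unfolding g_def by (subst cinner_on_commute) (simp add: cinner_on_sum_left)
  qed
  then have "cinner_on \<Gamma> (\<lambda>y. \<Sum>i\<in>I. char_proj V (\<psi> i) f y) g = complex_of_real ?S"
    unfolding cinner_on_sum_left by simp
  then have gg: "cinner_on \<Gamma> g g = complex_of_real ?S"
    by (simp only: g_def[symmetric])
  have "complex_of_real (sqn (\<lambda>y. f y - g y)) =
      cinner_on \<Gamma> f f - cnj (cinner_on \<Gamma> g f) - cinner_on \<Gamma> g f + cinner_on \<Gamma> g g"
    unfolding sq_norm_on_cinner cinner_on_commute[of _ g f, symmetric]
    by (simp add: cinner_on_def algebra_simps sum.distrib sum_subtractf)
  also have "\<dots> = complex_of_real (sqn f - ?S)"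
    unfolding gf gg by (simp flip: sq_norm_on_cinner)
  finally have "sqn (\<lambda>y. f y - g y) = sqn f - ?S" by (simp only: of_real_eq_iff)
  then show ?thesis using sq_norm_on_nonneg[of \<Gamma> "\<lambda>y. f y - g y"] by simp
qed

lemma char_proj_left_conv:
  assumes "A \<subseteq> \<Gamma>" "x \<in> \<Gamma>"
  shows "char_proj V \<psi> (left_conv A f) x = left_conv A (char_proj V \<psi> f) x"
proof -
  have "(\<Sum>v\<in>V. cnj (\<psi> v) * (\<Sum>a\<in>A. f (inv a \<otimes> (x \<otimes> v)))) =
      (\<Sum>a\<in>A. \<Sum>v\<in>V. cnj (\<psi> v) * f (inv a \<otimes> (x \<otimes> v)))"
    by (simp add: sum_distrib_left) (rule sum.swap)
  also have "\<dots> = (\<Sum>a\<in>A. \<Sum>v\<in>V. cnj (\<psi> v) * f (inv a \<otimes> x \<otimes> v))"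
    using assms by (intro sum.cong refl) (auto simp: m_assoc subset_iff)
  finally show ?thesis
    unfolding char_proj_def left_conv_def by (simp flip: sum_divide_distrib)
qed

text \<open>Right translation by \<open>l\<close> carries the component of \<open>\<psi>\<close> to
  that of its conjugate; this is why all characters of an orbit carry equal weight.\<close>

lemma char_proj_conj:
  assumes l: "l \<in> \<Gamma>" "\<And>v. v \<in> V \<Longrightarrow> l \<otimes> v \<otimes> inv l \<in> V" and y: "y \<in> \<Gamma>"
  shows "char_proj V (\<lambda>v. \<psi> (l \<otimes> v \<otimes> inv l)) f y = char_proj V \<psi> (\<lambda>z. f (z \<otimes> l)) (y \<otimes> inv l)"
proof -
  have inj: "inj_on (\<lambda>v. l \<otimes> v \<otimes> inv l) V"
    using l(1) by (auto simp: inj_on_def)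
  \<comment> \<open>An injective self-map of the finite set \<open>V\<close> is onto, so conjugation
    by \<open>l\<close> merely permutes the terms of the sum over \<open>V\<close>.\<close>
  have "(\<lambda>v. l \<otimes> v \<otimes> inv l) ` V = V"
    by (rule endo_inj_surj) (use l inj in auto)
  then have "(\<Sum>v\<in>V. cnj (\<psi> v) * f (y \<otimes> inv l \<otimes> v \<otimes> l)) =
      (\<Sum>v\<in>V. cnj (\<psi> (l \<otimes> v \<otimes> inv l)) * f (y \<otimes> inv l \<otimes> (l \<otimes> v \<otimes> inv l) \<otimes> l))"
    using sum.reindex[OF inj, of "\<lambda>v. cnj (\<psi> v) * f (y \<otimes> inv l \<otimes> v \<otimes> l)"] by (simp add: o_def)
  moreover have "y \<otimes> inv l \<otimes> (l \<otimes> v \<otimes> inv l) \<otimes> l = y \<otimes> v" if "v \<in> V" for v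
  proof -
    have "y \<otimes> inv l \<otimes> (l \<otimes> v \<otimes> inv l) \<otimes> l = y \<otimes> (inv l \<otimes> l) \<otimes> v \<otimes> (inv l \<otimes> l)"
      using that l(1) y by (simp only: m_assoc inv_closed m_closed subgroup_mem)
    then show ?thesis using that l(1) y by simp
  qed
  ultimately show ?thesis unfolding char_proj_def by simp
qed

end

section \<open>The convolution operator and its Hilbert-Schmidt norm\<close>

lemma left_conv_kernel:
  assumes "A \<subseteq> \<Gamma>" "x \<in> \<Gamma>"
  shows "left_conv A f x = cinner_on \<Gamma> f (conv_kernel A x)"
proof -
  have "cinner_on \<Gamma> f (conv_kernel A x) = (\<Sum>y\<in>{y\<in>\<Gamma>. x \<otimes> inv y \<in> A}. f y)"
    unfolding cinner_on_def conv_kernel_def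
    by (intro sum.mono_neutral_cong_right) (auto simp: finite_carrier)
  also have "\<dots> = (\<Sum>a\<in>A. f (inv a \<otimes> x))"
    by (rule sum.reindex_bij_witness[of _ "\<lambda>a. inv a \<otimes> x" "\<lambda>y. x \<otimes> inv y"])
      (use assms in \<open>auto simp: inv_mult_group subset_iff m_assoc simp flip: m_assoc[of "x"]\<close>)
  finally show ?thesis by (simp add: left_conv_def)
qed

lemma sqn_conv_kernel:
  assumes "A \<subseteq> \<Gamma>" "x \<in> \<Gamma>"
  shows "sqn (conv_kernel A x) = card A"
proof -
  have "sqn (conv_kernel A x) = (\<Sum>y\<in>{y\<in>\<Gamma>. x \<otimes> inv y \<in> A}. 1)"
    unfolding sq_norm_on_def conv_kernel_def
    by (intro sum.mono_neutral_cong_right) (auto simp: finite_carrier)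
  also have "\<dots> = (\<Sum>a\<in>A. 1)"
    by (rule sum.reindex_bij_witness[of _ "\<lambda>a. inv a \<otimes> x" "\<lambda>y. x \<otimes> inv y"])
      (use assms in \<open>auto simp: inv_mult_group subset_iff m_assoc simp flip: m_assoc[of "x"]\<close>)
  finally show ?thesis by simp
qed

lemma left_conv_right_mult:
  "A \<subseteq> \<Gamma> \<Longrightarrow> x \<in> \<Gamma> \<Longrightarrow> l \<in> \<Gamma> \<Longrightarrow> left_conv A f (x \<otimes> l) = left_conv A (\<lambda>y. f (y \<otimes> l)) x"
  unfolding left_conv_def by (intro sum.cong) (auto simp: m_assoc)

text \<open>
  The squared Hilbert--Schmidt norm of the convolution operator is \<open>|\<Gamma>||A|\<close>, and the isotypic
  components along an orbit of characters contribute equally to it.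
\<close>

lemma left_conv_bound_of_orbit:
  assumes V: "subgroup V G" and \<psi>: "is_char V \<psi>" and A: "A \<subseteq> \<Gamma>"
    and L: "L \<subseteq> \<Gamma>" "\<And>l v. l \<in> L \<Longrightarrow> v \<in> V \<Longrightarrow> l \<otimes> v \<otimes> inv l \<in> V"
      "\<And>l l'. l \<in> L \<Longrightarrow> l' \<in> L \<Longrightarrow> l \<noteq> l' \<Longrightarrow> \<exists>v\<in>V. \<psi> (l \<otimes> v \<otimes> inv l) \<noteq> \<psi> (l' \<otimes> v \<otimes> inv l')"
    and f: "\<And>y. y \<in> \<Gamma> \<Longrightarrow> char_proj V \<psi> f y = f y"
  shows "card L * sqn (left_conv A f) \<le> card \<Gamma> * card A * sqn f"
proof -
  \<comment> \<open>The squared Hilbert-Schmidt norm of the operator restricted to the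
    \<open>\<psi>\<close>-isotypic functions. It bounds the squared operator norm there.\<close>
  define S where "S = (\<Sum>x\<in>\<Gamma>. sqn (char_proj V \<psi> (conv_kernel A x)))"
  have finL: "finite L" using L(1) finite_carrier finite_subset by blast
  have "(cmod (left_conv A f x))\<^sup>2 \<le> sqn f * sqn (char_proj V \<psi> (conv_kernel A x))" if x: "x \<in> \<Gamma>" for x
  proof -
    have "left_conv A f x = cinner_on \<Gamma> (char_proj V \<psi> f) (conv_kernel A x)"
      using f by (simp add: left_conv_kernel[OF A x] cong: cinner_on_cong)
    also have "\<dots> = cinner_on \<Gamma> f (char_proj V \<psi> (conv_kernel A x))"
      by (rule char_proj_selfadjoint[OF V \<psi>])
    finally show ?thesis using cinner_on_Cauchy_Schwarz by metis
  qed
  then have "sqn (left_conv A f) \<le> sqn f * S"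
    unfolding S_def sum_distrib_left sq_norm_on_def[of _ "left_conv A f"] by (intro sum_mono) auto
  moreover have "card L * S \<le> card \<Gamma> * card A"
  proof -
    let ?\<psi> = "\<lambda>l v. \<psi> (l \<otimes> v \<otimes> inv l)"
    have char: "is_char V (?\<psi> l)" if l: "l \<in> L" for l
      unfolding is_char_def
    proof (intro conjI ballI)
      fix u v assume uv: "u \<in> V" "v \<in> V"
      have [simp]: "l \<in> \<Gamma>" "u \<in> \<Gamma>" "v \<in> \<Gamma>" using uv l L(1) subgroup_mem[OF V] by auto
      have "l \<otimes> (u \<otimes> v) \<otimes> inv l = (l \<otimes> u \<otimes> inv l) \<otimes> (l \<otimes> v \<otimes> inv l)"
        by (simp add: m_assoc) (simp add: m_assoc[symmetric, of "inv l" l])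
      then show "\<psi> (l \<otimes> (u \<otimes> v) \<otimes> inv l) = \<psi> (l \<otimes> u \<otimes> inv l) * \<psi> (l \<otimes> v \<otimes> inv l)"
        using L(2)[OF l] uv \<psi> unfolding is_char_def by metis
    qed (use \<psi> L(2)[OF l] in \<open>auto simp: is_char_def\<close>)
    \<comment> \<open>Moving \<open>l\<close> from the argument into the kernel replaces row
      \<open>x\<close> by row \<open>x \<otimes> inv l\<close>, and the sum over all rows absorbs
      this shift.\<close>
    have "S = (\<Sum>x\<in>\<Gamma>. sqn (char_proj V (?\<psi> l) (conv_kernel A x)))" if l: "l \<in> L" for l
    proof -
      have [simp]: "l \<in> \<Gamma>" using l L(1) by auto
      have "sqn (char_proj V (?\<psi> l) (conv_kernel A x)) = sqn (char_proj V \<psi> (conv_kernel A (x \<otimes> inv l)))"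
        if x: "x \<in> \<Gamma>" for x
      proof -
        have "sqn (char_proj V (?\<psi> l) (conv_kernel A x)) =
            sqn (\<lambda>y. char_proj V \<psi> (\<lambda>z. conv_kernel A x (z \<otimes> l)) (y \<otimes> inv l))"
          using char_proj_conj[OF V _ L(2)[OF l]] by (intro sq_norm_on_cong) simp
        also have "\<dots> = sqn (char_proj V \<psi> (\<lambda>z. conv_kernel A x (z \<otimes> l)))"
          by (rule sqn_right_mult) simp
        also have "\<dots> = sqn (char_proj V \<psi> (conv_kernel A (x \<otimes> inv l)))"
        proof (intro sq_norm_on_cong)
          fix y assume y: "y \<in> \<Gamma>"
          have "conv_kernel A x (y \<otimes> v \<otimes> l) = conv_kernel A (x \<otimes> inv l) (y \<otimes> v)" if "v \<in> V" for v
            using that x y subgroup_mem[OF V that] by (simp add: conv_kernel_def inv_mult_group m_assoc)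
          then show "char_proj V \<psi> (\<lambda>z. conv_kernel A x (z \<otimes> l)) y = char_proj V \<psi> (conv_kernel A (x \<otimes> inv l)) y"
            by (simp add: char_proj_def)
        qed
        finally show ?thesis .
      qed
      then show ?thesis
        using sum_right_mult[of "inv l" "\<lambda>x. sqn (char_proj V \<psi> (conv_kernel A x))"]
        unfolding S_def by simp
    qed
    then have "(\<Sum>l\<in>L. S) = (\<Sum>l\<in>L. \<Sum>x\<in>\<Gamma>. sqn (char_proj V (?\<psi> l) (conv_kernel A x)))"
      by (intro sum.cong refl)
    then have "card L * S = (\<Sum>l\<in>L. \<Sum>x\<in>\<Gamma>. sqn (char_proj V (?\<psi> l) (conv_kernel A x)))"
      by simp
    also have "\<dots> = (\<Sum>x\<in>\<Gamma>. \<Sum>l\<in>L. sqn (char_proj V (?\<psi> l) (conv_kernel A x)))"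
      by (rule sum.swap)
    also have "\<dots> \<le> (\<Sum>x\<in>\<Gamma>. sqn (conv_kernel A x))"
      using L char finL by (intro sum_mono sqn_Bessel[OF V])
    finally show ?thesis by (simp add: sqn_conv_kernel[OF A])
  qed
  ultimately have "card L * sqn (left_conv A f) \<le> card L * (sqn f * S)"
    by (intro mult_left_mono) auto
  also have "\<dots> \<le> card \<Gamma> * card A * sqn f"
    using mult_right_mono[OF \<open>card L * S \<le> card \<Gamma> * card A\<close>, of "sqn f"] by (simp add: ac_simps)
  finally show ?thesis .
qed

section \<open>Extremal functions of mean zero\<close>

definition conv_maximizer :: "'a set \<Rightarrow> ('a \<Rightarrow> complex) \<Rightarrow> bool" where
  "conv_maximizer A f \<longleftrightarrow> (\<Sum>x\<in>\<Gamma>. f x) = 0 \<and> sqn f = 1 \<and>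
     (\<forall>g. (\<Sum>x\<in>\<Gamma>. g x) = 0 \<longrightarrow> sqn (left_conv A g) \<le> sqn (left_conv A f) * sqn g)"

lemma left_conv_scale: "left_conv A (\<lambda>x. c * f x) x = c * left_conv A f x"
  by (simp add: left_conv_def sum_distrib_left)

lemma left_conv_cong:
  assumes "A \<subseteq> \<Gamma>" "x \<in> \<Gamma>" "\<And>y. y \<in> \<Gamma> \<Longrightarrow> f y = g y" shows "left_conv A f x = left_conv A g x"
  unfolding left_conv_def using assms by (intro sum.cong) auto

lemma sqn_scale: "sqn (\<lambda>x. c * f x) = (cmod c)\<^sup>2 * sqn f"
  by (simp add: sq_norm_on_def norm_mult power_mult_distrib sum_distrib_left)

text \<open>Total functions carry the product topology. Values in the unit disc on
  \<open>\<Gamma>\<close> and \<open>0\<close> outside give a compact set by Tychonoff, in which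
  norm 1 and mean zero are closed conditions. The function \<open>g0\<close> shows that the
  resulting sphere is nonempty; for the trivial group it would be empty.\<close>

lemma conv_maximizer_exists:
  assumes A: "A \<subseteq> \<Gamma>" and g0: "(\<Sum>x\<in>\<Gamma>. g0 x) = 0" "sqn g0 \<noteq> 0"
  shows "\<exists>f. conv_maximizer A f"
proof -
  define D :: "('a \<Rightarrow> complex) set" where "D = PiE UNIV (\<lambda>x. if x \<in> \<Gamma> then cball 0 1 else {0})"
  define S where "S = D \<inter> {f. (\<Sum>x\<in>\<Gamma>. f x) = 0} \<inter> {f. sqn f = 1}"
  have coord: "continuous_on UNIV (\<lambda>f::'a \<Rightarrow> complex. f x)" for x by simp
  have D: "compact D"
  proof -
    have "compactin (product_topology (\<lambda>_. euclidean) UNIV) D"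
      unfolding D_def compactin_PiE by auto
    then show ?thesis by (simp add: euclidean_product_topology)
  qed
  have 1: "closed {f::'a \<Rightarrow> complex. (\<Sum>x\<in>\<Gamma>. f x) = 0}"
    by (intro closed_Collect_eq continuous_intros coord)
  have 2: "closed {f::'a \<Rightarrow> complex. sqn f = 1}"
    unfolding sq_norm_on_def by (intro closed_Collect_eq continuous_intros coord)
  have S: "compact S"
    unfolding S_def using D 1 2 by (intro compact_Int_closed)
  have norm: "\<exists>f\<in>S. \<exists>c>0. \<forall>x\<in>\<Gamma>. g x = complex_of_real c * f x"
    if g: "(\<Sum>x\<in>\<Gamma>. g x) = 0" "sqn g \<noteq> 0" for g
  proof -
    define c where "c = sqrt (sqn g)"
    have c: "c > 0" "c\<^sup>2 = sqn g" using g(2) sq_norm_on_nonneg[of \<Gamma> g] by (auto simp: c_def less_le)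
    define f where "f = (\<lambda>x. if x \<in> \<Gamma> then complex_of_real (1/c) * g x else 0)"
    have "sqn f = sqn (\<lambda>x. complex_of_real (1/c) * g x)"
      by (intro sq_norm_on_cong) (simp add: f_def)
    then have sq: "sqn f = 1" using c g(2) by (simp add: sqn_scale power_divide del: of_real_divide)
    have "cmod (f x) \<le> 1" if "x \<in> \<Gamma>" for x
    proof -
      have "(cmod (f x))\<^sup>2 \<le> sqn f"
        unfolding sq_norm_on_def using that finite_carrier by (intro member_le_sum) auto
      then show ?thesis using sq by (simp add: power_le_one_iff abs_square_le_1)
    qed
    then have "f \<in> D" by (auto simp: D_def f_def)
    moreover have "(\<Sum>x\<in>\<Gamma>. f x) = complex_of_real (1/c) * (\<Sum>x\<in>\<Gamma>. g x)"
      unfolding sum_distrib_left f_def by (intro sum.cong) auto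
    ultimately have "f \<in> S" using sq g(1) by (simp add: S_def)
    moreover have "\<forall>x\<in>\<Gamma>. g x = complex_of_real c * f x" using c(1) by (simp add: f_def)
    ultimately show ?thesis using c(1) by blast
  qed
  have "S \<noteq> {}" using norm[OF g0] by blast
  moreover have "continuous_on S (\<lambda>f. sqn (left_conv A f))"
    unfolding sq_norm_on_def left_conv_def
    by (intro continuous_intros continuous_on_subset[OF coord]) auto
  ultimately obtain f where f: "f \<in> S" "\<And>g. g \<in> S \<Longrightarrow> sqn (left_conv A g) \<le> sqn (left_conv A f)"
    using continuous_attains_sup[OF S] by blast
  have "sqn (left_conv A g) \<le> sqn (left_conv A f) * sqn g" if g: "(\<Sum>x\<in>\<Gamma>. g x) = 0" for g
  proof (cases "sqn g = 0")
    case True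
    then have "\<forall>x\<in>\<Gamma>. g x = 0" using sq_norm_on_eq_0_iff[OF finite_carrier] by blast
    then have "sqn (left_conv A g) = sqn (left_conv A (\<lambda>_. 0))"
      using A by (intro sq_norm_on_cong left_conv_cong) auto
    also have "\<dots> = 0" by (simp add: left_conv_def sq_norm_on_def)
    finally show ?thesis using True by simp
  next
    case False
    then obtain f' c where f': "f' \<in> S" "c > 0" "\<forall>x\<in>\<Gamma>. g x = complex_of_real c * f' x"
      using norm[OF g] by blast
    have "sqn (left_conv A g) = sqn (\<lambda>x. complex_of_real c * left_conv A f' x)"
      using left_conv_cong[OF A, of _ g "\<lambda>x. complex_of_real c * f' x"] f'(3)
      by (intro sq_norm_on_cong) (simp add: left_conv_scale)
    moreover have "sqn g = sqn (\<lambda>x. complex_of_real c * f' x)"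
      using f'(3) by (intro sq_norm_on_cong) simp
    ultimately show ?thesis using f(2)[OF f'(1)] f'(1) by (simp add: sqn_scale S_def)
      (simp add: mult.commute mult_left_mono)
  qed
  then show ?thesis using f(1) unfolding conv_maximizer_def S_def by blast
qed

lemma conv_maximizer_right_mult:
  assumes A: "A \<subseteq> \<Gamma>" and f: "conv_maximizer A f" and l: "l \<in> \<Gamma>"
  shows "conv_maximizer A (\<lambda>y. f (y \<otimes> l))"
    and "sqn (left_conv A (\<lambda>y. f (y \<otimes> l))) = sqn (left_conv A f)"
proof -
  have "sqn (left_conv A (\<lambda>y. f (y \<otimes> l))) = sqn (\<lambda>y. left_conv A f (y \<otimes> l))"
    using A l by (intro sq_norm_on_cong) (simp add: left_conv_right_mult)
  then show *: "sqn (left_conv A (\<lambda>y. f (y \<otimes> l))) = sqn (left_conv A f)"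
    using l by (simp add: sqn_right_mult)
  show "conv_maximizer A (\<lambda>y. f (y \<otimes> l))"
    using f l unfolding conv_maximizer_def * by (simp add: sum_right_mult sqn_right_mult)
qed

text \<open>The defects \<open>?m * sqn (char_proj V \<psi> f) - sqn (left_conv A (char_proj V
  \<psi> f))\<close> are nonnegative and by Parseval add up to the defect of \<open>f\<close>, which
  is zero. So every nonzero component is extremal, and if \<open>\<psi> u \<noteq> 1\<close> this
  contradicts \<open>left_conv_bound_of_orbit\<close>. The surviving components are fixed by
  \<open>u\<close>.\<close>

lemma conv_maximizer_invariant:
  assumes A: "A \<subseteq> \<Gamma>" and f: "conv_maximizer A f" and u: "has_large_orbits h u"
    and big: "card \<Gamma> * card A < h * sqn (left_conv A f)" and y: "y \<in> \<Gamma>"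
  shows "f (y \<otimes> u) = f y"
proof -
  let ?m = "sqn (left_conv A f)"
  obtain V X where V: "subgroup V G" and X: "full_dual V X" and uV: "u \<in> V"
    and orb: "\<And>\<psi>. \<psi> \<in> X \<Longrightarrow> \<psi> u \<noteq> 1 \<Longrightarrow> large_orbit h V \<psi>"
    using u unfolding has_large_orbits_def by blast
  have char: "is_char V \<psi>" if "\<psi> \<in> X" for \<psi> using X that unfolding full_dual_def by blast
  have finX: "finite X" using X unfolding full_dual_def by blast
  \<comment> \<open>Maximality of \<open>f\<close> compares only with functions of mean zero, so
    this is needed for every component, including that of the trivial character.\<close>
  have "(\<Sum>y\<in>\<Gamma>. char_proj V \<psi> f y) = 0" for \<psi>
  proof -
    have "(\<Sum>y\<in>\<Gamma>. \<Sum>v\<in>V. cnj (\<psi> v) * f (y \<otimes> v)) = (\<Sum>v\<in>V. cnj (\<psi> v) * (\<Sum>y\<in>\<Gamma>. f (y \<otimes> v)))"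
      unfolding sum_distrib_left by (rule sum.swap)
    also have "\<dots> = 0"
      using f sum_right_mult[of _ f] subgroup_mem[OF V] unfolding conv_maximizer_def by simp
    finally show ?thesis by (simp add: char_proj_def flip: sum_divide_distrib)
  qed
  then have le: "sqn (left_conv A (char_proj V \<psi> f)) \<le> ?m * sqn (char_proj V \<psi> f)" for \<psi>
    using f unfolding conv_maximizer_def by blast
  have "(\<Sum>\<psi>\<in>X. ?m * sqn (char_proj V \<psi> f) - sqn (left_conv A (char_proj V \<psi> f))) =
      ?m * sqn f - (\<Sum>\<psi>\<in>X. sqn (char_proj V \<psi> (left_conv A f)))"
    unfolding sum_subtractf sqn_Parseval[OF V X, of f] sum_distrib_left
    by (simp add: char_proj_left_conv[OF V A] cong: sq_norm_on_cong)
  also have "\<dots> = 0"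
    using f unfolding sqn_Parseval[OF V X, of "left_conv A f", symmetric] conv_maximizer_def by simp
  finally have eq: "sqn (left_conv A (char_proj V \<psi> f)) = ?m * sqn (char_proj V \<psi> f)" if "\<psi> \<in> X" for \<psi>
    using le that by (subst (asm) sum_nonneg_eq_0_iff[OF finX]) auto
  have zero: "sqn (char_proj V \<psi> f) = 0" if \<psi>: "\<psi> \<in> X" "\<psi> u \<noteq> 1" for \<psi>
  proof (rule ccontr)
    assume "sqn (char_proj V \<psi> f) \<noteq> 0"
    then have pos: "sqn (char_proj V \<psi> f) > 0" by (simp add: less_le)
    obtain L where L: "L \<subseteq> \<Gamma>" "h \<le> card L" "\<forall>l\<in>L. \<forall>v\<in>V. l \<otimes> v \<otimes> inv l \<in> V"
      "\<forall>l\<in>L. \<forall>l'\<in>L. l \<noteq> l' \<longrightarrow> (\<exists>v\<in>V. \<psi> (l \<otimes> v \<otimes> inv l) \<noteq> \<psi> (l' \<otimes> v \<otimes> inv l'))"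
      using orb[OF \<psi>] unfolding large_orbit_def by (elim exE conjE) (rule that; assumption)
    have "card L * ?m * sqn (char_proj V \<psi> f) \<le> card \<Gamma> * card A * sqn (char_proj V \<psi> f)"
      using left_conv_bound_of_orbit[OF V char[OF \<psi>(1)] A L(1) L(3,4)[rule_format] char_proj_idem[OF V char[OF \<psi>(1)], of _ f]]
      by (simp add: eq[OF \<psi>(1)] mult.assoc)
    then have "card L * ?m \<le> card \<Gamma> * card A" using pos by simp
    moreover have "h * ?m \<le> card L * ?m" using L(2) by (intro mult_right_mono) auto
    ultimately show False using big by simp
  qed
  have yu: "y \<otimes> u \<in> \<Gamma>" using y uV subgroup_mem[OF V] by simp
  have "f (y \<otimes> u) = (\<Sum>\<psi>\<in>X. char_proj V \<psi> f (y \<otimes> u))"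
    using char_proj_sum[OF V X yu] by simp
  also have "\<dots> = (\<Sum>\<psi>\<in>X. char_proj V \<psi> f y)"
  proof (intro sum.cong refl)
    fix \<psi> assume \<psi>: "\<psi> \<in> X"
    show "char_proj V \<psi> f (y \<otimes> u) = char_proj V \<psi> f y"
    proof (cases "\<psi> u = 1")
      case True
      then show ?thesis using char_proj_translate[OF V char[OF \<psi>] uV y] by simp
    next
      case False
      then have "\<forall>x\<in>\<Gamma>. char_proj V \<psi> f x = 0"
        using zero[OF \<psi>] sq_norm_on_eq_0_iff[OF finite_carrier] by blast
      then show ?thesis using y yu by simp
    qed
  qed
  also have "\<dots> = f y" by (rule char_proj_sum[OF V X y])
  finally show ?thesis .
qed

text \<open>A submonoid of a finite group that is stable under conjugation is a normal subgroup. The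
  condition therefore says that the normal closure of the elements with large orbits is the whole
  group.\<close>

definition normally_generated_by_large_orbits :: "nat \<Rightarrow> bool" where
  "normally_generated_by_large_orbits h \<longleftrightarrow> (\<forall>N\<subseteq>\<Gamma>. \<one> \<in> N \<longrightarrow> (\<forall>x\<in>N. \<forall>y\<in>N. x \<otimes> y \<in> N) \<longrightarrow>
     (\<forall>x\<in>N. \<forall>g\<in>\<Gamma>. g \<otimes> x \<otimes> inv g \<in> N) \<longrightarrow> (\<forall>u\<in>\<Gamma>. has_large_orbits h u \<longrightarrow> u \<in> N) \<longrightarrow> N = \<Gamma>)"

text \<open>If the bound failed, an extremal function and all its right translates would be
  invariant under every element with large orbits, hence under the whole group. A constant function
  of mean zero is zero, which contradicts norm 1.\<close>

lemma left_conv_bound: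
  assumes gen: "normally_generated_by_large_orbits h" and A: "A \<subseteq> \<Gamma>" and g: "(\<Sum>x\<in>\<Gamma>. g x) = 0"
  shows "h * sqn (left_conv A g) \<le> card \<Gamma> * card A * sqn g"
proof (cases "\<exists>f. conv_maximizer A f")
  \<comment> \<open>Without an extremal function every function of mean zero vanishes, as in the
    trivial group.\<close>
  case False
  then have "sqn g = 0" using conv_maximizer_exists[OF A g] by blast
  then have "\<forall>x\<in>\<Gamma>. g x = 0" using sq_norm_on_eq_0_iff[OF finite_carrier] by blast
  then have "sqn (left_conv A g) = sqn (left_conv A (\<lambda>_. 0))"
    using A by (intro sq_norm_on_cong left_conv_cong) auto
  also have "\<dots> = 0" by (simp add: left_conv_def sq_norm_on_def)
  finally show ?thesis using \<open>sqn g = 0\<close> by simp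
next
  case True
  then obtain f where f: "conv_maximizer A f" by blast
  have "h * sqn (left_conv A f) \<le> card \<Gamma> * card A"
  proof (rule ccontr)
    assume "\<not> ?thesis"
    then have big: "card \<Gamma> * card A < h * sqn (left_conv A f)" by simp
    \<comment> \<open>The factor \<open>l\<close> on the right makes the set stable under
      conjugation. It can be allowed because right translates of an extremal function are
      extremal.\<close>
    define N where "N = {z\<in>\<Gamma>. \<forall>y\<in>\<Gamma>. \<forall>l\<in>\<Gamma>. f (y \<otimes> z \<otimes> l) = f (y \<otimes> l)}"
    have "N = \<Gamma>"
    proof (rule gen[unfolded normally_generated_by_large_orbits_def, rule_format])
      fix x y assume "x \<in> N" "y \<in> N"
      then show "x \<otimes> y \<in> N"
        unfolding N_def by (auto simp flip: m_assoc)
    next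
      fix x g assume x: "x \<in> N" and g: "g \<in> \<Gamma>"
      have "f (y \<otimes> (g \<otimes> x \<otimes> inv g) \<otimes> l) = f (y \<otimes> l)" if "y \<in> \<Gamma>" "l \<in> \<Gamma>" for y l
      proof -
        have "f (y \<otimes> (g \<otimes> x \<otimes> inv g) \<otimes> l) = f ((y \<otimes> g) \<otimes> x \<otimes> (inv g \<otimes> l))"
          using x g that by (simp add: m_assoc N_def)
        also have "\<dots> = f ((y \<otimes> g) \<otimes> (inv g \<otimes> l))"
          using x g that by (simp add: N_def)
        also have "(y \<otimes> g) \<otimes> (inv g \<otimes> l) = y \<otimes> l"
          using g that by (simp add: m_assoc) (simp flip: m_assoc[of g])
        finally show ?thesis .
      qed
      then show "g \<otimes> x \<otimes> inv g \<in> N" using x g by (simp add: N_def)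
    next
      fix u assume u: "u \<in> \<Gamma>" "has_large_orbits h u"
      show "u \<in> N"
        unfolding N_def
      proof (intro CollectI conjI ballI u(1))
        fix y l assume "y \<in> \<Gamma>" "l \<in> \<Gamma>"
        then show "f (y \<otimes> u \<otimes> l) = f (y \<otimes> l)"
          using conv_maximizer_invariant[OF A conv_maximizer_right_mult(1)[OF A f] u(2)] big
          by (simp add: conv_maximizer_right_mult(2)[OF A f])
      qed
    qed (auto simp: N_def)
    have const: "f z = f \<one>" if "z \<in> \<Gamma>" for z
    proof -
      have "z \<in> N" using that \<open>N = \<Gamma>\<close> by simp
      then have "f (\<one> \<otimes> z \<otimes> \<one>) = f (\<one> \<otimes> \<one>)" unfolding N_def by blast
      then show ?thesis using that by simp
    qed
    then have "(\<Sum>x\<in>\<Gamma>. f x) = (\<Sum>x\<in>\<Gamma>. f \<one>)" by (intro sum.cong refl)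
    then have "of_nat (card \<Gamma>) * f \<one> = 0"
      using f unfolding conv_maximizer_def by simp
    then have "f \<one> = 0" using finite_carrier by auto
    then have "sqn f = 0"
      using const sq_norm_on_eq_0_iff[OF finite_carrier, of f] by metis
    then show False using f by (simp add: conv_maximizer_def)
  qed
  then have "h * sqn (left_conv A f) * sqn g \<le> card \<Gamma> * card A * sqn g"
    by (intro mult_right_mono) auto
  moreover have "h * sqn (left_conv A g) \<le> h * (sqn (left_conv A f) * sqn g)"
    using f g by (intro mult_left_mono) (auto simp: conv_maximizer_def)
  ultimately show ?thesis by (simp add: mult.assoc)
qed

text \<open>If \<open>g\<close> is not such a product, then \<open>1_A * 1_A\<close> and
  \<open>F\<close> have disjoint supports. Writing \<open>1_A = f + \<alpha>\<close>, the main term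
  \<open>|A|^3 / |\<Gamma>|\<close> must be cancelled by the inner product of
  \<open>left_conv A f\<close> with \<open>F\<close>, whose square is at most
  \<open>|\<Gamma>| |A|^3 / h\<close> by Cauchy-Schwarz and \<open>left_conv_bound\<close>.\<close>

theorem triple_product_of_large_orbits:
  assumes gen: "normally_generated_by_large_orbits h" and A: "A \<subseteq> \<Gamma>"
    and large: "real (card \<Gamma>) ^ 3 < real h * real (card A) ^ 3" and g: "g \<in> \<Gamma>"
  shows "\<exists>a\<in>A. \<exists>b\<in>A. \<exists>c\<in>A. a \<otimes> b \<otimes> c = g"
proof (rule ccontr)
  assume none: "\<not> ?thesis"
  let ?n = "real (card \<Gamma>)" and ?a = "real (card A)"
  define \<alpha> where "\<alpha> = ?a / ?n"
  have n: "?n > 0" using finite_carrier by (auto simp: card_gt_0_iff)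
  have finA: "finite A" using A finite_carrier finite_subset by blast
  have a: "?a > 0" using large by (auto intro!: Nat.gr0I)
  define f :: "'a \<Rightarrow> complex" where "f x = of_bool (x \<in> A) - complex_of_real \<alpha>" for x
  define F :: "'a \<Rightarrow> complex" where "F x = of_bool (inv x \<otimes> g \<in> A)" for x
  have sum1: "(\<Sum>x\<in>\<Gamma>. of_bool (x \<in> A)) = complex_of_real ?a"
  proof -
    have "(\<Sum>x\<in>\<Gamma>. of_bool (x \<in> A)) = (\<Sum>x\<in>A. (1 :: complex))"
      by (intro sum.mono_neutral_cong_right) (use A finite_carrier in auto)
    then show ?thesis by simp
  qed
  have f0: "(\<Sum>x\<in>\<Gamma>. f x) = 0"
    using n unfolding f_def sum_subtractf sum1 by (simp add: \<alpha>_def)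
  have sqF: "sqn F = ?a"
  proof -
    have "sqn F = (\<Sum>y\<in>{y\<in>\<Gamma>. inv y \<otimes> g \<in> A}. 1)"
      unfolding sq_norm_on_def F_def
      by (intro sum.mono_neutral_cong_right) (auto simp: finite_carrier)
    also have "\<dots> = (\<Sum>a\<in>A. 1)"
      by (rule sum.reindex_bij_witness[of _ "\<lambda>a. g \<otimes> inv a" "\<lambda>y. inv y \<otimes> g"])
        (use A g in \<open>auto simp: inv_mult_group subset_iff m_assoc simp flip: m_assoc[of "g"]\<close>)
    finally show ?thesis by simp
  qed
  have sumF: "(\<Sum>x\<in>\<Gamma>. F x) = complex_of_real ?a"
  proof -
    have "complex_of_real (sqn F) = (\<Sum>x\<in>\<Gamma>. F x)"
      unfolding sq_norm_on_def of_real_sum by (intro sum.cong) (auto simp: F_def)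
    then show ?thesis using sqF by simp
  qed
  have sqf: "sqn f \<le> ?a"
  proof -
    have "sqn f = (\<Sum>x\<in>\<Gamma>. of_bool (x \<in> A) * (1 - 2 * \<alpha>) + \<alpha>\<^sup>2)"
      unfolding sq_norm_on_def f_def
    proof (intro sum.cong refl)
      fix x
      have "1 - complex_of_real \<alpha> = complex_of_real (1 - \<alpha>)" by simp
      then have "(cmod (1 - complex_of_real \<alpha>))\<^sup>2 = (1 - \<alpha>)\<^sup>2"
        by (simp only: norm_of_real power2_abs)
      then show "(cmod (of_bool (x \<in> A) - complex_of_real \<alpha>))\<^sup>2 = of_bool (x \<in> A) * (1 - 2 * \<alpha>) + \<alpha>\<^sup>2"
        by (simp add: power2_eq_square algebra_simps)
    qed
    also have "\<dots> = ?a * (1 - 2 * \<alpha>) + ?n * \<alpha>\<^sup>2"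
    proof -
      have "(\<Sum>x\<in>\<Gamma>. of_bool (x \<in> A)) = (\<Sum>x\<in>A. (1 :: real))"
        by (intro sum.mono_neutral_cong_right) (use A finite_carrier in auto)
      then show ?thesis unfolding sum.distrib sum_distrib_right[symmetric] by simp
    qed
    also have "\<dots> = ?a - \<alpha> * ?a" using n by (simp add: \<alpha>_def field_simps power2_eq_square)
    also have "\<dots> \<le> ?a" using n by (simp add: \<alpha>_def)
    finally show ?thesis .
  qed
  have "F x * left_conv A (\<lambda>y. of_bool (y \<in> A)) x = 0" if x: "x \<in> \<Gamma>" for x
  proof (rule ccontr)
    assume *: "F x * left_conv A (\<lambda>y. of_bool (y \<in> A)) x \<noteq> 0"
    then have c: "inv x \<otimes> g \<in> A" by (auto simp: F_def split: if_splits)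
    from * have "(\<Sum>a\<in>A. of_bool (inv a \<otimes> x \<in> A)) \<noteq> (0 :: complex)"
      unfolding left_conv_def by auto
    then obtain a where a: "a \<in> A" "inv a \<otimes> x \<in> A"
      by (metis (mono_tags, lifting) of_bool_eq(1) sum.neutral)
    have "a \<in> \<Gamma>" using a(1) A by blast
    then have "a \<otimes> (inv a \<otimes> x) = x" using x by (simp flip: m_assoc)
    moreover have "x \<otimes> (inv x \<otimes> g) = g" using x g by (simp flip: m_assoc)
    ultimately have "a \<otimes> (inv a \<otimes> x) \<otimes> (inv x \<otimes> g) = g" by simp
    then show False using none a c by blast
  qed
  then have "0 = (\<Sum>x\<in>\<Gamma>. F x * left_conv A (\<lambda>y. of_bool (y \<in> A)) x)"
    by (intro sum.neutral[symmetric]) auto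
  also have "\<dots> = (\<Sum>x\<in>\<Gamma>. F x * (left_conv A f x + complex_of_real (?a * \<alpha>)))"
    by (intro sum.cong refl) (simp add: left_conv_def f_def sum_subtractf algebra_simps)
  also have "\<dots> = cinner_on \<Gamma> (left_conv A f) F + complex_of_real (?a * \<alpha> * ?a)"
    unfolding distrib_left sum.distrib sum_distrib_right[symmetric] sumF cinner_on_def
    by (auto intro!: sum.cong simp: F_def)
  finally have "cinner_on \<Gamma> (left_conv A f) F = - complex_of_real (?a * \<alpha> * ?a)"
    by (metis eq_neg_iff_add_eq_0)
  then have "(?a * \<alpha> * ?a)\<^sup>2 = (cmod (cinner_on \<Gamma> (left_conv A f) F))\<^sup>2"
    by (simp only: norm_minus_cancel norm_of_real power2_abs)
  also have "\<dots> \<le> sqn (left_conv A f) * ?a"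
    using cinner_on_Cauchy_Schwarz[of \<Gamma> "left_conv A f" F] by (simp add: sqF)
  finally have "h * (?a * \<alpha> * ?a)\<^sup>2 \<le> (h * sqn (left_conv A f)) * ?a"
    by (simp add: mult_left_mono mult.assoc)
  also have "\<dots> \<le> (?n * ?a * ?a) * ?a"
  proof (rule mult_right_mono)
    have "h * sqn (left_conv A f) \<le> ?n * ?a * sqn f" using left_conv_bound[OF gen A f0] by simp
    also have "\<dots> \<le> ?n * ?a * ?a" using sqf by (intro mult_left_mono) auto
    finally show "h * sqn (left_conv A f) \<le> ?n * ?a * ?a" .
  qed simp
  finally have "h * ?a ^ 3 \<le> ?n ^ 3"
    using n a by (simp add: \<alpha>_def power2_eq_square power3_eq_cube field_simps)
  then show False using large by simp
qed

end

section \<open>The topology of the p-adic integers\<close>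

lemma padic_res_mod_le:
  fixes x :: "'p :: prime_card padic_int"
  assumes "m \<le> n" shows "padic_res x n mod int CARD('p) ^ m = padic_res x m"
  using assms
proof (induction n rule: dec_induct)
  case (step n)
  have "padic_res x n = padic_res x (Suc n) mod int CARD('p) ^ n" by transfer simp
  then have "padic_res x n mod int CARD('p) ^ m = padic_res x (Suc n) mod int CARD('p) ^ m"
    using step(1) by (simp add: mod_mod_cancel le_imp_power_dvd)
  then show ?case using step(3) by simp
qed simp

lemma padic_res_eq_le:
  "padic_res (x :: 'p :: prime_card padic_int) n = padic_res (y :: 'p padic_int) n \<Longrightarrow> m \<le> n \<Longrightarrow> padic_res x m = padic_res y m"
  by (metis padic_res_mod_le)

text \<open>The exponent is the first level of disagreement, one more than the valuation of
  \<open>x - y\<close>, so that \<open>padic_dist x y < (1/2) ^ n\<close> with strict inequality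
  means agreement at level \<open>n\<close>. The base \<open>1/2\<close> replaces the usual
  \<open>1/p\<close> without changing the topology.\<close>

definition padic_dist :: "'p :: prime_card padic_int \<Rightarrow> 'p padic_int \<Rightarrow> real" where
  "padic_dist x y = (if x = y then 0 else (1/2) ^ (LEAST n. padic_res x n \<noteq> padic_res y n))"

lemma padic_dist_less_iff: "padic_dist x y < (1/2) ^ n \<longleftrightarrow> padic_res x n = padic_res y n"
proof (cases "x = y")
  case False
  define N where "N = (LEAST n. padic_res x n \<noteq> padic_res y n)"
  have ex: "\<exists>n. padic_res x n \<noteq> padic_res y n" using False padic_int_eqI by blast
  have N: "padic_res x N \<noteq> padic_res y N" unfolding N_def by (rule LeastI_ex[OF ex])
  have "padic_res x n = padic_res y n \<longleftrightarrow> n < N"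
  proof
    assume "padic_res x n = padic_res y n"
    then show "n < N" using N padic_res_eq_le by (metis linorder_not_less)
  next
    assume "n < N"
    then show "padic_res x n = padic_res y n" unfolding N_def using not_less_Least by blast
  qed
  then show ?thesis
    using False by (simp add: padic_dist_def N_def[symmetric] power_strict_decreasing_iff)
qed (simp add: padic_dist_def)

text \<open>The metric serves to make the matrix space Polish, where finite Borel measures are inner
  regular. Since the topology is already fixed, the last goal identifies it with the metric
  one.\<close>

instantiation padic_int :: (prime_card) metric_space
begin

definition dist_padic_int :: "'a padic_int \<Rightarrow> 'a padic_int \<Rightarrow> real" where
  "dist_padic_int = padic_dist"

definition uniformity_padic_int :: "('a padic_int \<times> 'a padic_int) filter" where
  "uniformity_padic_int = (INF e\<in>{0 <..}. principal {(x, y). dist x y < e})"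

instance
proof
  fix x y z :: "'a padic_int"
  show "dist x y = 0 \<longleftrightarrow> x = y" by (simp add: dist_padic_int_def padic_dist_def)
  show "dist x y \<le> dist x z + dist y z"
  proof (cases "x = y")
    case False
    \<comment> \<open>At level \<open>N\<close>, where \<open>x\<close> and \<open>y\<close>
      disagree, \<open>z\<close> disagrees with one of them: the ultrametric inequality.\<close>
    then obtain N where N: "padic_dist x y = (1/2) ^ N"
      by (simp add: padic_dist_def)
    then have "padic_res x N \<noteq> padic_res y N"
      using padic_dist_less_iff[of x y N] by simp
    then have "\<not> padic_dist x z < (1/2) ^ N \<or> \<not> padic_dist y z < (1/2) ^ N"
      unfolding padic_dist_less_iff by auto
    moreover have "padic_dist x z \<ge> 0" "padic_dist y z \<ge> 0" by (auto simp: padic_dist_def)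
    ultimately show ?thesis using N unfolding dist_padic_int_def by linarith
  qed (simp add: dist_padic_int_def padic_dist_def)
next
  show "uniformity = (INF e\<in>{0 <..}. principal {(x :: 'a padic_int, y). dist x y < e})"
    by (rule uniformity_padic_int_def)
next
  fix U :: "'a padic_int set"
  have ev: "eventually P uniformity \<longleftrightarrow> (\<exists>e>0. \<forall>x y. padic_dist x y < e \<longrightarrow> P (x, y))"
    for P :: "'a padic_int \<times> 'a padic_int \<Rightarrow> bool"
    unfolding uniformity_padic_int_def dist_padic_int_def
    by (subst eventually_INF_base)
       (auto simp: eventually_principal subset_eq intro: bexI[of _ "min _ _"])
  have "(\<exists>n. \<forall>y. padic_res y n = padic_res x n \<longrightarrow> y \<in> U) \<longleftrightarrow>
      (\<exists>e>0. \<forall>x' y. padic_dist x' y < e \<longrightarrow> x' = x \<longrightarrow> y \<in> U)" (is "?l \<longleftrightarrow> ?r") for x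
  proof
    assume ?l
    then obtain n where "\<forall>y. padic_res y n = padic_res x n \<longrightarrow> y \<in> U" by blast
    then show ?r
      by (intro exI[of _ "(1/2) ^ n"]) (auto simp: padic_dist_less_iff)
  next
    assume ?r
    then obtain e where e: "e > 0" "\<And>y. padic_dist x y < e \<Longrightarrow> y \<in> U" by blast
    obtain n where "(1/2 :: real) ^ n < e" using real_arch_pow_inv[OF e(1), of "1/2"] by auto
    then have "y \<in> U" if "padic_res y n = padic_res x n" for y
      using e(2)[of y] that padic_dist_less_iff[of x y n] by auto
    then show ?l by blast
  qed
  then show "open U \<longleftrightarrow> (\<forall>x\<in>U. \<forall>\<^sub>F (x', y) in uniformity. x' = x \<longrightarrow> y \<in> U)"
    unfolding open_padic_int_def ev by simp
qed

end

lemma dist_padic_int_less_iff: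
  fixes x y :: "'p :: prime_card padic_int"
  shows "dist x y < (1/2) ^ n \<longleftrightarrow> padic_res x n = padic_res y n"
  by (simp add: dist_padic_int_def padic_dist_less_iff)

text \<open>Along a Cauchy sequence the residue at each level is eventually constant, and these
  constants are coherent.\<close>

instance padic_int :: (prime_card) complete_space
proof
  fix X :: "nat \<Rightarrow> 'a padic_int" assume "Cauchy X"
  then have "\<exists>M. \<forall>m\<ge>M. \<forall>n\<ge>M. dist (X m) (X n) < (1/2) ^ k" for k
    unfolding Cauchy_def by simp
  then obtain M where M: "\<And>k m n. m \<ge> M k \<Longrightarrow> n \<ge> M k \<Longrightarrow> padic_res (X m) k = padic_res (X n) k"
    unfolding dist_padic_int_less_iff by metis
  define L where "L = (\<lambda>k. padic_res (X (M k)) k)"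
  have "L (Suc k) mod int CARD('a) ^ k = L k" for k
  proof -
    let ?m = "max (M k) (M (Suc k))"
    have "L (Suc k) = padic_res (X ?m) (Suc k)" "L k = padic_res (X ?m) k"
      unfolding L_def by (intro M; simp)+
    then show ?thesis by (simp add: padic_res_mod_le)
  qed
  then have L: "padic_res (Abs_padic_int L :: 'a padic_int) = L"
    by (intro Abs_padic_int_inverse) auto
  have "X \<longlonglongrightarrow> Abs_padic_int L"
  proof (rule metric_LIMSEQ_I)
    fix e :: real assume "e > 0"
    then obtain k where k: "(1/2 :: real) ^ k < e" using real_arch_pow_inv[of e "1/2"] by auto
    have "dist (X n) (Abs_padic_int L) < e" if "n \<ge> M k" for n
    proof -
      have "dist (X n) (Abs_padic_int L) < (1/2) ^ k"
        unfolding dist_padic_int_less_iff L unfolding L_def using that by (intro M) auto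
      then show ?thesis using k by simp
    qed
    then show "\<exists>N. \<forall>n\<ge>N. dist (X n) (Abs_padic_int L) < e" by blast
  qed
  then show "convergent X" by (rule convergentI)
qed

lemma open_padic_res: "open {y :: 'p :: prime_card padic_int. padic_res y n = z}"
  unfolding open_padic_int_def by auto

instance padic_int :: (prime_card) second_countable_topology
proof
  let ?B = "range (\<lambda>(n, z). {y :: 'a padic_int. padic_res y n = z})"
  have "topological_basis ?B"
  proof (rule topological_basisI)
    fix B assume "B \<in> ?B"
    then show "open B" by (auto simp: open_padic_res)
  next
    fix U :: "'a padic_int set" and x assume "open U" "x \<in> U"
    then obtain n where n: "\<forall>y. padic_res y n = padic_res x n \<longrightarrow> y \<in> U"
      unfolding open_padic_int_def by blast
    then show "\<exists>B\<in>?B. x \<in> B \<and> B \<subseteq> U"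
      by (intro bexI[of _ "(\<lambda>(n, z). {y. padic_res y n = z}) (n, padic_res x n)"] rangeI) auto
  qed
  then show "\<exists>B :: 'a padic_int set set. countable B \<and> open = generate_topology B"
    by (intro exI[of _ ?B]) (auto dest: topological_basis_imp_subbasis)
qed

text \<open>Boxes with sides in a countable base of the entry space form a countable base; together
  with completeness this makes the matrix space Polish.\<close>

instance vec :: ("{metric_space, second_countable_topology}", finite) second_countable_topology
proof
  obtain B :: "'a set set" where B: "countable B" "topological_basis B"
    using ex_countable_basis by blast
  let ?box = "\<lambda>f. {x :: ('a, 'b) vec. \<forall>i. x $ i \<in> f i}"
  let ?C = "?box ` PiE UNIV (\<lambda>_. B)"
  have "topological_basis ?C"
  proof (rule topological_basisI)
    fix C assume "C \<in> ?C"
    then obtain f where f: "f \<in> PiE UNIV (\<lambda>_. B)" "C = ?box f" by blast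
    then have "\<forall>i. open (f i)" using topological_basis_open[OF B(2)] by auto
    then show "open C" unfolding f(2) by (rule open_vector_box)
  next
    fix U :: "('a, 'b) vec set" and x assume "open U" "x \<in> U"
    then obtain A where A: "\<And>i. open (A i) \<and> x $ i \<in> A i" "\<And>y. (\<forall>i. y $ i \<in> A i) \<Longrightarrow> y \<in> U"
      unfolding open_vec_def by blast
    have "\<exists>b\<in>B. x $ i \<in> b \<and> b \<subseteq> A i" for i
      using A(1)[of i] by (metis B(2) topological_basisE)
    then obtain f where f: "\<And>i. f i \<in> B" "\<And>i. x $ i \<in> f i" "\<And>i. f i \<subseteq> A i" by metis
    then have "?box f \<in> ?C" by (intro imageI) auto
    then show "\<exists>C\<in>?C. x \<in> C \<and> C \<subseteq> U"
    proof (intro bexI[of _ "?box f"] conjI subsetI)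
      fix y assume "y \<in> ?box f"
      then have "\<forall>i. y $ i \<in> A i" using f(3) by blast
      then show "y \<in> U" by (rule A(2))
    qed (use f(2) in auto)
  qed
  moreover have "countable ?C" using B(1) by (intro countable_image countable_PiE) auto
  ultimately show "\<exists>B :: ('a, 'b) vec set set. countable B \<and> open = generate_topology B"
    using topological_basis_imp_subbasis by blast
qed

section \<open>Reduction to finite levels\<close>

lemma padic_res_range: "padic_res (x :: 'p :: prime_card padic_int) n \<in> {0..<int CARD('p) ^ n}"
proof -
  have "int CARD('p) ^ n > 0" by simp
  then show ?thesis
    by (subst padic_res_mod[symmetric]) (simp only: atLeastLessThan_iff pos_mod_bound pos_mod_sign)
qed

lemma padic_res_sum:
  "padic_res (\<Sum>i\<in>S. f i :: 'p :: prime_card padic_int) n = (\<Sum>i\<in>S. padic_res (f i) n) mod int CARD('p) ^ n"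
  by (induction S rule: infinite_finite_induct)
    (auto simp: zero_padic_int.rep_eq plus_padic_int.rep_eq mod_simps)

lemma padic_res_prod:
  "padic_res (\<Prod>i\<in>S. f i :: 'p :: prime_card padic_int) n = (\<Prod>i\<in>S. padic_res (f i) n) mod int CARD('p) ^ n"
  by (induction S rule: infinite_finite_induct)
    (auto simp: one_padic_int.rep_eq times_padic_int.rep_eq mod_simps)

definition mat_res :: "nat \<Rightarrow> 'p :: prime_card padic_int ^ 'm ^ 'n \<Rightarrow> int ^ 'm ^ 'n" where
  "mat_res n A = (\<chi> i j. padic_res (A $ i $ j) n)"

definition mat_mod :: "int \<Rightarrow> int ^ 'm ^ 'n \<Rightarrow> int ^ 'm ^ 'n" where
  "mat_mod q A = (\<chi> i j. A $ i $ j mod q)"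

lemma mat_res_mult:
  fixes A :: "'p :: prime_card padic_int ^ 'm ^ 'n" and B :: "'p padic_int ^ 'l ^ 'm"
  shows "mat_res n (A ** B) = mat_mod (int CARD('p) ^ n) (mat_res n A ** mat_res n B)"
proof -
  have "padic_res (\<Sum>k\<in>UNIV. A $ i $ k * B $ k $ j) n =
      (\<Sum>k\<in>UNIV. padic_res (A $ i $ k) n * padic_res (B $ k $ j) n) mod int CARD('p) ^ n" for i j
    unfolding padic_res_sum times_padic_int.rep_eq by (rule mod_sum_eq)
  then show ?thesis
    by (simp add: vec_eq_iff mat_res_def mat_mod_def matrix_matrix_mult_def)
qed

lemma mat_res_eq_le:
  fixes A B :: "'p :: prime_card padic_int ^ 'm ^ 'n"
  shows "mat_res n A = mat_res n B \<Longrightarrow> m \<le> n \<Longrightarrow> mat_res m A = mat_res m B"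
  by (simp add: mat_res_def vec_eq_iff) (blast intro: padic_res_eq_le[of _ n])

lemma mat_res_eqI:
  fixes A B :: "'p :: prime_card padic_int ^ 'm ^ 'n"
  shows "(\<And>n. mat_res n A = mat_res n B) \<Longrightarrow> A = B"
  by (simp add: mat_res_def vec_eq_iff padic_int_eqI)

lemma open_mat_res: "open {A :: 'p :: prime_card padic_int ^ 'm ^ 'n. mat_res n A \<in> Z}"
proof -
  have "open {A :: 'p padic_int ^ 'm ^ 'n. mat_res n A = z}" for z
  proof -
    have "{A :: 'p padic_int ^ 'm ^ 'n. mat_res n A = z} =
        {A. \<forall>i. A $ i \<in> {r. \<forall>j. r $ j \<in> {y. padic_res y n = z $ i $ j}}}"
      by (auto simp: mat_res_def vec_eq_iff)
    then show ?thesis by (simp only:) (intro open_vector_box allI open_padic_res)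
  qed
  then have "open (\<Union>z\<in>Z. {A :: 'p padic_int ^ 'm ^ 'n. mat_res n A = z})" by (rule open_UN[rule_format])
  also have "(\<Union>z\<in>Z. {A :: 'p padic_int ^ 'm ^ 'n. mat_res n A = z}) = {A. mat_res n A \<in> Z}" by auto
  finally show ?thesis .
qed

lemma closed_mat_res: "closed {A :: 'p :: prime_card padic_int ^ 'm ^ 'n. mat_res n A \<in> Z}"
  using open_mat_res[of n "- Z"] by (simp add: closed_def Compl_eq)

lemma finite_mat_res: "finite (range (mat_res n :: 'p :: prime_card padic_int ^ 'm ^ 'n \<Rightarrow> _))"
proof -
  let ?R = "{0..<int CARD('p) ^ n}"
  have "range (mat_res n :: 'p padic_int ^ 'm ^ 'n \<Rightarrow> _) \<subseteq>
      (\<lambda>f. \<chi> i j. f (i, j)) ` PiE (UNIV :: ('n \<times> 'm) set) (\<lambda>_. ?R)"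
  proof
    fix M assume "M \<in> range (mat_res n :: 'p padic_int ^ 'm ^ 'n \<Rightarrow> _)"
    then obtain A :: "'p padic_int ^ 'm ^ 'n" where A: "M = mat_res n A" by blast
    then show "M \<in> (\<lambda>f. \<chi> i j. f (i, j)) ` PiE (UNIV :: ('n \<times> 'm) set) (\<lambda>_. ?R)"
      using padic_res_range[where 'p='p]
      by (intro image_eqI[of _ _ "\<lambda>(i, j). padic_res (A $ i $ j) n"]) (auto simp: mat_res_def)
  qed
  moreover have "finite (PiE (UNIV :: ('n \<times> 'm) set) (\<lambda>_. ?R))" by (intro finite_PiE) auto
  ultimately show ?thesis using finite_surj by blast
qed

text \<open>The image of \<open>G\<close> in the matrices over \<open>\<int>/p^n\<close>. Canonical
  integer representatives avoid a type depending on \<open>n\<close>; the price is the reduction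
  \<open>mat_mod\<close> after each product.\<close>

definition level_group :: "nat \<Rightarrow> ('p :: prime_card padic_int ^ 'n ^ 'n) set \<Rightarrow> (int ^ 'n ^ 'n) monoid" where
  "level_group n G = \<lparr>carrier = mat_res n ` G,
     mult = (\<lambda>A B. mat_mod (int CARD('p) ^ n) (A ** B)), one = mat_res n (mat 1 :: 'p padic_int ^ 'n ^ 'n)\<rparr>"

locale matrix_group =
  fixes G :: "('a :: semiring_1 ^ 'n ^ 'n) set"
  assumes one_mem: "mat 1 \<in> G"
    and mult_mem: "A \<in> G \<Longrightarrow> B \<in> G \<Longrightarrow> A ** B \<in> G"
    and inverse_ex: "A \<in> G \<Longrightarrow> \<exists>B\<in>G. A ** B = mat 1 \<and> B ** A = mat 1"

lemma level_group_simps: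
  fixes G :: "('p :: prime_card padic_int ^ 'n ^ 'n) set"
  shows "carrier (level_group n G) = mat_res n ` G"
    and "\<one>\<^bsub>level_group n G\<^esub> = mat_res n (mat 1 :: 'p padic_int ^ 'n ^ 'n)"
  by (simp_all add: level_group_def)

lemma level_group_mult [simp]:
  fixes G :: "('p :: prime_card padic_int ^ 'n ^ 'n) set"
  shows "mat_res n A \<otimes>\<^bsub>level_group n G\<^esub> mat_res n B = mat_res n (A ** B :: 'p padic_int ^ 'n ^ 'n)"
  by (simp add: level_group_def mat_res_mult)

lemma finite_group_level_group:
  fixes G :: "('p :: prime_card padic_int ^ 'n ^ 'n) set"
  assumes "matrix_group G"
  shows "finite_group (level_group n G)"
proof -
  interpret matrix_group G by fact
  have "group (level_group n G)"
  proof (rule groupI)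
    fix x assume "x \<in> carrier (level_group n G)"
    then obtain A where A: "A \<in> G" "x = mat_res n A" by (auto simp: level_group_simps)
    then obtain B where B: "B \<in> G" "B ** A = mat 1" using inverse_ex by blast
    then show "\<exists>y\<in>carrier (level_group n G). y \<otimes>\<^bsub>level_group n G\<^esub> x = \<one>\<^bsub>level_group n G\<^esub>"
      using A by (intro bexI[of _ "mat_res n B"]) (simp_all add: level_group_simps)
  qed (auto simp: level_group_simps mult_mem one_mem matrix_mul_assoc)
  moreover have "finite (carrier (level_group n G))"
    unfolding level_group_simps by (rule finite_subset[OF _ finite_mat_res]) auto
  ultimately show ?thesis by (simp add: finite_group_def finite_group_axioms_def)
qed

text \<open>These sets are the left cosets of the congruence kernel of level \<open>n\<close>. They
  partition \<open>G\<close>, and left invariance gives them equal measure.\<close>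

lemma haar_measure_level:
  fixes G :: "('p :: prime_card padic_int ^ 'n ^ 'n) set"
  assumes G: "matrix_group G" and haar: "normalized_haar_measure G \<mu>" and g: "g \<in> G"
  shows "{A \<in> G. mat_res n A = mat_res n g} \<in> sets \<mu>"
    and "measure \<mu> {A \<in> G. mat_res n A = mat_res n g} = 1 / card (mat_res n ` G)"
proof -
  interpret matrix_group G by fact
  have sp: "space \<mu> = G" and sets: "sets \<mu> = sets (restrict_space borel G)" and 1: "emeasure \<mu> G = 1"
    and inv: "\<And>g B. g \<in> G \<Longrightarrow> B \<in> sets \<mu> \<Longrightarrow> emeasure \<mu> ((\<lambda>x. g ** x) ` B) = emeasure \<mu> B"
    using haar unfolding normalized_haar_measure_def by auto
  define C where "C z = {A \<in> G. mat_res n A = z}" for z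
  have C_sets: "C z \<in> sets \<mu>" for z
  proof -
    have "C z = G \<inter> {A. mat_res n A \<in> {z}}" by (auto simp: C_def)
    then show ?thesis
      unfolding sets sets_restrict_space using borel_open[OF open_mat_res] by blast
  qed
  then show "{A \<in> G. mat_res n A = mat_res n g} \<in> sets \<mu>" unfolding C_def by simp
  let ?I = "mat_res n (mat 1 :: 'p padic_int ^ 'n ^ 'n)"
  have translate: "emeasure \<mu> (C (mat_res n h)) = emeasure \<mu> (C (?I))" if h: "h \<in> G" for h
  proof -
    obtain k where k: "k \<in> G" "h ** k = mat 1" "k ** h = mat 1" using inverse_ex[OF h] by blast
    have "(\<lambda>x. h ** x) ` C (?I) = C (mat_res n h)"
    proof (intro subset_antisym subsetI)
      fix x assume "x \<in> (\<lambda>x. h ** x) ` C (?I)"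
      then obtain y where "x = h ** y" "y \<in> C (?I)" by (rule imageE)
      then have y: "y \<in> G" "mat_res n y = ?I" "x = h ** y"
        by (simp_all add: C_def)
      then have "mat_res n x = mat_res n (h ** mat 1)" by (simp only: mat_res_mult)
      then show "x \<in> C (mat_res n h)" using y h by (simp add: C_def mult_mem)
    next
      fix x assume x: "x \<in> C (mat_res n h)"
      then have "mat_res n (k ** x) = mat_res n (k ** h)" by (simp only: mat_res_mult C_def mem_Collect_eq)
      then have "k ** x \<in> C (?I)" using x k by (simp add: C_def mult_mem)
      moreover have "x = h ** (k ** x)" using k(2) by (simp add: matrix_mul_assoc)
      ultimately show "x \<in> (\<lambda>x. h ** x) ` C (?I)" by (rule rev_image_eqI)
    qed
    then show ?thesis using inv[OF h C_sets] by metis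
  qed
  have fin: "finite (mat_res n ` G)" by (rule finite_subset[OF _ finite_mat_res]) auto
  have "(\<Union>z\<in>mat_res n ` G. C z) = G" by (auto simp: C_def)
  then have "1 = emeasure \<mu> (\<Union>z\<in>mat_res n ` G. C z)" using 1 by simp
  also have "\<dots> = (\<Sum>z\<in>mat_res n ` G. emeasure \<mu> (C z))"
    using C_sets fin by (intro sum_emeasure[symmetric]) (auto simp: disjoint_family_on_def C_def)
  also have "\<dots> = (\<Sum>z\<in>mat_res n ` G. emeasure \<mu> (C (mat_res n g)))"
    using translate translate[OF g] by (intro sum.cong) auto
  finally have *: "of_nat (card (mat_res n ` G)) * emeasure \<mu> (C (mat_res n g)) = 1" by simp
  have card: "card (mat_res n ` G) \<noteq> 0" using fin one_mem by auto
  have "measure \<mu> (C (mat_res n g)) * card (mat_res n ` G) = 1"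
    using arg_cong[OF *, of enn2real] by (simp add: enn2real_mult measure_def mult.commute)
  then have "measure \<mu> (C (mat_res n g)) = 1 / card (mat_res n ` G)"
    using card by (simp add: field_simps)
  then show "measure \<mu> {A \<in> G. mat_res n A = mat_res n g} = 1 / card (mat_res n ` G)"
    unfolding C_def .
qed

text \<open>The constant \<open>c\<close> stands for \<open>h^(-1/3)\<close>. The strict inequality
  leaves room to pass to a compact subset, and \<open>1 \<le> h * c^3\<close> turns density above
  \<open>c\<close> at each level into the counting hypothesis of
  \<open>triple_product_of_large_orbits\<close>.\<close>

theorem triple_product_of_levels:
  fixes G :: "('p :: prime_card padic_int ^ 'n ^ 'n) set"
  assumes G: "matrix_group G" "closed G"
    and gen: "\<And>n. n \<ge> 1 \<Longrightarrow> finite_group.normally_generated_by_large_orbits (level_group n G) h"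
    and haar: "normalized_haar_measure G \<mu>"
    and A: "A \<in> sets (completion \<mu>)" and c: "c < measure (completion \<mu>) A" "0 \<le> c" "1 \<le> real h * c ^ 3"
  shows "triple_product A = G"
proof -
  interpret matrix_group G by fact
  have sp: "space \<mu> = G" and sets: "sets \<mu> = sets (restrict_space borel G)" and 1: "emeasure \<mu> G = 1"
    using haar unfolding normalized_haar_measure_def by auto
  have Gb: "G \<in> sets borel" using G(2) by simp
  \<comment> \<open>\<open>A\<close> is measurable only for the completed measure; its main part has
    the same measure and lies in \<open>sets \<mu>\<close>.\<close>
  define B where "B = main_part \<mu> A"
  have B: "B \<in> sets \<mu>" "B \<subseteq> A" "measure \<mu> B = measure (completion \<mu>) A"
    unfolding B_def measure_def using main_part_sets[OF A] main_part_null_part_Un[OF A]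
    by (blast, blast, simp add: emeasure_completion[OF A])
  have Bb: "B \<in> sets borel" "B \<subseteq> G"
    using B(1) Gb unfolding sets by (auto simp: sets_restrict_space_iff)
  have meas: "(\<lambda>x. x) \<in> measurable \<mu> borel"
    unfolding measurable_cong_sets[OF sets refl] by (rule measurable_restrict_space1) simp
  \<comment> \<open>Inner regularity is stated for measures on a whole Polish space, so
    \<open>\<mu>\<close> is pushed forward along the inclusion of \<open>G\<close>.\<close>
  define \<nu> where "\<nu> = distr \<mu> borel (\<lambda>x. x)"
  have \<nu>: "emeasure \<nu> K = emeasure \<mu> (K \<inter> G)" if "K \<in> sets borel" for K
    unfolding \<nu>_def using that by (simp add: emeasure_distr[OF meas] sp)
  have fin: "emeasure \<mu> K \<noteq> \<infinity>" for K
    using emeasure_space[of \<mu> K] 1 sp by (auto simp: top_unique)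
  have "ennreal c < emeasure \<nu> B"
  proof -
    have "emeasure \<nu> B = ennreal (measure \<mu> B)"
      unfolding \<nu>[OF Bb(1)] Int_absorb2[OF Bb(2)] using fin by (intro emeasure_eq_ennreal_measure) simp
    then show ?thesis using c B(3) by (simp add: ennreal_less_iff)
  qed
  also have "emeasure \<nu> B = (SUP K \<in> {K. K \<subseteq> B \<and> compact K}. emeasure \<nu> K)"
  proof (rule inner_regular[OF _ _ Bb(1)])
    show "sets \<nu> = sets borel" by (simp add: \<nu>_def)
    have "space \<nu> = UNIV" by (simp add: \<nu>_def)
    then show "emeasure \<nu> (space \<nu>) \<noteq> \<infinity>" using \<nu>[of UNIV] fin[of G] by simp
  qed
  finally obtain K where K: "K \<subseteq> B" "compact K" "ennreal c < emeasure \<nu> K"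
    by (auto simp: less_SUP_iff)
  have KG: "K \<subseteq> G" using K(1) Bb(2) by blast
  have Ks: "K \<in> sets \<mu>" unfolding sets using K(2) KG Gb by (simp add: sets_restrict_space_iff compact_imp_closed)
  have Kc: "c < measure \<mu> K"
  proof -
    have "emeasure \<nu> K = ennreal (measure \<mu> K)"
      unfolding \<nu>[OF borel_closed[OF compact_imp_closed[OF K(2)]]] Int_absorb2[OF KG]
      using fin by (intro emeasure_eq_ennreal_measure) simp
    then show ?thesis using K(3) c(2) by (simp add: ennreal_less_iff)
  qed
  have fing: "finite (mat_res n ` G)" for n by (rule finite_subset[OF _ finite_mat_res]) auto
  \<comment> \<open>\<open>K\<close> is covered by as many cosets as its image has elements, each of
    measure \<open>1 / ?N\<close>; hence the image has density above \<open>c\<close>.\<close>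
  have level: "\<exists>x\<in>K. \<exists>y\<in>K. \<exists>z\<in>K. mat_res n (x ** y ** z) = mat_res n g" if g: "g \<in> G" and n: "n \<ge> 1" for g n
  proof -
    interpret L: finite_group "level_group n G" by (rule finite_group_level_group[OF G(1)])
    let ?S = "mat_res n ` K" and ?N = "card (mat_res n ` G)"
    have N: "?N \<noteq> 0" using fing one_mem by auto
    have finS: "finite ?S" using fing KG by (metis finite_subset image_mono)
    have "measure \<mu> K \<le> measure \<mu> (\<Union>z\<in>?S. {A \<in> G. mat_res n A = z})"
    proof (rule measure_mono_fmeasurable)
      show "K \<subseteq> (\<Union>z\<in>?S. {A \<in> G. mat_res n A = z})" using KG by auto
      have "(\<Union>z\<in>?S. {A \<in> G. mat_res n A = z}) \<in> sets \<mu>"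
        using haar_measure_level(1)[OF G(1) haar] KG by (intro sets.finite_UN finS) auto
      then show "(\<Union>z\<in>?S. {A \<in> G. mat_res n A = z}) \<in> fmeasurable \<mu>"
        using fin by (simp add: fmeasurable_def less_top)
    qed (rule Ks)
    also have "\<dots> \<le> (\<Sum>z\<in>?S. measure \<mu> {A \<in> G. mat_res n A = z})"
      using finS haar_measure_level(1)[OF G(1) haar] KG fin
      by (intro measure_UNION_le) (auto simp: fmeasurable_def less_top)
    also have "\<dots> = (\<Sum>z\<in>?S. 1 / ?N)"
      using haar_measure_level(2)[OF G(1) haar] KG by (intro sum.cong refl) auto
    also have "\<dots> = card ?S / ?N" by simp
    finally have "c < card ?S / ?N" using Kc by simp
    then have "c * ?N < card ?S" using N by (simp add: pos_less_divide_eq)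
    then have "(c * ?N) ^ 3 < real (card ?S) ^ 3" using c(2) by (intro power_strict_mono) auto
    moreover have h: "real h > 0" using c(3) by (auto intro!: Nat.gr0I)
    ultimately have "h * (c * ?N) ^ 3 < h * real (card ?S) ^ 3" by simp
    moreover have "real ?N ^ 3 \<le> h * (c * ?N) ^ 3"
      using mult_right_mono[OF c(3), of "real ?N ^ 3"] by (simp add: power_mult_distrib mult.assoc)
    ultimately have "real (card (carrier (level_group n G))) ^ 3 < real h * real (card ?S) ^ 3"
      by (simp add: level_group_simps)
    then have "\<exists>a\<in>?S. \<exists>b\<in>?S. \<exists>c\<in>?S. a \<otimes>\<^bsub>level_group n G\<^esub> b \<otimes>\<^bsub>level_group n G\<^esub> c = mat_res n g"
      using KG g by (intro L.triple_product_of_large_orbits[OF gen[OF n]]) (auto simp: level_group_simps)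
    then show ?thesis by auto
  qed
  have "g \<in> triple_product A" if g: "g \<in> G" for g
  proof -
    \<comment> \<open>Solvability of the equation at level \<open>n\<close>. These sets are closed
      and decreasing, so by compactness of \<open>K \<times> K \<times> K\<close> solutions in
      \<open>K\<close> at all levels yield one solution over the \<open>p\<close>-adic
      integers.\<close>
    define F where "F n = {(x :: 'p padic_int ^ 'n ^ 'n, y :: 'p padic_int ^ 'n ^ 'n, z). mat_res n (x ** y ** z) = mat_res n g}" for n
    have F_le: "F n \<subseteq> F m" if "m \<le> n" for m n
      unfolding F_def by clarify (rule mat_res_eq_le[OF _ that])
    have "closed (F n)" for n
    proof -
      let ?q = "int CARD('p) ^ n"
      have "- F n = (\<Union>(a, b, c)\<in>{(a, b, c). mat_mod ?q (mat_mod ?q (a ** b) ** c) \<noteq> mat_res n g}.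
          {x. mat_res n x \<in> {a}} \<times> {x. mat_res n x \<in> {b}} \<times> {x. mat_res n x \<in> {c}})"
        by (rule Set.set_eqI) (auto simp: F_def mat_res_mult split_beta)
      also have "open \<dots>"
      proof (rule open_UN, rule ballI)
        fix t :: "(int ^ 'n ^ 'n) \<times> (int ^ 'n ^ 'n) \<times> (int ^ 'n ^ 'n)"
        show "open (case t of (a, b, c) \<Rightarrow> {x :: 'p padic_int ^ 'n ^ 'n. mat_res n x \<in> {a}} \<times>
            {x :: 'p padic_int ^ 'n ^ 'n. mat_res n x \<in> {b}} \<times> {x :: 'p padic_int ^ 'n ^ 'n. mat_res n x \<in> {c}})"
          by (cases t, simp only: prod.case) (intro open_Times open_mat_res)
      qed
      finally show ?thesis by (simp add: closed_def)
    qed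
    moreover have "(K \<times> K \<times> K) \<inter> (\<Inter>n\<in>I. F n) \<noteq> {}" if I: "finite I" for I
    proof -
      \<comment> \<open>\<open>Suc\<close> keeps the level positive, as \<open>level\<close>
        demands. For empty \<open>I\<close> the value of \<open>Max I\<close> is immaterial.\<close>
      have "F (Suc (Max I)) \<subseteq> F n" if "n \<in> I" for n
        using that I by (intro F_le) (simp add: le_SucI[OF Max_ge])
      moreover obtain x y z where "x \<in> K" "y \<in> K" "z \<in> K" "(x, y, z) \<in> F (Suc (Max I))"
        using level[OF g, of "Suc (Max I)"] by (auto simp: F_def)
      ultimately show ?thesis by blast
    qed
    moreover have "compact (K \<times> K \<times> K)" by (intro compact_Times K(2))
    ultimately have "(K \<times> K \<times> K) \<inter> \<Inter> (range F) \<noteq> {}"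
      using compact_imp_fip_image[of "K \<times> K \<times> K" UNIV F] by metis
    then obtain t where "t \<in> (K \<times> K \<times> K) \<inter> \<Inter> (range F)"
      unfolding ex_in_conv[symmetric] by (elim exE)
    then have t: "t \<in> K \<times> K \<times> K" "\<And>n. t \<in> F n" by simp_all
    obtain x y z where "t = (x, y, z)" by (cases t)
    with t have xyz: "x \<in> K" "y \<in> K" "z \<in> K" "\<And>n. (x, y, z) \<in> F n" by auto
    have "x ** y ** z = g" using xyz(4) by (intro mat_res_eqI) (simp add: F_def)
    moreover have "x \<in> A" "y \<in> A" "z \<in> A" using xyz K(1) B(2) by auto
    ultimately show ?thesis
      unfolding triple_product_def by (intro CollectI exI[of _ x] exI[of _ y] exI[of _ z]) simp
  qed
  moreover have "A \<subseteq> G" using A sets.sets_into_space[OF A] sp by simp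
  ultimately show ?thesis
    unfolding triple_product_def by (auto simp: subset_iff mult_mem)
qed

section \<open>Orbits of characters of unipotent subgroups\<close>

definition add_char :: "int \<Rightarrow> int \<Rightarrow> complex" where
  "add_char q x = cis (2 * pi * (of_int x / of_int q))"

lemma add_char_add: "add_char q (x + y) = add_char q x * add_char q y"
  by (simp add: add_char_def cis_mult add_divide_distrib distrib_left)

lemma norm_add_char [simp]: "cmod (add_char q x) = 1"
  by (simp add: add_char_def)

lemma add_char_0 [simp]: "add_char q 0 = 1"
  by (simp add: add_char_def)

lemma add_char_eq_1_iff:
  assumes "q > 0" shows "add_char q x = 1 \<longleftrightarrow> q dvd x"
proof
  assume "add_char q x = 1"
  then have "cos (2 * pi * (of_int x / of_int q)) = 1"
    unfolding add_char_def by (metis cis.sel(1) one_complex.sel(1))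
  then obtain n :: int where n: "2 * pi * (of_int x / of_int q) = of_int n * 2 * pi"
    unfolding cos_one_2pi_int by blast
  have "of_int x / of_int q = (2 * pi * (of_int x / of_int q)) / (2 * pi)" by simp
  then have "of_int x / of_int q = (of_int n :: real)" unfolding n by simp
  then have "of_int x = (of_int (n * q) :: real)" using assms by (simp add: field_simps)
  then show "q dvd x" by (metis of_int_eq_iff dvd_triv_right)
next
  assume "q dvd x"
  then obtain k where "x = q * k" by blast
  then show "add_char q x = 1" using assms by (simp add: add_char_def)
qed

lemma add_char_eq_iff:
  assumes "q > 0" shows "add_char q x = add_char q y \<longleftrightarrow> q dvd (x - y)"
proof -
  have "add_char q x = add_char q (x - y) * add_char q y"
    by (simp flip: add_char_add)
  moreover have "add_char q y \<noteq> 0"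
    by (metis norm_add_char norm_zero zero_neq_one)
  ultimately show ?thesis using add_char_eq_1_iff[OF assms, of "x - y"] by auto
qed

lemma add_char_mod [simp]:
  assumes "q > 0" shows "add_char q (x * (y mod q)) = add_char q (x * y)"
  unfolding add_char_eq_iff[OF assms]
  by (simp add: mod_eq_dvd_iff mod_mult_right_eq flip: mod_eq_dvd_iff)

text \<open>A full geometric sum whose ratio is a nontrivial \<open>q\<close>-th root of
  unity.\<close>

lemma add_char_sum_eq_0:
  assumes q: "q > 0" and z: "\<not> q dvd z"
  shows "(\<Sum>x\<in>{0..<q}. add_char q (x * z)) = 0"
proof -
  have pow: "add_char q (int k * z) = add_char q z ^ k" for k
    by (induction k) (simp_all add: distrib_right add_char_add)
  have "(\<Sum>x\<in>{0..<q}. add_char q (x * z)) = (\<Sum>k<nat q. add_char q (int k * z))"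
    by (rule sum.reindex_bij_witness[of _ int nat]) auto
  also have "\<dots> = (\<Sum>k<nat q. add_char q z ^ k)" by (simp add: pow)
  also have "\<dots> = (add_char q z ^ nat q - 1) / (add_char q z - 1)"
    using z add_char_eq_1_iff[OF q] by (intro geometric_sum) simp
  also have "add_char q z ^ nat q = 1"
    unfolding pow[symmetric] using q add_char_eq_1_iff[OF q, of "q * z"] by simp
  finally show ?thesis by simp
qed

lemma padic_res_of_nat: "padic_res (of_nat k :: 'p :: prime_card padic_int) n = int k mod int CARD('p) ^ n"
  by (induction k)
    (auto simp: zero_padic_int.rep_eq one_padic_int.rep_eq plus_padic_int.rep_eq mod_simps)

lemma prime_int_card: "prime (int CARD('p :: prime_card))"
  using prime_card[where 'a='p] by simp

text \<open>
  The parameter \<open>m\<close> of \<open>v m\<close> is read off from the entries at \<open>(a, b j)\<close>. Conjugation changes its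
  coordinate \<open>j\<^sub>0\<close> into \<open>\<sigma> t (m\<^sub>j\<^sub>0 + \<Sum> r\<^sub>j m\<^sub>j)\<close> and rescales the others, so for a character that is
  nontrivial on this coordinate, different \<open>t\<close>, or different \<open>r\<close> modulo \<open>p\<close>, give different conjugates.
\<close>

theorem has_large_orbits_level:
  fixes G :: "('p :: prime_card padic_int ^ 'n ^ 'n) set"
    and v :: "('j \<Rightarrow> 'p padic_int) \<Rightarrow> 'p padic_int ^ 'n ^ 'n"
    and a :: 'n and b :: "'j \<Rightarrow> 'n" and \<sigma> :: "nat \<Rightarrow> nat" and T :: "nat set"
    and s :: "'j \<Rightarrow> nat \<Rightarrow> 'j \<Rightarrow> 'p padic_int"
  assumes G: "matrix_group G" and n: "n \<ge> 1" and J: "finite J" "J0 \<subseteq> J"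
    and vG: "\<And>m. v m \<in> G"
    and v_add: "\<And>m m'. v (\<lambda>j. m j + m' j) = v m ** v m'"
    and coord: "\<And>m j. j \<in> J \<Longrightarrow> v m $ a $ b j = m j"
    and ker: "\<And>m. (\<And>j. j \<in> J \<Longrightarrow> padic_res (m j) n = 0) \<Longrightarrow> mat_res n (v m) = mat_res n (mat 1 :: 'p padic_int ^ 'n ^ 'n)"
    and T: "finite T" "\<And>t. t \<in> T \<Longrightarrow> \<not> CARD('p) dvd \<sigma> t"
      "\<And>t t'. t \<in> T \<Longrightarrow> t' \<in> T \<Longrightarrow> t \<noteq> t' \<Longrightarrow> \<not> int CARD('p) dvd int (\<sigma> t) - int (\<sigma> t')"
    and conj: "\<And>j0 t (r :: 'j \<Rightarrow> nat). j0 \<in> J0 \<Longrightarrow> t \<in> T \<Longrightarrow> \<exists>l\<in>G. \<forall>m. \<exists>m'. l ** v m = v m' ** l \<and>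
        m' j0 = of_nat (\<sigma> t) * (m j0 + (\<Sum>j\<in>J-{j0}. of_nat (r j) * m j)) \<and>
        (\<forall>j\<in>J-{j0}. m' j = s j0 t j * m j)"
    and m: "\<And>j. j \<in> J - J0 \<Longrightarrow> m j = 0"
  shows "finite_group.has_large_orbits (level_group n G) (card T * CARD('p) ^ (card J - 1)) (mat_res n (v m))"
proof -
  interpret matrix_group G by fact
  interpret L: finite_group "level_group n G" by (rule finite_group_level_group[OF G])
  let ?H = "level_group n G" and ?p = "int CARD('p)" and ?res = "\<lambda>x :: 'p padic_int. padic_res x n"
  define q where "q = ?p ^ n"
  have p: "prime ?p" by (rule prime_int_card)
  have q: "q > 0" unfolding q_def by simp
  have q1: "q > 1" unfolding q_def using n prime_gt_1_int[OF p] by (intro one_less_power) auto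
  let ?red = "\<lambda>m. mat_res n (v m)"
  define V where "V = range ?red"
  \<comment> \<open>Through the entries at \<open>(a, b j)\<close> the group \<open>V\<close> is a
    product of copies of \<open>\<int>/q\<close> indexed by \<open>J\<close>, so its dual is
    parametrized by coefficient vectors \<open>c\<close> modulo \<open>q\<close>.\<close>
  define I where "I = PiE J (\<lambda>_. {0..<q})"
  define X where "X c z = (\<Prod>j\<in>J. add_char q (c j * z $ a $ b j))" for c :: "'j \<Rightarrow> int" and z :: "int ^ 'n ^ 'n"
  have X_red: "X c (?red m) = (\<Prod>j\<in>J. add_char q (c j * ?res (m j)))" for c m
    unfolding X_def by (intro prod.cong refl) (simp add: mat_res_def coord)
  have red_carrier: "?red m \<in> carrier ?H" for m using vG by (simp add: level_group_simps)
  have red_mult: "?red m \<otimes>\<^bsub>?H\<^esub> ?red m' = ?red (\<lambda>j. m j + m' j)" for m m'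
    by (simp add: v_add)
  have red_zero: "?red m = \<one>\<^bsub>?H\<^esub>" if "\<And>j. j \<in> J \<Longrightarrow> ?res (m j) = 0" for m
    unfolding level_group_simps by (rule ker) (rule that)
  have red_eqI: "?red m = ?red m'" if eq: "\<And>j. j \<in> J \<Longrightarrow> ?res (m j) = ?res (m' j)" for m m'
  proof -
    have "?red (\<lambda>j. m j - m' j) = \<one>\<^bsub>?H\<^esub>"
      using eq by (intro red_zero) (simp add: minus_padic_int.rep_eq)
    moreover have "?red m = ?red (\<lambda>j. m j - m' j) \<otimes>\<^bsub>?H\<^esub> ?red m'"
      unfolding red_mult by simp
    ultimately show ?thesis using red_carrier[of m'] by simp
  qed
  have inv_red: "inv\<^bsub>?H\<^esub> ?red m = ?red (\<lambda>j. - m j)" for m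
  proof (rule L.inv_equality)
    show "?red (\<lambda>j. - m j) \<otimes>\<^bsub>?H\<^esub> ?red m = \<one>\<^bsub>?H\<^esub>"
      unfolding red_mult by (rule red_zero) (simp add: zero_padic_int.rep_eq)
  qed (rule red_carrier)+
  have subV: "subgroup V ?H"
  proof (rule L.subgroupI)
    show "V \<subseteq> carrier ?H" using red_carrier by (auto simp: V_def)
    show "V \<noteq> {}" by (simp add: V_def)
  next
    fix x assume "x \<in> V" then show "inv\<^bsub>?H\<^esub> x \<in> V" by (auto simp: V_def inv_red)
  next
    fix x y assume "x \<in> V" "y \<in> V" then show "x \<otimes>\<^bsub>?H\<^esub> y \<in> V"
      unfolding V_def by (auto simp only: red_mult)
  qed
  have char: "L.is_char V (X c)" for c
    unfolding L.is_char_def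
  proof (intro conjI ballI)
    fix x y assume "x \<in> V" "y \<in> V"
    then obtain m m' where mm: "x = ?red m" "y = ?red m'" by (auto simp: V_def)
    have "add_char q (c j * ?res (m j + m' j)) = add_char q (c j * ?res (m j)) * add_char q (c j * ?res (m' j))" for j
      using add_char_mod[OF q, of "c j" "?res (m j) + ?res (m' j)"]
      by (simp add: plus_padic_int.rep_eq q_def distrib_left add_char_add)
    then show "X c (x \<otimes>\<^bsub>?H\<^esub> y) = X c x * X c y"
      unfolding mm red_mult X_red by (simp add: prod.distrib)
  qed (simp add: X_def flip: prod_norm)
  let ?e = "\<lambda>j i. if i = j then 1 else 0 :: 'p padic_int"
  have res1: "?res 1 = 1" using q1 by (simp add: one_padic_int.rep_eq q_def)
  have X_unit: "X c (?red (?e j)) = add_char q (c j)" if "j \<in> J" for c j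
  proof -
    have "X c (?red (?e j)) = (\<Prod>i\<in>J. if i = j then add_char q (c j) else 1)"
      unfolding X_red by (intro prod.cong refl) (auto simp: res1 zero_padic_int.rep_eq)
    then show ?thesis using that J(1) by simp
  qed
  have inj: "inj_on X I"
  proof (rule inj_onI)
    fix c c' assume c: "c \<in> I" "c' \<in> I" and eq: "X c = X c'"
    show "c = c'"
    proof (rule PiE_ext[OF c[unfolded I_def]])
      fix j assume j: "j \<in> J"
      have "add_char q (c j) = add_char q (c' j)" using X_unit[OF j] eq by metis
      then have "q dvd c j - c' j" using add_char_eq_iff[OF q] by blast
      moreover have "c j \<in> {0..<q}" "c' j \<in> {0..<q}" using c j by (auto simp: I_def)
      ultimately show "c j = c' j"
        by (metis atLeastLessThan_iff mod_eq_dvd_iff mod_pos_pos_trivial)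
    qed
  qed
  have "bij_betw (\<lambda>z. restrict (\<lambda>j. z $ a $ b j) J) V I"
  proof (rule bij_betwI')
    fix x y assume "x \<in> V" "y \<in> V"
    then obtain m m' where mm: "x = ?red m" "y = ?red m'" by (auto simp: V_def)
    show "(restrict (\<lambda>j. x $ a $ b j) J = restrict (\<lambda>j. y $ a $ b j) J) = (x = y)"
    proof
      assume eq: "restrict (\<lambda>j. x $ a $ b j) J = restrict (\<lambda>j. y $ a $ b j) J"
      show "x = y" unfolding mm
      proof (rule red_eqI)
        fix j assume "j \<in> J"
        then show "?res (m j) = ?res (m' j)"
          using fun_cong[OF eq, of j] by (simp add: mm mat_res_def coord)
      qed
    qed simp
  next
    fix x assume "x \<in> V"
    then obtain m where "x = ?red m" by (auto simp: V_def)
    then show "restrict (\<lambda>j. x $ a $ b j) J \<in> I"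
      using padic_res_range[where 'p='p and n=n] by (auto simp: I_def q_def mat_res_def coord)
  next
    fix c assume c: "c \<in> I"
    let ?m = "\<lambda>j. of_nat (nat (c j)) :: 'p padic_int"
    have "restrict (\<lambda>j. ?red ?m $ a $ b j) J = c"
    proof (rule PiE_ext[OF _ c[unfolded I_def]])
      fix j assume j: "j \<in> J"
      then have "c j \<in> {0..<q}" using c by (auto simp: I_def)
      then show "restrict (\<lambda>j. ?red ?m $ a $ b j) J j = c j"
        using j padic_res_of_nat[where 'p = 'p, of "nat (c j)" n] by (simp add: mat_res_def coord q_def)
    qed (use padic_res_range[where 'p='p and n=n] in \<open>auto simp: q_def mat_res_def coord\<close>)
    then show "\<exists>x\<in>V. c = restrict (\<lambda>j. x $ a $ b j) J" unfolding V_def by (intro bexI[of _ "?red ?m"]) auto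
  qed
  then have cardV: "card V = card I" by (rule bij_betw_same_card)
  have dual: "L.full_dual V (X ` I)"
    unfolding L.full_dual_def
  proof (intro conjI ballI impI)
    show "finite (X ` I)" unfolding I_def using J(1) by (intro finite_imageI finite_PiE) auto
    show "card (X ` I) = card V" using card_image[OF inj] cardV by simp
    show "L.is_char V \<psi>" if "\<psi> \<in> X ` I" for \<psi> using that char by auto
  next
    fix z assume z: "z \<in> V" "z \<noteq> \<one>\<^bsub>?H\<^esub>"
    then obtain m where m: "z = ?red m" by (auto simp: V_def)
    then obtain j where j: "j \<in> J" "?res (m j) \<noteq> 0" using z red_zero by blast
    then have "\<not> q dvd ?res (m j)"
      using padic_res_range[of "m j" n] by (auto simp: q_def dest: zdvd_imp_le)
    then have zero: "(\<Sum>x\<in>{0..<q}. add_char q (x * ?res (m j))) = 0" by (rule add_char_sum_eq_0[OF q])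
    have "(\<Sum>\<psi>\<in>X ` I. \<psi> z) = (\<Sum>c\<in>I. \<Prod>j\<in>J. add_char q (c j * ?res (m j)))"
      unfolding sum.reindex[OF inj] by (simp add: m X_red)
    also have "\<dots> = (\<Prod>j\<in>J. \<Sum>x\<in>{0..<q}. add_char q (x * ?res (m j)))"
      unfolding I_def using J(1) by (intro prod_sum_PiE[symmetric]) auto
    also have "\<dots> = 0" using zero j(1) J(1) by (intro prod_zero) auto
    finally show "(\<Sum>\<psi>\<in>X ` I. \<psi> z) = 0" .
  qed
  \<comment> \<open>The coefficient \<open>c\<close> may be divisible by \<open>p\<close>: as
    \<open>x - y\<close> is invertible modulo \<open>q\<close>, nontriviality of \<open>c\<close>
    modulo \<open>q\<close> suffices.\<close>
  have separate: "add_char q (c * x) \<noteq> add_char q (c * y)"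
    if c: "\<not> q dvd c" and xy: "\<not> ?p dvd x - y" for c x y
  proof
    assume "add_char q (c * x) = add_char q (c * y)"
    then have "q dvd c * (x - y)" using add_char_eq_iff[OF q] by (simp add: right_diff_distrib)
    moreover have "coprime q (x - y)"
      unfolding q_def using p xy n by (simp add: prime_imp_coprime)
    ultimately show False using c by (simp add: coprime_dvd_mult_left_iff)
  qed
  have "L.large_orbit (card T * CARD('p) ^ (card J - 1)) V (X c)"
    if c: "c \<in> I" "X c (?red m) \<noteq> 1" for c
  proof -
    \<comment> \<open>Since \<open>m\<close> vanishes outside \<open>J0\<close>, a character
      nontrivial at \<open>v m\<close> has a nontrivial coefficient inside \<open>J0\<close>, where
      conjugating elements are available.\<close>
    have "\<exists>j0\<in>J0. \<not> q dvd c j0"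
    proof (rule ccontr)
      assume *: "\<not> ?thesis"
      have "add_char q (c j * ?res (m j)) = 1" if "j \<in> J" for j
      proof (cases "j \<in> J0")
        case True
        then have "q dvd c j * ?res (m j)" using * that by auto
        then show ?thesis using add_char_eq_1_iff[OF q] by blast
      qed (use m that in \<open>simp add: zero_padic_int.rep_eq\<close>)
      then show False using c(2) by (simp add: X_red)
    qed
    then obtain j0 where j0: "j0 \<in> J0" "\<not> q dvd c j0" by blast
    have j0J: "j0 \<in> J" using j0 J by blast
    define K where "K = T \<times> PiE (J - {j0}) (\<lambda>_. {0..<CARD('p)})"
    have cardK: "card K = card T * CARD('p) ^ (card J - 1)"
      unfolding K_def using J(1) j0J by (simp add: card_cartesian_product card_PiE)
    define P where "P k l \<longleftrightarrow> (\<forall>m. \<exists>m'. l ** v m = v m' ** l \<and>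
        m' j0 = of_nat (\<sigma> (fst k)) * (m j0 + (\<Sum>j\<in>J-{j0}. of_nat (snd k j) * m j)) \<and>
        (\<forall>j\<in>J-{j0}. m' j = s j0 (fst k) j * m j))"
      for k :: "nat \<times> ('j \<Rightarrow> nat)" and l :: "'p padic_int ^ 'n ^ 'n"
    have "\<forall>k\<in>K. \<exists>l. l \<in> G \<and> P k l"
    proof
      fix k assume "k \<in> K"
      then have kT: "fst k \<in> T" unfolding K_def mem_Times_iff by (rule conjunct1)
      show "\<exists>l. l \<in> G \<and> P k l"
        using conj[OF j0(1) kT, where r = "snd k"] unfolding P_def Bex_def by assumption
    qed
    then obtain l where "\<forall>k\<in>K. l k \<in> G \<and> P k (l k)" by (rule exE[OF bchoice])
    then have l: "l k \<in> G" "P k (l k)" if "k \<in> K" for k using that by auto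
    let ?l = "\<lambda>k. mat_res n (l k)"
    have lH: "?l k \<in> carrier ?H" if "k \<in> K" for k using l(1)[OF that] by (simp add: level_group_simps)
    have lv: "\<exists>m'. ?l k \<otimes>\<^bsub>?H\<^esub> ?red m \<otimes>\<^bsub>?H\<^esub> inv\<^bsub>?H\<^esub> ?l k = ?red m' \<and>
        m' j0 = of_nat (\<sigma> (fst k)) * (m j0 + (\<Sum>j\<in>J-{j0}. of_nat (snd k j) * m j)) \<and>
        (\<forall>j\<in>J-{j0}. m' j = s j0 (fst k) j * m j)" if k: "k \<in> K" for k m
    proof -
      obtain m' where m': "l k ** v m = v m' ** l k"
        "m' j0 = of_nat (\<sigma> (fst k)) * (m j0 + (\<Sum>j\<in>J-{j0}. of_nat (snd k j) * m j))"
        "\<forall>j\<in>J-{j0}. m' j = s j0 (fst k) j * m j"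
        using l(2)[OF k] unfolding P_def by blast
      have "?l k \<otimes>\<^bsub>?H\<^esub> ?red m = ?red m' \<otimes>\<^bsub>?H\<^esub> ?l k" using m'(1) by simp
      then have "?l k \<otimes>\<^bsub>?H\<^esub> ?red m \<otimes>\<^bsub>?H\<^esub> inv\<^bsub>?H\<^esub> ?l k = ?red m'"
        using lH[OF k] red_carrier[of m'] by (simp only: L.m_assoc L.inv_closed L.r_inv L.r_one)
      then show ?thesis using m' by blast
    qed
    have distinct: "\<exists>x\<in>V. X c (?l k \<otimes>\<^bsub>?H\<^esub> x \<otimes>\<^bsub>?H\<^esub> inv\<^bsub>?H\<^esub> ?l k) \<noteq>
        X c (?l k' \<otimes>\<^bsub>?H\<^esub> x \<otimes>\<^bsub>?H\<^esub> inv\<^bsub>?H\<^esub> ?l k')" if k: "k \<in> K" "k' \<in> K" "k \<noteq> k'" for k k'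
    proof -
      obtain t r t' r' where kk: "k = (t, r)" "k' = (t', r')" by (cases k, cases k')
      have r: "r \<in> PiE (J - {j0}) (\<lambda>_. {0..<CARD('p)})" "r' \<in> PiE (J - {j0}) (\<lambda>_. {0..<CARD('p)})"
        and t: "t \<in> T" "t' \<in> T" using k by (auto simp: K_def kk)
      \<comment> \<open>The test vector: if the scalings differ, the unit vector at
        \<open>j0\<close> is blind to \<open>r\<close> and separates \<open>\<sigma> t\<close> from
        \<open>\<sigma> t'\<close>; otherwise the unit vector at a coordinate \<open>j\<close> with
        \<open>r j \<noteq> r' j\<close> separates \<open>\<sigma> t * r j\<close> from
        \<open>\<sigma> t * r' j\<close>. Either way the remaining coordinates of the two conjugates
        coincide and cancel.\<close>
      have "\<exists>m. (\<forall>j\<in>J-{j0}. s j0 t j * m j = s j0 t' j * m j) \<and> (\<exists>x y. \<not> ?p dvd int x - int y \<and>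
          of_nat (\<sigma> t) * (m j0 + (\<Sum>j\<in>J-{j0}. of_nat (r j) * m j)) = (of_nat x :: 'p padic_int) \<and>
          of_nat (\<sigma> t') * (m j0 + (\<Sum>j\<in>J-{j0}. of_nat (r' j) * m j)) = (of_nat y :: 'p padic_int))"
      proof (cases "t = t'")
        case False
        have "(\<Sum>j\<in>J-{j0}. of_nat (f j) * ?e j0 j) = 0" for f by (intro sum.neutral) auto
        then show ?thesis using T(3)[OF t False]
          by (intro exI[of _ "?e j0"] conjI exI[of _ "\<sigma> t"] exI[of _ "\<sigma> t'"]) auto
      next
        case True
        then have "r \<noteq> r'" using k(3) kk by simp
        then obtain j where j: "j \<in> J - {j0}" "r j \<noteq> r' j" using PiE_ext[OF r] by blast
        have "(\<Sum>i\<in>J-{j0}. of_nat (f i) * ?e j i) = (\<Sum>i\<in>J-{j0}. if i = j then of_nat (f i) else 0)" for f :: "'j \<Rightarrow> nat"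
          by (intro sum.cong) auto
        then have sum: "(\<Sum>i\<in>J-{j0}. of_nat (f i) * ?e j i) = of_nat (f j)" for f :: "'j \<Rightarrow> nat"
          using j(1) J(1) by simp
        have "\<not> ?p dvd int (r j) - int (r' j)"
        proof
          assume "?p dvd int (r j) - int (r' j)"
          then have "int (r j) mod ?p = int (r' j) mod ?p" by (simp add: mod_eq_dvd_iff)
          moreover have "r j < CARD('p)" "r' j < CARD('p)" using r j(1) by (auto simp: PiE_iff)
          ultimately show False using j(2) by simp
        qed
        moreover have "\<not> ?p dvd int (\<sigma> t)" using T(2)[OF t(1)] by (simp add: int_dvd_int_iff)
        ultimately have "\<not> ?p dvd int (\<sigma> t) * (int (r j) - int (r' j))" using p by (simp add: prime_dvd_mult_iff)
        then have "\<not> ?p dvd int (\<sigma> t * r j) - int (\<sigma> t * r' j)" by (simp add: right_diff_distrib)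
        then show ?thesis using True j(1)
          by (intro exI[of _ "?e j"] conjI exI[of _ "\<sigma> t * r j"] exI[of _ "\<sigma> t * r' j"]) (auto simp: sum)
      qed
      then obtain m x y where m: "\<And>j. j \<in> J - {j0} \<Longrightarrow> s j0 t j * m j = s j0 t' j * m j"
        and xy: "\<not> ?p dvd int x - int y"
        and x: "of_nat (\<sigma> t) * (m j0 + (\<Sum>j\<in>J-{j0}. of_nat (r j) * m j)) = (of_nat x :: 'p padic_int)"
        and y: "of_nat (\<sigma> t') * (m j0 + (\<Sum>j\<in>J-{j0}. of_nat (r' j) * m j)) = (of_nat y :: 'p padic_int)"
        by blast
      obtain m1 where m1: "?l k \<otimes>\<^bsub>?H\<^esub> ?red m \<otimes>\<^bsub>?H\<^esub> inv\<^bsub>?H\<^esub> ?l k = ?red m1"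
        "m1 j0 = of_nat x" "\<forall>j\<in>J-{j0}. m1 j = s j0 t j * m j"
        using lv[OF k(1), of m] unfolding kk fst_conv snd_conv x by blast
      obtain m2 where m2: "?l k' \<otimes>\<^bsub>?H\<^esub> ?red m \<otimes>\<^bsub>?H\<^esub> inv\<^bsub>?H\<^esub> ?l k' = ?red m2"
        "m2 j0 = of_nat y" "\<forall>j\<in>J-{j0}. m2 j = s j0 t' j * m j"
        using lv[OF k(2), of m] unfolding kk fst_conv snd_conv y by blast
      have X_split: "X c (?red m') = add_char q (c j0 * ?res (m' j0)) * (\<Prod>j\<in>J-{j0}. add_char q (c j * ?res (m' j)))" for m'
        unfolding X_red using J(1) j0J by (rule prod.remove)
      have "(\<Prod>j\<in>J-{j0}. add_char q (c j * ?res (m1 j))) = (\<Prod>j\<in>J-{j0}. add_char q (c j * ?res (m2 j)))"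
        using m1(3) m2(3) m by (intro prod.cong refl) simp
      moreover have "(\<Prod>j\<in>J-{j0}. add_char q (c j * ?res (m1 j))) \<noteq> 0"
      proof -
        have "cmod (\<Prod>j\<in>J-{j0}. add_char q (c j * ?res (m1 j))) = 1" by (simp flip: prod_norm)
        then show ?thesis by force
      qed
      moreover have "add_char q (c j0 * ?res (m1 j0)) \<noteq> add_char q (c j0 * ?res (m2 j0))"
        unfolding m1(2) m2(2) padic_res_of_nat q_def[symmetric] add_char_mod[OF q]
        using j0(2) xy by (rule separate)
      ultimately have "X c (?red m1) \<noteq> X c (?red m2)" unfolding X_split by simp
      then show ?thesis using m1(1) m2(1) by (intro bexI[of _ "?red m"]) (simp_all add: V_def)
    qed
    have inj_l: "inj_on ?l K" using distinct by (fastforce intro!: inj_onI)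
    show ?thesis
      unfolding L.large_orbit_def
    proof (intro exI[of _ "?l ` K"] conjI ballI impI)
      show "?l ` K \<subseteq> carrier ?H" using lH by auto
      show "card T * CARD('p) ^ (card J - 1) \<le> card (?l ` K)"
        unfolding card_image[OF inj_l] cardK by simp
    next
      fix x y assume "x \<in> ?l ` K" "y \<in> V"
      then show "x \<otimes>\<^bsub>?H\<^esub> y \<otimes>\<^bsub>?H\<^esub> inv\<^bsub>?H\<^esub> x \<in> V" using lv by (force simp: V_def)
    next
      fix x y assume xy: "x \<in> ?l ` K" "y \<in> ?l ` K" "x \<noteq> y"
      obtain k where k: "x = ?l k" "k \<in> K" using xy(1) by (rule imageE)
      obtain k' where k': "y = ?l k'" "k' \<in> K" using xy(2) by (rule imageE)
      have "k \<noteq> k'" using xy(3) k k' by blast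
      then show "\<exists>z\<in>V. X c (x \<otimes>\<^bsub>?H\<^esub> z \<otimes>\<^bsub>?H\<^esub> inv\<^bsub>?H\<^esub> x) \<noteq> X c (y \<otimes>\<^bsub>?H\<^esub> z \<otimes>\<^bsub>?H\<^esub> inv\<^bsub>?H\<^esub> y)"
        unfolding k(1) k'(1) by (rule distinct[OF k(2) k'(2)])
    qed
  qed
  then show ?thesis
    unfolding L.has_large_orbits_def using subV dual
    by (intro exI[of _ V] exI[of _ "X ` I"]) (auto simp: V_def)
qed

section \<open>The special linear group\<close>

text \<open>The residues of \<open>x\<close> are invertible modulo every \<open>p^n\<close>.
  Inverses modulo \<open>p^n\<close> are unique, hence coherent, and so define a
  \<open>p\<close>-adic integer.\<close>

lemma ex_padic_inverse:
  fixes x :: "'p :: prime_card padic_int"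
  assumes x: "padic_res x 1 \<noteq> 0"
  shows "\<exists>y. x * y = 1"
proof -
  let ?p = "int CARD('p)"
  have p: "prime ?p" by (rule prime_int_card)
  have cop: "coprime (padic_res x n) (?p ^ n)" for n
  proof (cases "n = 0")
    case False
    have "padic_res x n mod ?p ^ 1 = padic_res x 1" using False by (intro padic_res_mod_le) simp
    then have "\<not> ?p dvd padic_res x n" using x by (auto simp: mod_0_imp_dvd)
    then have "coprime ?p (padic_res x n)" using p by (simp add: prime_imp_coprime)
    then show ?thesis by (simp add: coprime_commute)
  qed simp
  then have "\<exists>y. [padic_res x n * y = 1] (mod ?p ^ n)" for n
    by (rule cong_solve_coprime_int)
  then obtain f where f: "\<And>n. [padic_res x n * f n = 1] (mod ?p ^ n)" by metis
  define y where "y = (\<lambda>n. f n mod ?p ^ n)"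
  have "y (Suc n) mod ?p ^ n = y n" for n
  proof -
    have "padic_res x (Suc n) mod ?p ^ n = padic_res x n mod ?p ^ n"
      using padic_res_mod_le[of n "Suc n" x] by simp
    then have 1: "[padic_res x (Suc n) = padic_res x n] (mod ?p ^ n)" by (simp add: cong_def)
    have "[padic_res x (Suc n) * f (Suc n) = 1] (mod ?p ^ n)"
      using f[of "Suc n"] by (rule cong_dvd_modulus) (simp add: le_imp_power_dvd)
    then have "[padic_res x n * f (Suc n) = 1] (mod ?p ^ n)"
      using cong_scalar_right[OF 1, of "f (Suc n)"] by (metis cong_sym cong_trans)
    then have "[padic_res x n * f (Suc n) = padic_res x n * f n] (mod ?p ^ n)"
      using f[of n] by (metis cong_sym cong_trans)
    then have "[f (Suc n) = f n] (mod ?p ^ n)"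
      using cop[of n] by (simp add: cong_mult_lcancel)
    then show ?thesis by (simp add: y_def cong_def mod_mod_cancel)
  qed
  then have y: "padic_res (Abs_padic_int y :: 'p padic_int) = y"
    by (intro Abs_padic_int_inverse) auto
  have "x * Abs_padic_int y = 1"
  proof (rule padic_int_eqI)
    fix n
    have "padic_res x n * y n mod ?p ^ n = 1 mod ?p ^ n"
      using f[of n] by (simp add: y_def cong_def mod_mult_right_eq)
    then show "padic_res (x * Abs_padic_int y) n = padic_res (1 :: 'p padic_int) n"
      by (simp add: times_padic_int.rep_eq y one_padic_int.rep_eq)
  qed
  then show ?thesis by blast
qed

lemma padic_res_1_add:
  fixes x y :: "'p :: prime_card padic_int"
  assumes "padic_res x 1 = 0" shows "padic_res (x + y) 1 = padic_res y 1"
  using assms padic_res_mod[of y 1] by (simp add: plus_padic_int.rep_eq del: padic_res_mod)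

lemma padic_res_one_1: "padic_res (1 :: 'p :: prime_card padic_int) 1 = 1"
  using prime_gt_1_int[OF prime_int_card[where 'p='p]] by (simp add: one_padic_int.rep_eq)

lemma padic_res_det:
  fixes A :: "'p :: prime_card padic_int ^ 'n ^ 'n"
  shows "padic_res (det A) n = det (mat_res n A) mod int CARD('p) ^ n"
proof -
  let ?q = "int CARD('p) ^ n"
  have sign: "padic_res (of_int (sign \<pi>) * x :: 'p padic_int) n = (sign \<pi> * padic_res x n) mod ?q" for \<pi> :: "'n \<Rightarrow> 'n" and x
    by (auto simp: sign_def uminus_padic_int.rep_eq)
  have "padic_res (det A) n =
      (\<Sum>\<pi> | \<pi> permutes UNIV. (sign \<pi> * ((\<Prod>i\<in>UNIV. padic_res (A $ i $ \<pi> i) n) mod ?q)) mod ?q) mod ?q"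
    unfolding det_def padic_res_sum sign padic_res_prod ..
  also have "\<dots> = det (mat_res n A) mod ?q"
    unfolding det_def mat_res_def by (simp add: mod_sum_eq mod_mult_right_eq)
  finally show ?thesis .
qed

text \<open>The matrix \<open>1 + e_i m^T\<close>. For fixed \<open>i\<close> and
  \<open>m i = 0\<close> these form the abelian unipotent radical of a maximal parabolic subgroup of
  \<open>SL\<close>.\<close>

definition row_mat :: "'n \<Rightarrow> ('n \<Rightarrow> 'a) \<Rightarrow> 'a :: comm_ring_1 ^ 'n ^ 'n" where
  "row_mat i m = (\<chi> a b. (if a = b then 1 else 0) + (if a = i then m b else 0))"

lemma row_mat_mult: "(row_mat i m ** A) $ a $ c = A $ a $ c + (if a = i then \<Sum>b\<in>UNIV. m b * A $ b $ c else 0)"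
  by (simp add: row_mat_def matrix_matrix_mult_def distrib_right sum.distrib if_distrib[of "\<lambda>x. x * _"] cong: if_cong)

lemma mult_row_mat: "(A ** row_mat i m) $ a $ c = A $ a $ c + A $ a $ i * m c"
  by (simp add: row_mat_def matrix_matrix_mult_def distrib_left sum.distrib if_distrib[of "\<lambda>x. _ * x"] cong: if_cong)

lemma row_mat_add:
  assumes "m i = 0" shows "row_mat i m ** row_mat i m' = row_mat i (\<lambda>b. m b + m' b)"
  by (simp add: vec_eq_iff mult_row_mat) (use assms in \<open>auto simp: row_mat_def\<close>)

lemma row_mat_0: "row_mat i (\<lambda>_. 0) = mat 1"
  by (simp add: vec_eq_iff row_mat_def mat_def)

text \<open>The entries of \<open>m\<close> are switched on one at a time, each by an elementary row
  operation.\<close>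

lemma det_row_mat:
  fixes m :: "'n :: finite \<Rightarrow> 'a :: comm_ring_1"
  assumes "m i = 0" shows "det (row_mat i m) = 1"
proof -
  have "det (row_mat i (\<lambda>b. if b \<in> S then m b else 0)) = 1" if "finite S" for S
    using that
  proof induction
    case empty
    then show ?case by (simp add: row_mat_0)
  next
    case (insert j S)
    show ?case
    proof (cases "j = i")
      case True
      then have "(\<lambda>b. if b \<in> insert j S then m b else 0) = (\<lambda>b. if b \<in> S then m b else 0)"
        using assms insert.hyps by auto
      then show ?thesis using insert.IH by (simp only:)
    next
      case False
      let ?A = "row_mat i (\<lambda>b. if b \<in> S then m b else 0)"
      have eq: "row_mat i (\<lambda>b. if b \<in> insert j S then m b else 0) =
          (\<chi> k. if k = i then row i ?A + m j *s row j ?A else row k ?A)"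
        using False insert.hyps by (auto simp: vec_eq_iff row_mat_def row_def)
      have "i \<noteq> j" using False by simp
      from det_row_operation[OF this, of ?A "m j"] insert.IH
      show ?thesis unfolding eq by (rule trans)
    qed
  qed
  from this[of UNIV] show ?thesis by simp
qed

text \<open>
  Gaussian elimination over the local ring \<open>\<int>\<^sub>p\<close>, using only multiplications by the matrices
  \<open>1 + e\<^sub>i m\<^sup>T\<close> on either side; \<open>S\<close> is the set of rows that have already been reduced.
\<close>

lemma SL_generated_by_row_mats:
  fixes N :: "('p :: prime_card padic_int ^ 'n ^ 'n) set"
  assumes one: "mat 1 \<in> N" and mult: "\<And>A B. A \<in> N \<Longrightarrow> B \<in> N \<Longrightarrow> A ** B \<in> N"
    and row: "\<And>i m. m i = 0 \<Longrightarrow> row_mat i m \<in> N"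
    and A: "det A = 1"
  shows "A \<in> N"
proof -
  have left: "A \<in> N" if "m i = 0" "row_mat i m ** A \<in> N" for i m A
  proof -
    have "row_mat i (\<lambda>b. - m b) ** (row_mat i m ** A) = A"
      using that(1) by (simp add: matrix_mul_assoc row_mat_add row_mat_0)
    moreover have "row_mat i (\<lambda>b. - m b) \<in> N" using that(1) by (intro row) simp
    ultimately show ?thesis using mult[of "row_mat i (\<lambda>b. - m b)" "row_mat i m ** A"] that(2) by simp
  qed
  have right: "A \<in> N" if "m i = 0" "A ** row_mat i m \<in> N" for i m A
  proof -
    have "(A ** row_mat i m) ** row_mat i (\<lambda>b. - m b) = A"
      using that(1) by (simp add: matrix_mul_assoc[symmetric] row_mat_add row_mat_0)
    moreover have "row_mat i (\<lambda>b. - m b) \<in> N" using that(1) by (intro row) simp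
    ultimately show ?thesis using mult[of "A ** row_mat i m" "row_mat i (\<lambda>b. - m b)"] that(2) by simp
  qed
  have main: "A \<in> N" if "det A = 1" "\<And>s b. s \<in> S \<Longrightarrow> A $ s $ b = (if s = b then 1 else 0)" "card (- S) = k" for A S k
    using that
  proof (induction k arbitrary: A S)
    case 0
    then have "- S = {}" by simp
    then have "S = UNIV" by blast
    then have "A = mat 1" using 0(2) by (simp add: vec_eq_iff mat_def)
    then show ?case using one by simp
  next
    case (Suc k)
    have "card (- S) \<noteq> 0" using Suc.prems(3) by simp
    then have "- S \<noteq> {}" by (metis card.empty)
    then obtain j where j: "j \<notin> S" by blast
    have card: "card (- insert j S) = k"
    proof -
      have "- insert j S = - S - {j}" by auto
      then show ?thesis using Suc.prems(3) j by simp
    qed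
    \<comment> \<open>Column \<open>j\<close> clears the rest of row \<open>j\<close>; the rows in
      \<open>S\<close> have entry \<open>0\<close> in that column and stay reduced.\<close>
    have pivot: "A \<in> N" if A: "det A = 1" "\<And>s b. s \<in> S \<Longrightarrow> A $ s $ b = (if s = b then 1 else 0)" "A $ j $ j = 1" for A
    proof (rule right[rotated])
      let ?m = "\<lambda>b. if b = j then 0 else - A $ j $ b"
      show "A ** row_mat j ?m \<in> N"
      proof (rule Suc.IH[OF _ _ card])
        show "det (A ** row_mat j ?m) = 1" using A(1) by (simp add: det_mul det_row_mat)
      next
        fix s b assume s: "s \<in> insert j S"
        show "(A ** row_mat j ?m) $ s $ b = (if s = b then 1 else 0)"
        proof (cases "s = j")
          case True then show ?thesis using A(3) by (auto simp: mult_row_mat)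
        next
          case False then show ?thesis using s A(2)[of s] by (simp add: mult_row_mat)
        qed
      qed
      show "?m j = 0" by simp
    qed
    \<comment> \<open>A unit at \<open>(j, i)\<close> allows a multiple of column \<open>i\<close>
      to correct the entry at \<open>(j, j)\<close> to 1.\<close>
    have off_diagonal: "A \<in> N" if A: "det A = 1" "\<And>s b. s \<in> S \<Longrightarrow> A $ s $ b = (if s = b then 1 else 0)"
      and i: "i \<notin> S" "i \<noteq> j" "padic_res (A $ j $ i) 1 \<noteq> 0" for A i
    proof -
      obtain u where u: "A $ j $ i * u = 1" using ex_padic_inverse[OF i(3)] by blast
      let ?m = "\<lambda>b. if b = j then u * (1 - A $ j $ j) else 0"
      have "A $ j $ i * (u * (1 - A $ j $ j)) = 1 - A $ j $ j" using u by (simp flip: mult.assoc)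
      moreover have "A $ s $ i = 0" if "s \<in> S" for s using A(2)[OF that] i(1) that by auto
      ultimately have "A ** row_mat i ?m \<in> N"
        using A i by (intro pivot) (auto simp: det_mul det_row_mat mult_row_mat)
      then show ?thesis by (rule right[rotated]) (use i(2) in simp)
    qed
    \<comment> \<open>The rows in \<open>S\<close> are those of the identity, so they can be used to
      clear row \<open>j\<close> in the columns of \<open>S\<close>.\<close>
    let ?m = "\<lambda>b. if b \<in> S then - A $ j $ b else 0"
    define B where "B = row_mat j ?m ** A"
    have B1: "det B = 1" using Suc.prems(1) j by (simp add: B_def det_mul det_row_mat)
    have B2: "B $ s $ b = (if s = b then 1 else 0)" if "s \<in> S" for s b
      using that j Suc.prems(2)[OF that] by (auto simp: B_def row_mat_mult)
    have B3: "B $ j $ b = 0" if "b \<in> S" for b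
    proof -
      have "(\<Sum>c\<in>UNIV. ?m c * A $ c $ b) = (\<Sum>c\<in>UNIV. if c = b then - A $ j $ b else 0)"
        using Suc.prems(2) that by (intro sum.cong) auto
      then show ?thesis by (simp add: B_def row_mat_mult)
    qed
    have "B \<in> N"
    proof (cases "\<exists>i. i \<notin> S \<and> i \<noteq> j \<and> padic_res (B $ j $ i) 1 \<noteq> 0")
      case True
      then obtain i where "i \<notin> S" "i \<noteq> j" "padic_res (B $ j $ i) 1 \<noteq> 0" by blast
      then show ?thesis by (intro off_diagonal[OF B1 B2])
    next
      case False
      \<comment> \<open>Otherwise all of row \<open>j\<close> would vanish modulo \<open>p\<close>,
        against determinant 1.\<close>
      have unit: "padic_res (B $ j $ j) 1 \<noteq> 0"
      proof
        assume "padic_res (B $ j $ j) 1 = 0"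
        then have "padic_res (B $ j $ b) 1 = 0" for b
          using False B3[of b] by (cases "b \<in> S"; cases "b = j") (auto simp: zero_padic_int.rep_eq)
        then have "row j (mat_res 1 B) = 0" by (simp add: row_def mat_res_def vec_eq_iff)
        then have "det (mat_res 1 B) = 0" by (rule det_zero_row)
        then have "padic_res (det B) 1 = 0" unfolding padic_res_det by simp
        then show False unfolding B1 padic_res_one_1 by simp
      qed
      show ?thesis
      proof (cases "\<exists>i. i \<notin> S \<and> i \<noteq> j")
        case True
        then obtain i where i: "i \<notin> S" "i \<noteq> j" by blast
        \<comment> \<open>Adding column \<open>j\<close> to column \<open>i\<close> makes the entry
          at \<open>(j, i)\<close> a unit.\<close>
        let ?r = "\<lambda>b. if b = i then 1 else 0 :: 'p padic_int"
        have "padic_res (B $ j $ i + B $ j $ j) 1 \<noteq> 0"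
          using False i unit by (subst padic_res_1_add) auto
        moreover have "B $ s $ j = 0" if "s \<in> S" for s using B2[OF that] j that by auto
        ultimately have "B ** row_mat j ?r \<in> N"
          using i B1 B2 by (intro off_diagonal[of _ i]) (auto simp: det_mul det_row_mat mult_row_mat)
        then show ?thesis by (rule right[rotated]) (use i in simp)
      next
        \<comment> \<open>Now \<open>j\<close> is the only index outside \<open>S\<close>, so
          \<open>B\<close> is diagonal and its determinant forces the last entry to be 1.\<close>
        case no: False
        have off: "B $ s $ b = 0" if "s \<noteq> b" for s b
          using no B2[of s b] B3[of b] that by (cases "s \<in> S") auto
        have "B $ s $ s = 1" if "s \<noteq> j" for s using no B2[of s s] that by auto
        then have "(\<Prod>s\<in>UNIV. B $ s $ s) = (\<Prod>s\<in>UNIV. if s = j then B $ j $ j else 1)"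
          by (intro prod.cong) auto
        then have "B $ j $ j = 1" using det_diagonal[of B, OF off] B1 by simp
        then show ?thesis by (intro pivot[OF B1 B2])
      qed
    qed
    then show ?case unfolding B_def by (rule left[rotated]) (use j in simp)
  qed
  show ?thesis by (rule main[of A "{}"]) (use A in auto)
qed

text \<open>Inverses come from elimination: the matrices with an inverse in \<open>SL\<close> are
  closed under products and contain each \<open>row_mat i m\<close> with \<open>m i = 0\<close>,
  whose inverse is given by \<open>- m\<close>.\<close>

lemma matrix_group_SL: "matrix_group (SL :: ('p :: prime_card padic_int ^ 'n ^ 'n) set)"
proof
  fix A :: "'p padic_int ^ 'n ^ 'n" assume A: "A \<in> SL"
  let ?N = "{A :: 'p padic_int ^ 'n ^ 'n. \<exists>B\<in>SL. A ** B = mat 1 \<and> B ** A = mat 1}"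
  have "A \<in> ?N"
  proof (rule SL_generated_by_row_mats)
    show "mat 1 \<in> ?N" by (auto simp: SL_def)
    show "det A = 1" using A by (simp add: SL_def)
  next
    fix A B assume "A \<in> ?N" "B \<in> ?N"
    then obtain A' B' where AB: "A' \<in> SL" "A ** A' = mat 1" "A' ** A = mat 1"
      "B' \<in> SL" "B ** B' = mat 1" "B' ** B = mat 1" by blast
    have "(A ** B) ** (B' ** A') = A ** (B ** B') ** A'" "(B' ** A') ** (A ** B) = B' ** (A' ** A) ** B"
      by (simp_all add: matrix_mul_assoc)
    moreover have "B' ** A' \<in> SL" using AB by (simp add: SL_def det_mul)
    ultimately show "A ** B \<in> ?N" using AB by auto
  next
    fix i and m :: "'n \<Rightarrow> 'p padic_int" assume "m i = 0"
    then show "row_mat i m \<in> ?N"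
      by (intro CollectI bexI[of _ "row_mat i (\<lambda>b. - m b)"])
        (auto simp: row_mat_add row_mat_0 SL_def det_row_mat)
  qed
  then show "\<exists>B\<in>SL. A ** B = mat 1 \<and> B ** A = mat 1" by blast
qed (auto simp: SL_def det_mul)

lemma closed_SL: "closed (SL :: ('p :: prime_card padic_int ^ 'n ^ 'n) set)"
proof -
  have "A \<in> SL \<longleftrightarrow> (\<forall>n. mat_res n A \<in> {M. det M mod int CARD('p) ^ n = 1 mod int CARD('p) ^ n})"
    for A :: "'p padic_int ^ 'n ^ 'n"
    by (auto simp: SL_def one_padic_int.rep_eq simp flip: padic_res_det intro: padic_int_eqI)
  then have "(SL :: ('p padic_int ^ 'n ^ 'n) set) =
      (\<Inter>n. {A. mat_res n A \<in> {M. det M mod int CARD('p) ^ n = 1 mod int CARD('p) ^ n}})"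
    by auto
  also have "closed \<dots>" by (intro closed_INT ballI closed_mat_res)
  finally show ?thesis .
qed

text \<open>Take \<open>l = D (1 - r e_j^T)\<close> with \<open>D\<close> the diagonal matrix of
  \<open>d\<close>. Then \<open>l e_i = d i e_i\<close>, while
  \<open>m^T l^(-1) = m^T (1 + r e_j^T) D^(-1)\<close> adds \<open>r^T m\<close> to coordinate
  \<open>j\<close> and divides coordinate \<open>b\<close> by \<open>d b\<close>.\<close>

lemma row_mat_conj:
  fixes d d' r :: "'n :: finite \<Rightarrow> 'a :: comm_ring_1"
  assumes d: "\<And>a. d a * d' a = 1" "prod d UNIV = 1" and j: "j \<noteq> i" and r: "r i = 0" "r j = 0"
  shows "\<exists>l\<in>SL. \<forall>m. m i = 0 \<longrightarrow>
    l ** row_mat i m = row_mat i (\<lambda>b. d i * d' b * (if b = j then m j + (\<Sum>a\<in>UNIV. r a * m a) else m b)) ** l"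
proof -
  define l where "l = (\<chi> a b. d a * ((if a = b then 1 else 0) - (if b = j then r a else 0)))"
  have "l = (\<chi> a b. if a = b then d a else 0) ** transpose (row_mat j (\<lambda>a. - r a))"
    by (auto simp: l_def vec_eq_iff matrix_matrix_mult_def row_mat_def transpose_def if_distrib[of "\<lambda>x. x * _"] cong: if_cong)
  then have "det l = 1"
    using d(2) r by (simp add: det_mul det_row_mat det_diagonal)
  moreover have "l ** row_mat i m = row_mat i (\<lambda>b. d i * d' b * (if b = j then m j + (\<Sum>a\<in>UNIV. r a * m a) else m b)) ** l"
    (is "_ = row_mat i ?m' ** l") if m: "m i = 0" for m
  proof -
    have dd: "?m' b * d b = d i * (if b = j then m j + (\<Sum>a\<in>UNIV. r a * m a) else m b)" for b
    proof -
      have "?m' b * d b = d i * (d b * d' b) * (if b = j then m j + (\<Sum>a\<in>UNIV. r a * m a) else m b)"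
        by (simp only: ac_simps)
      then show ?thesis unfolding d(1) by simp
    qed
    have "l $ a $ i * m c = (if a = i then \<Sum>b\<in>UNIV. ?m' b * l $ b $ c else 0)" for a c
    proof (cases "a = i")
      case True
      have "(\<Sum>b\<in>UNIV. ?m' b * l $ b $ c) = (\<Sum>b\<in>UNIV. (?m' b * d b) * ((if b = c then 1 else 0) - (if c = j then r b else 0)))"
        by (simp add: l_def mult.assoc)
      also have "\<dots> = (\<Sum>b\<in>UNIV. (if b = c then ?m' c * d c else 0)) - (\<Sum>b\<in>UNIV. if c = j then ?m' b * d b * r b else 0)"
        unfolding sum_subtractf[symmetric] by (intro sum.cong refl) (simp add: algebra_simps)
      also have "\<dots> = ?m' c * d c - (if c = j then \<Sum>b\<in>UNIV. ?m' b * d b * r b else 0)"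
        by simp
      also have "(\<Sum>b\<in>UNIV. ?m' b * d b * r b) = d i * (\<Sum>b\<in>UNIV. r b * m b)"
        unfolding dd sum_distrib_left using r by (intro sum.cong refl) (auto simp: algebra_simps)
      also have "?m' c * d c - (if c = j then d i * (\<Sum>b\<in>UNIV. r b * m b) else 0) = d i * m c"
        unfolding dd by (simp add: distrib_left)
      finally show ?thesis using True j by (simp add: l_def)
    next
      case False
      then show ?thesis using j by (simp add: l_def)
    qed
    then show ?thesis by (simp add: vec_eq_iff mult_row_mat row_mat_mult)
  qed
  ultimately show ?thesis by (intro bexI[of _ l]) (auto simp: SL_def)
qed

text \<open>Every coordinate \<open>j \<noteq> i\<close> can serve as the distinguished one; the
  exponent counts the remaining indices other than \<open>i\<close> and \<open>j\<close>.\<close>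

lemma has_large_orbits_SL:
  fixes \<sigma> :: "nat \<Rightarrow> nat" and T :: "nat set" and m :: "'n :: finite \<Rightarrow> 'p :: prime_card padic_int"
  assumes n: "n \<ge> 1"
    and T: "finite T" "\<And>t. t \<in> T \<Longrightarrow> \<not> CARD('p) dvd \<sigma> t"
      "\<And>t t'. t \<in> T \<Longrightarrow> t' \<in> T \<Longrightarrow> t \<noteq> t' \<Longrightarrow> \<not> int CARD('p) dvd int (\<sigma> t) - int (\<sigma> t')"
    and d: "\<And>j t. j \<noteq> i \<Longrightarrow> t \<in> T \<Longrightarrow> \<exists>d d' :: 'n \<Rightarrow> 'p padic_int.
      (\<forall>a. d a * d' a = 1) \<and> prod d UNIV = 1 \<and> d i * d' j = of_nat (\<sigma> t)"
    and m: "m i = 0"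
  shows "finite_group.has_large_orbits (level_group n (SL :: ('p padic_int ^ 'n ^ 'n) set))
    (card T * CARD('p) ^ (CARD('n) - 2)) (mat_res n (row_mat i m))"
proof -
  define v where "v m = row_mat i (\<lambda>b. if b = i then 0 else m b)" for m :: "'n \<Rightarrow> 'p padic_int"
  have "\<exists>d d' :: 'n \<Rightarrow> 'p padic_int. j \<noteq> i \<longrightarrow> t \<in> T \<longrightarrow>
      (\<forall>a. d a * d' a = 1) \<and> prod d UNIV = 1 \<and> d i * d' j = of_nat (\<sigma> t)" for j t
    using d[of j t] by blast
  then obtain d d' :: "'n \<Rightarrow> nat \<Rightarrow> 'n \<Rightarrow> 'p padic_int" where d: "\<And>j t. j \<noteq> i \<Longrightarrow> t \<in> T \<Longrightarrow>
      (\<forall>a. d j t a * d' j t a = 1) \<and> prod (d j t) UNIV = 1 \<and> d j t i * d' j t j = of_nat (\<sigma> t)"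
    by metis
  have "finite_group.has_large_orbits (level_group n (SL :: ('p padic_int ^ 'n ^ 'n) set))
    (card T * CARD('p) ^ (card (UNIV - {i}) - 1)) (mat_res n (v m))"
  proof (rule has_large_orbits_level[where J = "UNIV - {i}" and ?J0.0 = "UNIV - {i}" and a = i and b = "\<lambda>j. j"
        and s = "\<lambda>j t b. d j t i * d' j t b" and T = T and \<sigma> = \<sigma> and v = v, OF matrix_group_SL n _ _ _ _ _ _ T])
    show "v m \<in> SL" for m by (simp add: v_def SL_def det_row_mat)
    show "v (\<lambda>j. m j + m' j) = v m ** v m'" for m m'
      unfolding v_def by (subst row_mat_add) (auto intro!: arg_cong[where f = "row_mat i"])
    show "v m $ i $ j = m j" if "j \<in> UNIV - {i}" for m j using that by (simp add: v_def row_mat_def)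
    show "mat_res n (v m) = mat_res n (mat 1 :: 'p padic_int ^ 'n ^ 'n)"
      if "\<And>j. j \<in> UNIV - {i} \<Longrightarrow> padic_res (m j) n = 0" for m
      using that by (auto simp: v_def mat_res_def vec_eq_iff row_mat_def mat_def zero_padic_int.rep_eq)
  next
    fix j t and r :: "'n \<Rightarrow> nat" assume j: "j \<in> UNIV - {i}" and t: "t \<in> T"
    let ?r = "\<lambda>b. if b = i \<or> b = j then 0 else of_nat (r b) :: 'p padic_int"
    obtain l where l: "l \<in> SL" "\<And>m. m i = 0 \<Longrightarrow> l ** row_mat i m =
        row_mat i (\<lambda>b. d j t i * d' j t b * (if b = j then m j + (\<Sum>a\<in>UNIV. ?r a * m a) else m b)) ** l"
      using row_mat_conj[of "d j t" "d' j t" j i ?r] d[of j t] j t by auto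
    show "\<exists>l\<in>SL. \<forall>m. \<exists>m'. l ** v m = v m' ** l \<and>
        m' j = of_nat (\<sigma> t) * (m j + (\<Sum>b\<in>UNIV - {i} - {j}. of_nat (r b) * m b)) \<and>
        (\<forall>b\<in>UNIV - {i} - {j}. m' b = d j t i * d' j t b * m b)"
    proof (intro bexI[OF _ l(1)] allI)
      fix m :: "'n \<Rightarrow> 'p padic_int"
      let ?m = "\<lambda>b. if b = i then 0 else m b"
      let ?m' = "\<lambda>b. d j t i * d' j t b * (if b = j then ?m j + (\<Sum>a\<in>UNIV. ?r a * ?m a) else ?m b)"
      have sum: "(\<Sum>a\<in>UNIV. ?r a * ?m a) = (\<Sum>b\<in>UNIV - {i} - {j}. of_nat (r b) * m b)"
        by (intro sum.mono_neutral_cong_right) auto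
      have "?m' i = 0" using j by simp
      then have "(\<lambda>b. if b = i then 0 else ?m' b) = ?m'" by auto
      then have "l ** v m = v ?m' ** l" using l(2)[of ?m] unfolding v_def by simp
      then show "\<exists>m'. l ** v m = v m' ** l \<and>
          m' j = of_nat (\<sigma> t) * (m j + (\<Sum>b\<in>UNIV - {i} - {j}. of_nat (r b) * m b)) \<and>
          (\<forall>b\<in>UNIV - {i} - {j}. m' b = d j t i * d' j t b * m b)"
        using d[of j t] j t sum by (intro exI[of _ ?m']) auto
    qed
  qed auto
  moreover have "v m = row_mat i m"
    unfolding v_def using m by (intro arg_cong[where f = "row_mat i"]) auto
  moreover have "card (UNIV - {i}) - 1 = CARD('n) - 2" by (simp add: card_Diff_singleton)
  ultimately show ?thesis by simp
qed

text \<open>The preimage of \<open>N\<close> under reduction inherits the closure properties of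
  \<open>N\<close>. So generation is proved once over the \<open>p\<close>-adic integers and holds
  at every level.\<close>

lemma normally_generated_level:
  fixes G :: "('p :: prime_card padic_int ^ 'n ^ 'n) set"
  assumes G: "matrix_group G" and UG: "U \<subseteq> G"
    and U: "\<And>u. u \<in> U \<Longrightarrow> finite_group.has_large_orbits (level_group n G) h (mat_res n u)"
    and gen: "\<And>N. N \<subseteq> G \<Longrightarrow> mat 1 \<in> N \<Longrightarrow> (\<And>A B. A \<in> N \<Longrightarrow> B \<in> N \<Longrightarrow> A ** B \<in> N) \<Longrightarrow>
      (\<And>A g g'. A \<in> N \<Longrightarrow> g \<in> G \<Longrightarrow> g' \<in> G \<Longrightarrow> g ** g' = mat 1 \<Longrightarrow> g' ** g = mat 1 \<Longrightarrow> g ** A ** g' \<in> N) \<Longrightarrow>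
      U \<subseteq> N \<Longrightarrow> G \<subseteq> N"
  shows "finite_group.normally_generated_by_large_orbits (level_group n G) h"
proof -
  interpret matrix_group G by fact
  interpret L: finite_group "level_group n G" by (rule finite_group_level_group[OF G])
  let ?H = "level_group n G"
  have mem: "mat_res n g \<in> carrier ?H" if "g \<in> G" for g using that by (simp add: level_group_simps)
  show ?thesis
    unfolding L.normally_generated_by_large_orbits_def
  proof (intro allI impI)
    fix N assume N: "N \<subseteq> carrier ?H" "\<one>\<^bsub>?H\<^esub> \<in> N" "\<forall>x\<in>N. \<forall>y\<in>N. x \<otimes>\<^bsub>?H\<^esub> y \<in> N"
      "\<forall>x\<in>N. \<forall>g\<in>carrier ?H. g \<otimes>\<^bsub>?H\<^esub> x \<otimes>\<^bsub>?H\<^esub> inv\<^bsub>?H\<^esub> g \<in> N"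
      "\<forall>u\<in>carrier ?H. L.has_large_orbits h u \<longrightarrow> u \<in> N"
    have "G \<subseteq> {A \<in> G. mat_res n A \<in> N}"
    proof (rule gen)
      show "mat 1 \<in> {A \<in> G. mat_res n A \<in> N}" using N(2) one_mem by (simp add: level_group_simps)
      show "U \<subseteq> {A \<in> G. mat_res n A \<in> N}" using U UG N(5) mem by auto
    next
      fix A B assume AB: "A \<in> {A \<in> G. mat_res n A \<in> N}" "B \<in> {A \<in> G. mat_res n A \<in> N}"
      then have "mat_res n A \<otimes>\<^bsub>?H\<^esub> mat_res n B \<in> N" using N(3) by blast
      then show "A ** B \<in> {A \<in> G. mat_res n A \<in> N}" using AB by (simp add: mult_mem)
    next
      fix A g g' assume A: "A \<in> {A \<in> G. mat_res n A \<in> N}" and g: "g \<in> G" "g' \<in> G" "g ** g' = mat 1" "g' ** g = mat 1"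
      have "inv\<^bsub>?H\<^esub> mat_res n g = mat_res n g'"
        using g mem by (intro L.inv_equality) (auto simp: level_group_simps)
      moreover have "mat_res n g \<otimes>\<^bsub>?H\<^esub> mat_res n A \<otimes>\<^bsub>?H\<^esub> inv\<^bsub>?H\<^esub> mat_res n g \<in> N"
        using N(4) A mem[OF g(1)] by blast
      ultimately show "g ** A ** g' \<in> {A \<in> G. mat_res n A \<in> N}" using A g by (simp add: mult_mem)
    qed auto
    then show "N = carrier ?H" using N(1) by (auto simp: level_group_simps)
  qed
qed

lemma mult_powr_cube:
  assumes "h > 0" shows "h * (h powr (- 1 / 3)) ^ 3 = (1 :: real)"
proof -
  have "(h powr (- 1 / 3)) ^ 3 = (h powr (- 1 / 3)) powr 3"
    using assms by simp
  also have "\<dots> = h powr (- 1)"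
    by (simp only: powr_powr) simp
  finally have "(h powr (- 1 / 3)) ^ 3 = h powr (- 1)" .
  then show ?thesis using assms by (simp add: powr_minus)
qed

text \<open>In this range \<open>t + t'\<close> lies strictly between \<open>0\<close> and
  \<open>p\<close>, and so does the absolute value of \<open>t - t'\<close> when
  \<open>t \<noteq> t'\<close>; hence neither factor of the difference of squares is divisible by
  \<open>p\<close>.\<close>

lemma squares_mod_prime:
  fixes p t t' :: nat
  assumes p: "prime p" and t: "t \<in> {1..(p - 1) div 2}"
  shows "\<not> p dvd t\<^sup>2"
    and "t' \<in> {1..(p - 1) div 2} \<Longrightarrow> t \<noteq> t' \<Longrightarrow> \<not> int p dvd int (t\<^sup>2) - int (t'\<^sup>2)"
proof -
  have "t < p" "t > 0" using t prime_gt_1_nat[OF p] by auto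
  then have "\<not> p dvd t" by (auto dest: dvd_imp_le)
  then show "\<not> p dvd t\<^sup>2" using p by (simp add: prime_dvd_power_iff)
  assume t': "t' \<in> {1..(p - 1) div 2}" "t \<noteq> t'"
  show "\<not> int p dvd int (t\<^sup>2) - int (t'\<^sup>2)"
  proof
    assume "int p dvd int (t\<^sup>2) - int (t'\<^sup>2)"
    also have "int (t\<^sup>2) - int (t'\<^sup>2) = (int t - int t') * (int t + int t')"
      by (simp add: power2_eq_square algebra_simps)
    finally have "int p dvd int t - int t' \<or> int p dvd int t + int t'"
      using p by (subst (asm) prime_dvd_mult_iff) auto
    moreover have "\<not> int p dvd int t + int t'"
      using t t' by (auto dest!: zdvd_imp_le)
    moreover have "\<not> int p dvd int t - int t'"
    proof
      assume "int p dvd int t - int t'"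
      moreover have "int t - int t' \<noteq> 0" using t' by simp
      ultimately have "\<bar>int p\<bar> \<le> \<bar>int t - int t'\<bar>" by (rule dvd_imp_le_int[rotated])
      then show False using t t' by auto
    qed
    ultimately show False by blast
  qed
qed

lemma ex_padic_of_nat_inverse:
  assumes "\<not> CARD('p) dvd t"
  shows "\<exists>u :: 'p :: prime_card padic_int. of_nat t * u = 1"
proof (rule ex_padic_inverse)
  show "padic_res (of_nat t :: 'p padic_int) 1 \<noteq> 0"
    using assms by (simp add: padic_res_of_nat flip: dvd_eq_mod_eq_0 int_dvd_int_iff)
qed

lemma ex_torus_element:
  fixes w u :: "'a :: comm_ring_1" and x y :: "'n :: finite"
  assumes "w * u = 1" "x \<noteq> y"
  shows "\<exists>d d' :: 'n \<Rightarrow> 'a. (\<forall>a. d a * d' a = 1) \<and> prod d UNIV = 1 \<and>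
    d x = w \<and> d' x = u \<and> d y = u \<and> d' y = w \<and> (\<forall>a. a \<noteq> x \<longrightarrow> a \<noteq> y \<longrightarrow> d a = 1 \<and> d' a = 1)"
proof -
  let ?d = "\<lambda>w u a. if a = x then w else if a = y then u else 1 :: 'a"
  have "prod (?d w u) UNIV = prod (?d w u) {x, y}"
    by (rule prod.mono_neutral_right) auto
  also have "\<dots> = 1" using assms by simp
  finally show ?thesis
    using assms by (intro exI[of _ "?d w u"] exI[of _ "?d u w"]) (auto simp: mult.commute)
qed

theorem triple_product_SL:
  fixes \<mu> :: "('p :: prime_card padic_int ^ 'n ^ 'n) measure"
  assumes p: "CARD('p) \<ge> 3" and k: "CARD('n) \<ge> 2" and haar: "normalized_haar_measure SL \<mu>"
    and A: "A \<in> sets (completion \<mu>)" "measure (completion \<mu>) A > h_SL CARD('n) CARD('p) powr (- 1 / 3)"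
  shows "triple_product A = SL"
proof -
  let ?p = "CARD('p)" and ?k = "CARD('n)"
  let ?SL = "SL :: ('p padic_int ^ 'n ^ 'n) set"
  have prime: "prime ?p" by (rule prime_card)
  have odd: "odd ?p" using prime p prime_odd_nat by auto
  obtain h where h: "real h = h_SL ?k ?p"
    and large: "\<And>n i (m :: 'n \<Rightarrow> 'p padic_int). n \<ge> 1 \<Longrightarrow> m i = 0 \<Longrightarrow>
      finite_group.has_large_orbits (level_group n ?SL) h (mat_res n (row_mat i m))"
  proof (cases "?k = 2")
    case True
    \<comment> \<open>With two indices, determinant 1 leaves only the torus elements with entries
      \<open>t\<close> and \<open>1/t\<close>, which scale the root coordinate by
      \<open>t^2\<close>; half of the residues exhaust the squares.\<close>
    let ?T = "{1..(?p - 1) div 2}"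
    show thesis
    proof (rule that[of "card ?T * ?p ^ (?k - 2)"])
      have "real ((?p - 1) div 2) = (real ?p - 1) / 2" using odd p by (auto elim!: oddE)
      then show "real (card ?T * ?p ^ (?k - 2)) = h_SL ?k ?p" using True by (simp add: h_SL_def)
    next
      fix n :: nat and i and m :: "'n \<Rightarrow> 'p padic_int" assume n: "n \<ge> 1" and m: "m i = 0"
      show "finite_group.has_large_orbits (level_group n ?SL) (card ?T * ?p ^ (?k - 2)) (mat_res n (row_mat i m))"
      proof (rule has_large_orbits_SL[where \<sigma> = "\<lambda>t. t\<^sup>2" and T = ?T and m = m and i = i, OF n _ squares_mod_prime[OF prime] _ m])
        fix j t assume j: "j \<noteq> i" and t: "t \<in> ?T"
        have "\<not> ?p dvd t" using squares_mod_prime(1)[OF prime t] by (auto simp: power2_eq_square)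
        then obtain u :: "'p padic_int" where u: "of_nat t * u = 1" using ex_padic_of_nat_inverse by blast
        obtain d d' :: "'n \<Rightarrow> 'p padic_int" where d: "\<forall>a. d a * d' a = 1" "prod d UNIV = 1" "d i = of_nat t" "d' j = of_nat t"
          using ex_torus_element[OF u, of i j] j by metis
        then show "\<exists>d d' :: 'n \<Rightarrow> 'p padic_int. (\<forall>a. d a * d' a = 1) \<and> prod d UNIV = 1 \<and> d i * d' j = of_nat (t\<^sup>2)"
          by (intro exI[of _ d] exI[of _ d']) (simp add: power2_eq_square)
      qed auto
    qed
  next
    case False
    \<comment> \<open>A third index \<open>i'\<close> takes over the compensation: with
      \<open>t\<close> at \<open>i'\<close>, \<open>1/t\<close> at \<open>j\<close> and
      \<open>1\<close> at \<open>i\<close>, the scaling factor of coordinate \<open>j\<close> is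
      \<open>t\<close> itself.\<close>
    let ?T = "{1..?p - 1}"
    show thesis
    proof (rule that[of "card ?T * ?p ^ (?k - 2)"])
      have "?p ^ (?k - 1) = ?p * ?p ^ (?k - 2)" using k by (cases ?k) (auto simp flip: power_Suc)
      then show "real (card ?T * ?p ^ (?k - 2)) = h_SL ?k ?p"
        using False p by (simp add: h_SL_def of_nat_diff algebra_simps flip: of_nat_power)
    next
      fix n :: nat and i and m :: "'n \<Rightarrow> 'p padic_int" assume n: "n \<ge> 1" and m: "m i = 0"
      have dvd: "\<not> ?p dvd t" if "t \<in> ?T" for t using that p by (auto dest: dvd_imp_le)
      show "finite_group.has_large_orbits (level_group n ?SL) (card ?T * ?p ^ (?k - 2)) (mat_res n (row_mat i m))"
      proof (rule has_large_orbits_SL[where \<sigma> = "\<lambda>t. t" and T = ?T and m = m and i = i, OF n _ dvd _ _ m])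
        fix t t' assume t: "t \<in> ?T" "t' \<in> ?T" "t \<noteq> t'"
        show "\<not> int ?p dvd int t - int t'"
        proof
          assume "int ?p dvd int t - int t'"
          moreover have "int t - int t' \<noteq> 0" using t by simp
          ultimately have "\<bar>int ?p\<bar> \<le> \<bar>int t - int t'\<bar>" by (rule dvd_imp_le_int[rotated])
          then show False using t by auto
        qed
      next
        fix j t assume j: "j \<noteq> i" and t: "t \<in> ?T"
        obtain u :: "'p padic_int" where u: "of_nat t * u = 1" using ex_padic_of_nat_inverse[OF dvd[OF t]] by blast
        have "card {i, j} < ?k" using False k j by simp
        then obtain i' where i': "i' \<notin> {i, j}" by (metis UNIV_eq_I less_irrefl)
        obtain d d' :: "'n \<Rightarrow> 'p padic_int" where d: "\<forall>a. d a * d' a = 1" "prod d UNIV = 1" "d' j = of_nat t" "d i = 1"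
          using ex_torus_element[OF u, of i' j] i' j by (metis insert_iff)
        then show "\<exists>d d' :: 'n \<Rightarrow> 'p padic_int. (\<forall>a. d a * d' a = 1) \<and> prod d UNIV = 1 \<and> d i * d' j = of_nat t"
          by (intro exI[of _ d] exI[of _ d']) simp
      qed auto
    qed
  qed
  have hpos: "real h > 0"
  proof -
    have "real ?p ^ (?k - 1) > real ?p ^ (?k - 2)" using p k by (intro power_strict_increasing) auto
    then show ?thesis unfolding h h_SL_def using p by auto
  qed
  show ?thesis
  proof (rule triple_product_of_levels[OF matrix_group_SL closed_SL _ haar A])
    fix n :: nat assume n: "n \<ge> 1"
    define U :: "('p padic_int ^ 'n ^ 'n) set" where "U = {row_mat i m | i m. m i = 0}"
    show "finite_group.normally_generated_by_large_orbits (level_group n ?SL) h"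
    proof (rule normally_generated_level[OF matrix_group_SL, where U = U])
      show "U \<subseteq> ?SL" by (auto simp: U_def SL_def det_row_mat)
      show "finite_group.has_large_orbits (level_group n ?SL) h (mat_res n u)"
        if "u \<in> U" for u using that large[OF n] by (auto simp: U_def)
    next
      fix N :: "('p padic_int ^ 'n ^ 'n) set"
      assume N: "mat 1 \<in> N" "\<And>A B. A \<in> N \<Longrightarrow> B \<in> N \<Longrightarrow> A ** B \<in> N" "U \<subseteq> N"
      have rows: "row_mat i m \<in> N" if "m i = 0" for i m
        using N(3) that unfolding U_def by blast
      show "?SL \<subseteq> N"
      proof
        fix A :: "'p padic_int ^ 'n ^ 'n" assume "A \<in> SL"
        then have "det A = 1" by (simp add: SL_def)
        then show "A \<in> N" by (rule SL_generated_by_row_mats[rotated -1]) (use N(1,2) rows in auto)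
      qed
    qed
  next
    show "1 \<le> real h * (h_SL ?k ?p powr (- 1 / 3)) ^ 3"
      using mult_powr_cube[OF hpos] by (simp add: h)
  qed simp
qed

section \<open>The symplectic group\<close>

definition block_mat :: "'a ^ 'k ^ 'k \<Rightarrow> 'a ^ 'k ^ 'k \<Rightarrow> 'a ^ 'k ^ 'k \<Rightarrow> 'a ^ 'k ^ 'k \<Rightarrow> 'a ^ ('k + 'k) ^ ('k :: finite + 'k)" where
  "block_mat a b c d = (\<chi> i j. case i of
      Inl i \<Rightarrow> (case j of Inl j \<Rightarrow> a $ i $ j | Inr j \<Rightarrow> b $ i $ j)
    | Inr i \<Rightarrow> (case j of Inl j \<Rightarrow> c $ i $ j | Inr j \<Rightarrow> d $ i $ j))"

lemma block_mat_nth [simp]: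
  "block_mat a b c d $ Inl i $ Inl j = a $ i $ j" "block_mat a b c d $ Inl i $ Inr j = b $ i $ j"
  "block_mat a b c d $ Inr i $ Inl j = c $ i $ j" "block_mat a b c d $ Inr i $ Inr j = d $ i $ j"
  by (simp_all add: block_mat_def)

lemma sum_UNIV_sum:
  fixes f :: "'k :: finite + 'k \<Rightarrow> 'a :: comm_monoid_add"
  shows "sum f UNIV = (\<Sum>i\<in>UNIV. f (Inl i)) + (\<Sum>i\<in>UNIV. f (Inr i))"
  by (simp add: sum.Plus flip: UNIV_Plus_UNIV)

lemma all_sum_iff: "(\<forall>i :: 'k + 'k. P i) \<longleftrightarrow> (\<forall>i. P (Inl i)) \<and> (\<forall>i. P (Inr i))"
  by (metis sum.exhaust)

lemma block_mat_mult:
  "block_mat a b c d ** block_mat a' b' c' d' =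
    block_mat (a ** a' + b ** c') (a ** b' + b ** d') (c ** a' + d ** c') (c ** b' + d ** d')"
  by (simp add: vec_eq_iff all_sum_iff matrix_matrix_mult_def sum_UNIV_sum)

lemma transpose_block_mat:
  "transpose (block_mat a b c d) = block_mat (transpose a) (transpose c) (transpose b) (transpose d)"
  by (simp add: vec_eq_iff all_sum_iff transpose_def)

lemma block_mat_1: "block_mat (mat 1) 0 0 (mat 1) = mat 1"
  by (simp add: vec_eq_iff all_sum_iff mat_def)

lemma symplectic_J_block: "symplectic_J = block_mat 0 (mat 1) (- mat 1) 0"
  by (simp add: vec_eq_iff all_sum_iff symplectic_J_def mat_def)

lemma block_mat_mult_Inl:
  "(block_mat a b c d ** A) $ Inl i $ j = (\<Sum>k\<in>UNIV. a $ i $ k * A $ Inl k $ j) + (\<Sum>k\<in>UNIV. b $ i $ k * A $ Inr k $ j)"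
  by (simp add: matrix_matrix_mult_def sum_UNIV_sum)

lemma block_mat_mult_Inr:
  "(block_mat a b c d ** A) $ Inr i $ j = (\<Sum>k\<in>UNIV. c $ i $ k * A $ Inl k $ j) + (\<Sum>k\<in>UNIV. d $ i $ k * A $ Inr k $ j)"
  by (simp add: matrix_matrix_mult_def sum_UNIV_sum)

lemma matrix_minus_mult: "(- A) ** B = - (A ** B)" "A ** (- B) = - (A ** B)"
  for A :: "'a :: comm_ring_1 ^ 'n ^ 'm" and B :: "'a ^ 'l ^ 'n"
  by (simp_all add: vec_eq_iff matrix_matrix_mult_def sum_negf)

lemma matrix_zero_mult: "0 ** B = 0" "A ** 0 = 0"
  for A :: "'a :: comm_ring_1 ^ 'n ^ 'm" and B :: "'a ^ 'l ^ 'n"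
  by (simp_all add: vec_eq_iff matrix_matrix_mult_def)

lemma transpose_minus: "transpose (- A) = - transpose A" for A :: "'a :: comm_ring_1 ^ 'n ^ 'm"
  by (simp add: vec_eq_iff transpose_def)

lemma transpose_zero: "transpose 0 = 0"
  by (simp add: vec_eq_iff transpose_def)

lemma matrix_diff_rdistrib: "(B - C) ** A = B ** A - C ** A" for A :: "'a :: comm_ring_1 ^ 'n ^ 'm"
  by (simp add: vec_eq_iff matrix_matrix_mult_def sum_subtractf algebra_simps)

lemmas block_simps = block_mat_mult transpose_block_mat matrix_minus_mult matrix_zero_mult
  transpose_minus transpose_zero transpose_mat matrix_mul_lid matrix_mul_rid

lemma symplectic_J_sq:
  "symplectic_J ** symplectic_J = - (mat 1 :: 'a :: comm_ring_1 ^ ('k :: finite + 'k) ^ ('k + 'k))"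
  unfolding symplectic_J_block block_simps
  by (simp add: vec_eq_iff all_sum_iff mat_def)

text \<open>Since \<open>J^2 = -1\<close>, the relation \<open>A J A^T = J\<close> says that
  \<open>- J A^T J\<close> is a right inverse of \<open>A\<close>, and invertibility makes it
  two-sided. This replaces \<open>invertible\<close> by equations, which show that \<open>Sp\<close>
  is closed and yield the transposed relation \<open>Sp_form\<close>.\<close>

lemma Sp_iff:
  fixes A :: "'a :: comm_ring_1 ^ ('k :: finite + 'k) ^ ('k + 'k)"
  shows "A \<in> Sp \<longleftrightarrow> A ** (- (symplectic_J ** transpose A ** symplectic_J)) = mat 1 \<and>
    (- (symplectic_J ** transpose A ** symplectic_J)) ** A = mat 1"
    (is "_ \<longleftrightarrow> A ** ?B = mat 1 \<and> ?B ** A = mat 1")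
proof
  let ?J = "symplectic_J :: 'a ^ ('k + 'k) ^ ('k + 'k)"
  have right: "A ** ?B = mat 1 \<longleftrightarrow> A ** ?J ** transpose A = ?J"
  proof
    assume "A ** ?B = mat 1"
    then have "A ** ?B ** ?J = ?J" by simp
    moreover have "A ** ?B ** ?J = - (A ** ?J ** transpose A ** (?J ** ?J))"
      by (simp add: matrix_minus_mult matrix_mul_assoc)
    ultimately show "A ** ?J ** transpose A = ?J" by (simp add: symplectic_J_sq matrix_minus_mult)
  next
    assume eq: "A ** ?J ** transpose A = ?J"
    have "A ** ?B = - ((A ** ?J ** transpose A) ** ?J)"
      by (simp add: matrix_minus_mult matrix_mul_assoc)
    then show "A ** ?B = mat 1" unfolding eq by (simp add: symplectic_J_sq)
  qed
  show "A \<in> Sp" if "A ** ?B = mat 1 \<and> ?B ** A = mat 1"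
    using that right unfolding Sp_def invertible_def by blast
  show "A ** ?B = mat 1 \<and> ?B ** A = mat 1" if A: "A \<in> Sp"
  proof -
    from A obtain A' where A': "A ** A' = mat 1" "A' ** A = mat 1"
      unfolding Sp_def invertible_def by blast
    have AB: "A ** ?B = mat 1" using A right unfolding Sp_def by blast
    then have "A' ** (A ** ?B) = A'" by simp
    then have "?B = A'" using A'(2) by (simp add: matrix_mul_assoc)
    then show ?thesis using AB A'(2) by simp
  qed
qed

lemma Sp_form:
  fixes A :: "'a :: comm_ring_1 ^ ('k :: finite + 'k) ^ ('k + 'k)"
  assumes "A \<in> Sp" shows "transpose A ** symplectic_J ** A = symplectic_J"
proof -
  let ?J = "symplectic_J :: 'a ^ ('k + 'k) ^ ('k + 'k)"
  have "?J ** (- (?J ** transpose A ** ?J) ** A) = ?J" using assms unfolding Sp_iff by simp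
  moreover have "?J ** (- (?J ** transpose A ** ?J) ** A) = - ((?J ** ?J) ** (transpose A ** ?J ** A))"
    by (simp add: matrix_minus_mult matrix_mul_assoc)
  ultimately show ?thesis by (simp add: symplectic_J_sq matrix_minus_mult)
qed

lemma Sp_memI:
  assumes "A ** symplectic_J ** transpose A = symplectic_J" "A ** B = mat 1" "B ** A = mat 1"
  shows "A \<in> Sp"
  using assms unfolding Sp_def invertible_def by blast

lemma matrix_group_Sp: "matrix_group (Sp :: ('a :: comm_ring_1 ^ ('k :: finite + 'k) ^ ('k + 'k)) set)"
proof
  show "(mat 1 :: 'a ^ ('k + 'k) ^ ('k + 'k)) \<in> Sp"
    by (rule Sp_memI[of _ "mat 1"]) (simp_all add: transpose_mat)
next
  let ?J = "symplectic_J :: 'a ^ ('k + 'k) ^ ('k + 'k)"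
  fix A :: "'a ^ ('k + 'k) ^ ('k + 'k)" assume A: "A \<in> Sp"
  then obtain A' where A': "A ** A' = mat 1" "A' ** A = mat 1" and J: "A ** ?J ** transpose A = ?J"
    unfolding Sp_def invertible_def by blast
  have "transpose A ** transpose A' = mat 1"
    using A'(2) by (simp flip: matrix_transpose_mul add: transpose_mat)
  then have "A' ** (A ** ?J ** transpose A) ** transpose A' = ?J"
    using A'(2) by (simp add: matrix_mul_assoc flip: matrix_mul_assoc[of _ "transpose A"])
  then have "A' \<in> Sp" unfolding J using A' by (intro Sp_memI[of _ A])
  then show "\<exists>B\<in>Sp. A ** B = mat 1 \<and> B ** A = mat 1" using A' by blast
  fix B :: "'a ^ ('k + 'k) ^ ('k + 'k)" assume B: "B \<in> Sp"
  then obtain B' where B': "B ** B' = mat 1" "B' ** B = mat 1" and JB: "B ** ?J ** transpose B = ?J"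
    unfolding Sp_def invertible_def by blast
  show "A ** B \<in> Sp"
  proof (rule Sp_memI[of _ "B' ** A'"])
    have "A ** B ** ?J ** transpose (A ** B) = A ** (B ** ?J ** transpose B) ** transpose A"
      by (simp add: matrix_transpose_mul matrix_mul_assoc)
    then show "A ** B ** ?J ** transpose (A ** B) = ?J" unfolding JB J .
    have "A ** B ** (B' ** A') = A ** (B ** B') ** A'" "B' ** A' ** (A ** B) = B' ** (A' ** A) ** B"
      by (simp_all add: matrix_mul_assoc)
    then show "A ** B ** (B' ** A') = mat 1" "B' ** A' ** (A ** B) = mat 1" using A' B' by simp_all
  qed
qed

text \<open>Whether \<open>f A\<close> and \<open>g A\<close> agree at level \<open>n\<close>
  depends only on \<open>A\<close> at level \<open>n\<close>, so the equation is an intersection of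
  closed conditions.\<close>

lemma closed_eq_of_levels:
  fixes f g :: "'p :: prime_card padic_int ^ 'm ^ 'n \<Rightarrow> 'p padic_int ^ 'l ^ 'h"
  assumes f: "\<And>n A B. mat_res n A = mat_res n B \<Longrightarrow> mat_res n (f A) = mat_res n (f B)"
    and g: "\<And>n A B. mat_res n A = mat_res n B \<Longrightarrow> mat_res n (g A) = mat_res n (g B)"
  shows "closed {A. f A = g A}"
proof -
  let ?Z = "\<lambda>n. {mat_res n A | A. mat_res n (f A) = mat_res n (g A)}"
  have "mat_res n (f A) = mat_res n (g A)" if "mat_res n A \<in> ?Z n" for n A
  proof -
    obtain B where B: "mat_res n A = mat_res n B" "mat_res n (f B) = mat_res n (g B)" using \<open>mat_res n A \<in> ?Z n\<close> by blast
    then show ?thesis using f[OF B(1)] g[OF B(1)] by simp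
  qed
  then have "{A. f A = g A} = (\<Inter>n. {A. mat_res n A \<in> ?Z n})"
    by (auto intro: mat_res_eqI)
  also have "closed \<dots>" by (intro closed_INT ballI closed_mat_res)
  finally show ?thesis .
qed

lemma closed_Sp: "closed (Sp :: ('p :: prime_card padic_int ^ ('k :: finite + 'k) ^ ('k + 'k)) set)"
proof -
  let ?B = "\<lambda>A :: 'p padic_int ^ ('k + 'k) ^ ('k + 'k). - (symplectic_J ** transpose A ** symplectic_J)"
  have tr: "mat_res n (transpose A) = transpose (mat_res n A)" for n and A :: "'p padic_int ^ ('k + 'k) ^ ('k + 'k)"
    by (simp add: mat_res_def transpose_def vec_eq_iff)
  have um: "mat_res n (- A) = mat_mod (int CARD('p) ^ n) (- mat_res n A)" for n and A :: "'p padic_int ^ ('k + 'k) ^ ('k + 'k)"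
    by (simp add: mat_res_def mat_mod_def vec_eq_iff uminus_padic_int.rep_eq)
  have "(Sp :: ('p padic_int ^ ('k + 'k) ^ ('k + 'k)) set) = {A. A ** ?B A = mat 1} \<inter> {A. ?B A ** A = mat 1}"
    by (auto simp: Sp_iff)
  also have "closed \<dots>"
    by (intro closed_Int closed_eq_of_levels) (simp_all add: mat_res_mult tr um)
  finally show ?thesis .
qed

section \<open>Unipotent and Levi elements\<close>

definition upper_unip :: "'a :: comm_ring_1 ^ 'k ^ 'k \<Rightarrow> 'a ^ ('k :: finite + 'k) ^ ('k + 'k)" where
  "upper_unip s = block_mat (mat 1) s 0 (mat 1)"

definition lower_unip :: "'a :: comm_ring_1 ^ 'k ^ 'k \<Rightarrow> 'a ^ ('k :: finite + 'k) ^ ('k + 'k)" where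
  "lower_unip s = block_mat (mat 1) 0 s (mat 1)"

lemma upper_unip_add: "upper_unip s ** upper_unip t = upper_unip (s + t)"
  unfolding upper_unip_def block_simps by (simp add: add.commute)

lemma lower_unip_add: "lower_unip s ** lower_unip t = lower_unip (s + t)"
  unfolding lower_unip_def block_simps by (simp add: add.commute)

lemma unip_0: "upper_unip 0 = mat 1" "lower_unip 0 = mat 1"
  by (simp_all add: upper_unip_def lower_unip_def block_mat_1)

lemma upper_unip_Sp: "transpose s = s \<Longrightarrow> upper_unip s \<in> Sp"
  by (rule Sp_memI[of _ "upper_unip (- s)"], unfold upper_unip_add)
    (simp_all add: unip_0, simp add: upper_unip_def symplectic_J_block block_simps)

text \<open>Here \<open>a'\<close> is the inverse transpose of \<open>a\<close>: these are the Levi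
  elements of the Siegel parabolic subgroup.\<close>

lemma levi_Sp:
  assumes "a ** transpose a' = mat 1" "transpose a' ** a = mat 1"
  shows "block_mat a 0 0 a' \<in> Sp"
proof -
  have tr: "a' ** transpose a = mat 1" "transpose a ** a' = mat 1"
    using arg_cong[OF assms(1), of transpose] arg_cong[OF assms(2), of transpose]
    by (simp_all add: matrix_transpose_mul transpose_mat)
  show ?thesis
    by (rule Sp_memI[of _ "block_mat (transpose a') 0 0 (transpose a)"])
      (simp_all add: symplectic_J_block block_simps assms tr block_mat_1)
qed

lemma levi_conj:
  assumes "transpose a ** a' = mat 1"
  shows "block_mat a 0 0 a' ** upper_unip s = upper_unip (a ** s ** transpose a) ** block_mat a 0 0 a'"
  using assms by (simp add: upper_unip_def block_simps flip: matrix_mul_assoc)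

lemma matrix_add_rdistrib: "(B + C) ** A = B ** A + C ** A" for A :: "'a :: comm_ring_1 ^ 'n ^ 'm"
  by (simp add: vec_eq_iff matrix_matrix_mult_def sum.distrib algebra_simps)

definition diag_mat :: "('n \<Rightarrow> 'a) \<Rightarrow> 'a :: comm_ring_1 ^ 'n ^ 'n" where
  "diag_mat d = (\<chi> a b. if a = b then d a else 0)"

lemma diag_mat_mult: "(diag_mat d ** A) $ a $ b = d a * A $ a $ b"
  by (simp add: diag_mat_def matrix_matrix_mult_def if_distrib[of "\<lambda>x. x * _"] cong: if_cong)

lemma mult_diag_mat: "(A ** diag_mat d) $ a $ b = A $ a $ b * d b"
  by (simp add: diag_mat_def matrix_matrix_mult_def if_distrib[of "\<lambda>x. _ * x"] cong: if_cong)

lemma transpose_diag_mat: "transpose (diag_mat d) = diag_mat d"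
  by (simp add: diag_mat_def transpose_def vec_eq_iff)

lemma diag_mat_inverse: "(\<And>a. d a * d' a = 1) \<Longrightarrow> diag_mat d ** diag_mat d' = mat 1"
  by (simp add: vec_eq_iff diag_mat_mult) (simp add: diag_mat_def mat_def)

lemma mult_transpose_row_mat:
  "(A ** transpose (row_mat i m)) $ a $ c = A $ a $ c + (if c = i then \<Sum>b\<in>UNIV. m b * A $ a $ b else 0)"
proof -
  have "A ** transpose (row_mat i m) = transpose (row_mat i m ** transpose A)"
    by (simp only: matrix_transpose_mul transpose_transpose)
  moreover have "transpose (row_mat i m ** transpose A) $ a $ c = (row_mat i m ** transpose A) $ c $ a"
    by (simp add: transpose_def)
  ultimately show ?thesis by (simp add: row_mat_mult transpose_def)
qed

lemma transpose_row_mat_mult: "(transpose (row_mat i m) ** A) $ a $ c = A $ a $ c + m a * A $ i $ c"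
proof -
  have "transpose (row_mat i m) ** A = transpose (transpose A ** row_mat i m)"
    by (simp only: matrix_transpose_mul transpose_transpose)
  moreover have "transpose (transpose A ** row_mat i m) $ a $ c = (transpose A ** row_mat i m) $ c $ a"
    by (simp add: transpose_def)
  ultimately show ?thesis by (simp add: mult_row_mat transpose_def mult.commute)
qed

text \<open>In \<open>upper_unip (sym_row i m)\<close> the diagonal entry \<open>m i\<close> is the
  long root coordinate, and the other \<open>m j\<close> are short root coordinates.\<close>

definition sym_row :: "'n \<Rightarrow> ('n \<Rightarrow> 'a) \<Rightarrow> 'a :: comm_ring_1 ^ 'n ^ 'n" where
  "sym_row i m = (\<chi> a b. if a = i then m b else if b = i then m a else 0)"

lemma transpose_sym_row [simp]: "transpose (sym_row i m) = sym_row i m"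
  by (simp add: sym_row_def transpose_def vec_eq_iff)

text \<open>As \<open>r i = 0\<close>, the row vector \<open>r^T\<close> times the symmetric matrix
  is \<open>q e_i^T\<close>. The congruence adds this once as a row and once as a column, both at
  \<open>(i, i)\<close>, whence the doubling.\<close>

lemma sym_row_congruence:
  fixes m r :: "'n :: finite \<Rightarrow> 'a :: comm_ring_1"
  assumes r: "r i = 0" and q: "(\<Sum>k\<in>UNIV. r k * m k) = q"
  shows "row_mat i r ** sym_row i m ** transpose (row_mat i r) =
    sym_row i (\<lambda>c. m c + (if c = i then q + q else 0))"
proof -
  let ?s = "sym_row i m"
  have "(\<Sum>k\<in>UNIV. r k * ?s $ k $ c) = (\<Sum>k\<in>UNIV. if c = i then r k * m k else 0)" for c
    using r by (intro sum.cong) (auto simp: sym_row_def)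
  then have S: "(\<Sum>k\<in>UNIV. r k * ?s $ k $ c) = (if c = i then q else 0)" for c
    using q by simp
  have A: "(row_mat i r ** ?s) $ b $ c = ?s $ b $ c + (if b = i \<and> c = i then q else 0)" for b c
    unfolding row_mat_mult S by simp
  have B: "(\<Sum>k\<in>UNIV. r k * (row_mat i r ** ?s) $ b $ k) = (if b = i then q else 0)" for b
  proof -
    have "(\<Sum>k\<in>UNIV. r k * (row_mat i r ** ?s) $ b $ k) = (\<Sum>k\<in>UNIV. if b = i then r k * m k else 0)"
    proof (intro sum.cong refl)
      fix k
      show "r k * (row_mat i r ** ?s) $ b $ k = (if b = i then r k * m k else 0)"
        unfolding A using r by (cases "k = i") (simp_all add: sym_row_def)
    qed
    then show ?thesis using q by simp
  qed
  have "(row_mat i r ** ?s ** transpose (row_mat i r)) $ b $ c =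
      sym_row i (\<lambda>c. m c + (if c = i then q + q else 0)) $ b $ c" for b c
  proof -
    have "(row_mat i r ** ?s ** transpose (row_mat i r)) $ b $ c =
        ?s $ b $ c + (if b = i \<and> c = i then q else 0) + (if c = i then if b = i then q else 0 else 0)"
      by (simp only: mult_transpose_row_mat B) (simp only: A)
    then show ?thesis by (simp add: sym_row_def add.assoc)
  qed
  then show ?thesis by (simp only: vec_eq_iff) simp
qed

lemma sym_row_scale: "diag_mat d ** sym_row i m ** diag_mat d = sym_row i (\<lambda>c. d i * d c * m c)"
  by (simp add: vec_eq_iff mult_diag_mat diag_mat_mult sym_row_def mult_ac)

text \<open>Only the diagonal coordinate \<open>i\<close> is distinguished: congruence by
  \<open>row_mat i \<rho>\<close> adds multiples of the others to it and leaves them unchanged, and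
  the torus scales it by \<open>t^2\<close> and the others by \<open>t\<close>.\<close>

lemma has_large_orbits_Sp:
  fixes i :: "'k :: finite" and x :: "'p :: prime_card padic_int"
  assumes p: "CARD('p) \<ge> 3" and n: "n \<ge> 1"
  shows "finite_group.has_large_orbits (level_group n (Sp :: ('p padic_int ^ ('k + 'k) ^ ('k + 'k)) set))
    (card {1..(CARD('p) - 1) div 2} * CARD('p) ^ (CARD('k) - 1))
    (mat_res n (upper_unip (sym_row i (\<lambda>j. if j = i then x else 0))))"
proof (rule has_large_orbits_level[where J = UNIV and ?J0.0 = "{i}" and a = "Inl i" and b = Inr and \<sigma> = "\<lambda>t. t\<^sup>2"
      and s = "\<lambda>_ t _. of_nat t" and T = "{1..(CARD('p) - 1) div 2}" and v = "\<lambda>m. upper_unip (sym_row i m)"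
      and m = "\<lambda>j. if j = i then x else 0"])
  show "matrix_group (Sp :: ('p padic_int ^ ('k + 'k) ^ ('k + 'k)) set)" by (rule matrix_group_Sp)
  show "upper_unip (sym_row i m) \<in> Sp" for m :: "'k \<Rightarrow> 'p padic_int"
    by (intro upper_unip_Sp) simp
  show "upper_unip (sym_row i (\<lambda>j. m j + m' j)) = upper_unip (sym_row i m) ** upper_unip (sym_row i m')"
    for m m' :: "'k \<Rightarrow> 'p padic_int"
    unfolding upper_unip_add by (intro arg_cong[where f = upper_unip]) (simp add: sym_row_def vec_eq_iff)
  show "upper_unip (sym_row i m) $ Inl i $ Inr j = m j" for m :: "'k \<Rightarrow> 'p padic_int" and j
    by (simp add: upper_unip_def sym_row_def)
  show "mat_res n (upper_unip (sym_row i m)) = mat_res n (mat 1 :: 'p padic_int ^ ('k + 'k) ^ ('k + 'k))"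
    if "\<And>j. j \<in> UNIV \<Longrightarrow> padic_res (m j) n = 0" for m :: "'k \<Rightarrow> 'p padic_int"
    unfolding block_mat_1[symmetric] upper_unip_def
    using that by (simp add: mat_res_def vec_eq_iff all_sum_iff sym_row_def zero_padic_int.rep_eq)
  show "\<not> CARD('p) dvd t\<^sup>2" if "t \<in> {1..(CARD('p) - 1) div 2}" for t
    using squares_mod_prime(1)[OF prime_card that] .
  show "\<not> int CARD('p) dvd int (t\<^sup>2) - int (t'\<^sup>2)"
    if "t \<in> {1..(CARD('p) - 1) div 2}" "t' \<in> {1..(CARD('p) - 1) div 2}" "t \<noteq> t'" for t t'
    using squares_mod_prime(2)[OF prime_card that] .
next
  fix j0 t and r :: "'k \<Rightarrow> nat"
  assume j0: "j0 \<in> {i}" and t: "t \<in> {1..(CARD('p) - 1) div 2}"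
  have "\<not> CARD('p) dvd 2" using p by (auto dest: dvd_imp_le)
  then obtain hf :: "'p padic_int" where hf: "of_nat 2 * hf = 1" using ex_padic_of_nat_inverse by blast
  have "\<not> CARD('p) dvd t" using squares_mod_prime(1)[OF prime_card t] by (auto simp: power2_eq_square)
  then obtain u :: "'p padic_int" where u: "of_nat t * u = 1" using ex_padic_of_nat_inverse by blast
  \<comment> \<open>The factor \<open>hf\<close>, the inverse of 2, cancels the doubling in
    \<open>sym_row_congruence\<close>.\<close>
  define \<rho> :: "'k \<Rightarrow> 'p padic_int" where "\<rho> k = (if k = i then 0 else hf * of_nat (r k))" for k
  have \<rho>i: "\<rho> i = 0" by (simp add: \<rho>_def)
  define d :: "'k \<Rightarrow> 'p padic_int" where "d k = (if k = i then of_nat t else 1)" for k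
  define d' :: "'k \<Rightarrow> 'p padic_int" where "d' k = (if k = i then u else 1)" for k
  have dd: "d k * d' k = 1" "d' k * d k = 1" for k using u by (auto simp: d_def d'_def mult.commute)
  define a where "a = diag_mat d ** row_mat i \<rho>"
  define a' where "a' = diag_mat d' ** transpose (row_mat i (\<lambda>k. - \<rho> k))"
  have R: "row_mat i \<rho> ** row_mat i (\<lambda>k. - \<rho> k) = mat 1" "row_mat i (\<lambda>k. - \<rho> k) ** row_mat i \<rho> = mat 1"
    by (simp_all add: row_mat_add \<rho>_def row_mat_0)
  have tr_a': "transpose a' = row_mat i (\<lambda>k. - \<rho> k) ** diag_mat d'"
    by (simp add: a'_def matrix_transpose_mul transpose_diag_mat)
  have "a ** transpose a' = diag_mat d ** (row_mat i \<rho> ** row_mat i (\<lambda>k. - \<rho> k)) ** diag_mat d'"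
    by (simp add: a_def tr_a' matrix_mul_assoc)
  then have aa: "a ** transpose a' = mat 1" unfolding R by (simp add: diag_mat_inverse dd)
  have "transpose a' ** a = row_mat i (\<lambda>k. - \<rho> k) ** (diag_mat d' ** diag_mat d) ** row_mat i \<rho>"
    by (simp add: a_def tr_a' matrix_mul_assoc)
  then have a'a: "transpose a' ** a = mat 1" by (simp add: diag_mat_inverse dd R)
  have taa': "transpose a ** a' = mat 1"
    using arg_cong[OF a'a, of transpose] by (simp add: matrix_transpose_mul transpose_mat)
  have a_sym: "a ** sym_row i m ** transpose a =
      sym_row i (\<lambda>c. d i * d c * (m c + (if c = i then (\<Sum>k\<in>UNIV. \<rho> k * m k) + (\<Sum>k\<in>UNIV. \<rho> k * m k) else 0)))"
    (is "_ = sym_row i (?m' m)") for m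
  proof -
    have "a ** sym_row i m ** transpose a =
        diag_mat d ** (row_mat i \<rho> ** sym_row i m ** transpose (row_mat i \<rho>)) ** diag_mat d"
      by (simp add: a_def matrix_transpose_mul transpose_diag_mat matrix_mul_assoc)
    also have "\<dots> = sym_row i (?m' m)"
      by (simp only: sym_row_congruence[of \<rho> i m, OF \<rho>i refl] sym_row_scale)
    finally show ?thesis .
  qed
  have "block_mat a 0 0 a' ** upper_unip (sym_row i m) = upper_unip (sym_row i (?m' m)) ** block_mat a 0 0 a'" for m
    unfolding levi_conj[OF taa'] a_sym ..
  moreover have "?m' m j0 = of_nat (t\<^sup>2) * (m j0 + (\<Sum>j\<in>UNIV - {j0}. of_nat (r j) * m j))" for m
  proof -
    have "(\<Sum>k\<in>UNIV. \<rho> k * m k) + (\<Sum>k\<in>UNIV. \<rho> k * m k) = (\<Sum>k\<in>UNIV. (of_nat 2 * hf) * (if k = i then 0 else of_nat (r k) * m k))"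
      unfolding sum.distrib[symmetric] by (intro sum.cong refl) (simp add: \<rho>_def algebra_simps)
    also have "\<dots> = (\<Sum>k\<in>UNIV - {i}. of_nat (r k) * m k)"
      unfolding hf by (intro sum.mono_neutral_cong_right) auto
    finally have sum: "(\<Sum>k\<in>UNIV. \<rho> k * m k) + (\<Sum>k\<in>UNIV. \<rho> k * m k) = (\<Sum>k\<in>UNIV - {i}. of_nat (r k) * m k)" .
    have "j0 = i" using j0 by simp
    then show ?thesis by (simp only: sum) (simp add: d_def power2_eq_square)
  qed
  moreover have "\<forall>j\<in>UNIV - {j0}. ?m' m j = of_nat t * m j" for m
    using j0 by (simp add: d_def)
  ultimately have main: "\<forall>m :: 'k \<Rightarrow> 'p padic_int. \<exists>m'. block_mat a 0 0 a' ** upper_unip (sym_row i m) = upper_unip (sym_row i m') ** block_mat a 0 0 a' \<and>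
      m' j0 = of_nat (t\<^sup>2) * (m j0 + (\<Sum>j\<in>UNIV - {j0}. of_nat (r j) * m j)) \<and>
      (\<forall>j\<in>UNIV - {j0}. m' j = of_nat t * m j)" by meson
  have mem: "block_mat a 0 0 a' \<in> Sp" by (rule levi_Sp[OF aa a'a])
  show "\<exists>l\<in>Sp. \<forall>m :: 'k \<Rightarrow> 'p padic_int. \<exists>m'. l ** upper_unip (sym_row i m) = upper_unip (sym_row i m') ** l \<and>
      m' j0 = of_nat (t\<^sup>2) * (m j0 + (\<Sum>j\<in>UNIV - {j0}. of_nat (r j) * m j)) \<and>
      (\<forall>j\<in>UNIV - {j0}. m' j = of_nat t * m j)"
    by (rule bexI[where x = "block_mat a 0 0 a'", OF _ mem]) (rule main)
qed (use n in auto)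

section \<open>Symplectic Gaussian elimination\<close>

lemma Sp_columns:
  fixes A :: "'a :: comm_ring_1 ^ ('k :: finite + 'k) ^ ('k + 'k)"
  assumes "A \<in> Sp"
  shows "(\<Sum>a\<in>UNIV. A $ Inl a $ x * A $ Inr a $ y) - (\<Sum>a\<in>UNIV. A $ Inr a $ x * A $ Inl a $ y) = symplectic_J $ x $ y"
proof -
  let ?J = "symplectic_J :: 'a ^ ('k + 'k) ^ ('k + 'k)"
  have J: "(?J ** A) $ Inl a $ y = A $ Inr a $ y" "(?J ** A) $ Inr a $ y = - A $ Inl a $ y" for a
    by (simp_all add: symplectic_J_block block_mat_mult_Inl block_mat_mult_Inr mat_def
        if_distrib[of "\<lambda>x. x * _"] if_distrib[of uminus] sum_negf cong: if_cong)
  have "?J $ x $ y = (transpose A ** (?J ** A)) $ x $ y"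
    using Sp_form[OF assms] by (simp add: matrix_mul_assoc)
  also have "\<dots> = (\<Sum>a\<in>UNIV. A $ Inl a $ x * A $ Inr a $ y) - (\<Sum>a\<in>UNIV. A $ Inr a $ x * A $ Inl a $ y)"
    by (subst matrix_matrix_mult_def) (simp add: sum_UNIV_sum transpose_def J sum_negf)
  finally show ?thesis by simp
qed

lemma upper_unip_mult:
  "(upper_unip s ** A) $ Inl a $ y = A $ Inl a $ y + (\<Sum>b\<in>UNIV. s $ a $ b * A $ Inr b $ y)"
  "(upper_unip s ** A) $ Inr a $ y = A $ Inr a $ y"
  by (simp_all add: upper_unip_def block_mat_mult_Inl block_mat_mult_Inr mat_def
      if_distrib[of "\<lambda>x. x * _"] cong: if_cong)

lemma lower_unip_mult:
  "(lower_unip s ** A) $ Inr a $ y = A $ Inr a $ y + (\<Sum>b\<in>UNIV. s $ a $ b * A $ Inl b $ y)"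
  "(lower_unip s ** A) $ Inl a $ y = A $ Inl a $ y"
  by (simp_all add: lower_unip_def block_mat_mult_Inl block_mat_mult_Inr mat_def
      if_distrib[of "\<lambda>x. x * _"] add.commute cong: if_cong)

text \<open>The name tells in which half all rows may receive multiples of row \<open>j\<close>; the
  action on the other half is forced by the symplectic form.\<close>

definition levi_upper :: "'k :: finite \<Rightarrow> ('k \<Rightarrow> 'a :: comm_ring_1) \<Rightarrow> 'a ^ ('k + 'k) ^ ('k + 'k)" where
  "levi_upper j c = block_mat (transpose (row_mat j c)) 0 0 (row_mat j (\<lambda>b. - c b))"

definition levi_lower :: "'k :: finite \<Rightarrow> ('k \<Rightarrow> 'a :: comm_ring_1) \<Rightarrow> 'a ^ ('k + 'k) ^ ('k + 'k)" where
  "levi_lower j c = block_mat (row_mat j (\<lambda>b. - c b)) 0 0 (transpose (row_mat j c))"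

lemma block_diag_mult_nth:
  "(block_mat a 0 0 d ** A) $ Inl i $ y = (a ** (\<chi> k y. A $ Inl k $ y)) $ i $ y"
  "(block_mat a 0 0 d ** A) $ Inr i $ y = (d ** (\<chi> k y. A $ Inr k $ y)) $ i $ y"
  by (simp_all add: block_mat_mult_Inl block_mat_mult_Inr) (simp_all add: matrix_matrix_mult_def)

lemma levi_upper_mult:
  "(levi_upper j c ** A) $ Inl a $ y = A $ Inl a $ y + c a * A $ Inl j $ y"
  "(levi_upper j c ** A) $ Inr a $ y = A $ Inr a $ y + (if a = j then \<Sum>b\<in>UNIV. - c b * A $ Inr b $ y else 0)"
  unfolding levi_upper_def block_diag_mult_nth by (simp_all add: transpose_row_mat_mult row_mat_mult)

lemma levi_lower_mult:
  "(levi_lower j c ** A) $ Inr a $ y = A $ Inr a $ y + c a * A $ Inr j $ y"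
  "(levi_lower j c ** A) $ Inl a $ y = A $ Inl a $ y + (if a = j then \<Sum>b\<in>UNIV. - c b * A $ Inl b $ y else 0)"
  unfolding levi_lower_def block_diag_mult_nth by (simp_all add: transpose_row_mat_mult row_mat_mult)

text \<open>Because \<open>t ** s ** t = 0\<close>, the commutator has only one nonzero off-diagonal
  block, \<open>- (s ** t ** s)\<close>, and the fifth factor removes it.\<close>

lemma unip_commutator:
  fixes s t :: "'a :: comm_ring_1 ^ 'k :: finite ^ 'k"
  assumes "t ** s ** t = 0"
  shows "upper_unip s ** lower_unip t ** upper_unip (- s) ** lower_unip (- t) ** upper_unip (s ** t ** s) =
      block_mat (mat 1 + s ** t) 0 0 (mat 1 - t ** s)"
    and "lower_unip s ** upper_unip t ** lower_unip (- s) ** upper_unip (- t) ** lower_unip (s ** t ** s) =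
      block_mat (mat 1 - t ** s) 0 0 (mat 1 + s ** t)"
proof -
  have z: "s ** t ** s ** t = 0" "s ** t ** s ** t ** s = 0"
  proof -
    have "s ** t ** s ** t = s ** (t ** s ** t)" by (simp only: matrix_mul_assoc)
    then show *: "s ** t ** s ** t = 0" unfolding assms by (simp only: matrix_zero_mult)
    show "s ** t ** s ** t ** s = 0" unfolding * by (simp only: matrix_zero_mult)
  qed
  note unip = upper_unip_def lower_unip_def
  note simps = block_mat_mult matrix_minus_mult matrix_zero_mult matrix_add_ldistrib matrix_add_rdistrib
    matrix_diff_rdistrib matrix_mul_lid matrix_mul_rid matrix_mul_assoc
  have "upper_unip s ** lower_unip t ** upper_unip (- s) = block_mat (mat 1 + s ** t) (- (s ** t ** s)) t (mat 1 - t ** s)"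
    unfolding unip simps by simp
  then have "upper_unip s ** lower_unip t ** upper_unip (- s) ** lower_unip (- t) =
      block_mat (mat 1 + s ** t) (- (s ** t ** s)) 0 (mat 1 - t ** s)"
    unfolding unip simps z assms by simp
  then show "upper_unip s ** lower_unip t ** upper_unip (- s) ** lower_unip (- t) ** upper_unip (s ** t ** s) =
      block_mat (mat 1 + s ** t) 0 0 (mat 1 - t ** s)"
    unfolding unip by (simp add: simps z)
  have "lower_unip s ** upper_unip t ** lower_unip (- s) = block_mat (mat 1 - t ** s) t (- (s ** t ** s)) (mat 1 + s ** t)"
    unfolding unip simps by (simp add: add.commute)
  then have "lower_unip s ** upper_unip t ** lower_unip (- s) ** upper_unip (- t) =
      block_mat (mat 1 - t ** s) 0 (- (s ** t ** s)) (mat 1 + s ** t)"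
    unfolding unip simps z assms by (simp add: add.commute)
  then show "lower_unip s ** upper_unip t ** lower_unip (- s) ** upper_unip (- t) ** lower_unip (s ** t ** s) =
      block_mat (mat 1 - t ** s) 0 0 (mat 1 + s ** t)"
    unfolding unip by (simp add: simps z add.commute)
qed

text \<open>Here \<open>s t = c e_j^T\<close> and \<open>t s = e_j c^T\<close>, so
  \<open>c j = 0\<close> gives \<open>t s t = 0\<close>. Thus the Levi row operations lie in the
  group generated by upper and lower unipotents.\<close>

lemma levi_upper_commutator:
  fixes c :: "'k :: finite \<Rightarrow> 'a :: comm_ring_1"
  assumes c: "c j = 0"
  defines "s \<equiv> sym_row j c" and "t \<equiv> sym_row j (\<lambda>b. if b = j then 1 else 0)"
  shows "levi_upper j c = upper_unip s ** lower_unip t ** upper_unip (- s) ** lower_unip (- t) ** upper_unip (s ** t ** s)"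
    and "levi_lower j c = lower_unip s ** upper_unip t ** lower_unip (- s) ** upper_unip (- t) ** lower_unip (s ** t ** s)"
    and "transpose (s ** t ** s) = s ** t ** s"
proof -
  have t: "t $ a $ b = (if a = j \<and> b = j then 1 else 0)" for a b
    by (simp add: t_def sym_row_def)
  have mult_t: "(X ** t) $ a $ b = (if b = j then X $ a $ j else 0)" for X :: "'a ^ 'k ^ 'k" and a b
    by (cases "b = j") (simp_all add: matrix_matrix_mult_def t if_distrib[of "\<lambda>x. _ * x"] cong: if_cong)
  have st: "(s ** t) $ a $ b = (if b = j then c a else 0)" for a b
    using c by (simp add: mult_t s_def sym_row_def)
  have ts: "(t ** s) $ a $ b = (if a = j then c b else 0)" for a b
    by (cases "a = j") (simp_all add: matrix_matrix_mult_def t s_def sym_row_def if_distrib[of "\<lambda>x. x * _"] cong: if_cong)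
  have "(t ** s ** t) $ a $ b = 0" for a b
    using c by (simp add: mult_t ts)
  then have "t ** s ** t = 0" by (simp add: vec_eq_iff)
  moreover have "mat 1 + s ** t = transpose (row_mat j c)"
    by (auto simp: vec_eq_iff st mat_def row_mat_def transpose_def)
  moreover have "mat 1 - t ** s = row_mat j (\<lambda>b. - c b)"
    by (auto simp: vec_eq_iff ts mat_def row_mat_def)
  ultimately show
    "levi_upper j c = upper_unip s ** lower_unip t ** upper_unip (- s) ** lower_unip (- t) ** upper_unip (s ** t ** s)"
    "levi_lower j c = lower_unip s ** upper_unip t ** lower_unip (- s) ** upper_unip (- t) ** lower_unip (s ** t ** s)"
    unfolding levi_upper_def levi_lower_def by (simp_all add: unip_commutator)
  show "transpose (s ** t ** s) = s ** t ** s"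
    by (simp add: matrix_transpose_mul s_def t_def matrix_mul_assoc)
qed

lemma levi_inverse:
  assumes "c j = 0"
  shows "levi_upper j (\<lambda>b. - c b) ** levi_upper j c = mat 1"
    and "levi_lower j (\<lambda>b. - c b) ** levi_lower j c = mat 1"
proof -
  have R: "row_mat j c ** row_mat j (\<lambda>b. - c b) = mat 1" "row_mat j (\<lambda>b. - c b) ** row_mat j c = mat 1"
    using assms by (simp_all add: row_mat_add row_mat_0)
  have "transpose (row_mat j (\<lambda>b. - c b)) ** transpose (row_mat j c) = mat 1"
    unfolding matrix_transpose_mul[symmetric] R by (rule transpose_mat)
  with R show "levi_upper j (\<lambda>b. - c b) ** levi_upper j c = mat 1" "levi_lower j (\<lambda>b. - c b) ** levi_lower j c = mat 1"
    by (simp_all add: levi_upper_def levi_lower_def block_simps block_mat_1)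
qed

text \<open>
  For a symplectic matrix this forces the rows with indices in \<open>S\<close> to be trivial as well, so that
  elimination can go on with the remaining indices.
\<close>

definition std_columns :: "'k set \<Rightarrow> 'a :: comm_ring_1 ^ ('k :: finite + 'k) ^ ('k + 'k) \<Rightarrow> bool" where
  "std_columns S A \<longleftrightarrow> (\<forall>s\<in>S. \<forall>a.
     A $ Inl a $ Inl s = (if a = s then 1 else 0) \<and> A $ Inr a $ Inl s = 0 \<and>
     A $ Inl a $ Inr s = 0 \<and> A $ Inr a $ Inr s = (if a = s then 1 else 0))"

lemma std_columnsD:
  assumes "std_columns S A" "s \<in> S"
  shows "A $ Inl a $ Inl s = (if a = s then 1 else 0)" "A $ Inr a $ Inl s = 0"
    "A $ Inl a $ Inr s = 0" "A $ Inr a $ Inr s = (if a = s then 1 else 0)"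
  using assms unfolding std_columns_def by blast+

text \<open>The symplectic product of a column with the standard column \<open>Inl s\<close> or
  \<open>Inr s\<close> is, up to sign, its entry in row \<open>Inr s\<close> or
  \<open>Inl s\<close>.\<close>

lemma std_columns_rows:
  assumes A: "A \<in> Sp" and S: "std_columns S A" "s \<in> S" and j: "j \<notin> S"
  shows "A $ Inl s $ Inl j = 0" "A $ Inr s $ Inl j = 0" "A $ Inl s $ Inr j = 0" "A $ Inr s $ Inr j = 0"
proof -
  have js: "j \<noteq> s" "s \<noteq> j" using S(2) j by auto
  have J: "symplectic_J $ Inl s $ Inr j = 0" "symplectic_J $ Inr s $ Inl j = 0"
    "symplectic_J $ Inl s $ Inl j = 0" "symplectic_J $ Inr s $ Inr j = 0"
    using js by (simp_all add: symplectic_J_block mat_def)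
  note simps = std_columnsD[OF S] J if_distrib[of "\<lambda>x. x * _"]
  show "A $ Inl s $ Inl j = 0" "A $ Inr s $ Inl j = 0" "A $ Inl s $ Inr j = 0" "A $ Inr s $ Inr j = 0"
    using Sp_columns[OF A, of "Inr s" "Inl j"] Sp_columns[OF A, of "Inl s" "Inl j"]
      Sp_columns[OF A, of "Inr s" "Inr j"] Sp_columns[OF A, of "Inl s" "Inr j"]
    by (simp_all add: simps cong: if_cong)
qed

lemma std_columns_mult:
  assumes S: "std_columns S A" and j: "j \<notin> S"
  shows "(\<And>s a. s \<in> S \<Longrightarrow> m $ a $ s = 0) \<Longrightarrow> std_columns S (upper_unip m ** A)"
    and "(\<And>s a. s \<in> S \<Longrightarrow> m $ a $ s = 0) \<Longrightarrow> std_columns S (lower_unip m ** A)"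
    and "(\<And>s. s \<in> S \<Longrightarrow> c s = 0) \<Longrightarrow> std_columns S (levi_upper j c ** A)"
    and "(\<And>s. s \<in> S \<Longrightarrow> c s = 0) \<Longrightarrow> std_columns S (levi_lower j c ** A)"
proof -
  have js: "s \<in> S \<Longrightarrow> j \<noteq> s" for s using j by auto
  note D = std_columnsD[OF S] if_distrib[of "\<lambda>x. _ * x"]
  show "(\<And>s a. s \<in> S \<Longrightarrow> m $ a $ s = 0) \<Longrightarrow> std_columns S (upper_unip m ** A)"
    unfolding std_columns_def by (simp add: upper_unip_mult D cong: if_cong)
  show "(\<And>s a. s \<in> S \<Longrightarrow> m $ a $ s = 0) \<Longrightarrow> std_columns S (lower_unip m ** A)"
    unfolding std_columns_def by (simp add: lower_unip_mult D cong: if_cong)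
  show "(\<And>s. s \<in> S \<Longrightarrow> c s = 0) \<Longrightarrow> std_columns S (levi_upper j c ** A)"
    unfolding std_columns_def using js by (simp add: levi_upper_mult D sum_negf cong: if_cong)
  show "(\<And>s. s \<in> S \<Longrightarrow> c s = 0) \<Longrightarrow> std_columns S (levi_lower j c ** A)"
    unfolding std_columns_def using js by (simp add: levi_lower_mult D sum_negf cong: if_cong)
qed

text \<open>Left multiplications make the columns \<open>Inl j\<close> and \<open>Inr j\<close>
  standard, one pair at a time. The symplectic relations protect the pairs already treated.\<close>

lemma Sp_elimination:
  fixes N :: "('p :: prime_card padic_int ^ ('k :: finite + 'k) ^ ('k + 'k)) set"
  assumes NSp: "N \<subseteq> Sp" and one: "mat 1 \<in> N" and mult: "\<And>A B. A \<in> N \<Longrightarrow> B \<in> N \<Longrightarrow> A ** B \<in> N"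
    and upper: "\<And>s. transpose s = s \<Longrightarrow> upper_unip s \<in> N" and lower: "\<And>s. transpose s = s \<Longrightarrow> lower_unip s \<in> N"
  shows "Sp \<subseteq> N"
proof -
  interpret matrix_group "Sp :: ('p padic_int ^ ('k + 'k) ^ ('k + 'k)) set" by (rule matrix_group_Sp)
  have levi: "levi_upper j c \<in> N" "levi_lower j c \<in> N" if "c j = 0" for j and c :: "'k \<Rightarrow> 'p padic_int"
    unfolding levi_upper_commutator(1,2)[of c j, OF that]
    by (intro mult upper lower; simp add: transpose_minus levi_upper_commutator(3)[of c j, OF that])+
  have reduce: "A \<in> N" if "M \<in> N" "M' \<in> N" "M' ** M = mat 1" "M ** A \<in> N" for A M M'
    using mult[OF that(2,4)] that(3) by (simp add: matrix_mul_assoc)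
  have upper_red: "A \<in> N" if "transpose s = s" "upper_unip s ** A \<in> N" for s A
    by (rule reduce[OF upper upper _ that(2), of "- s"])
      (simp_all add: that(1) transpose_minus upper_unip_add unip_0)
  have lower_red: "A \<in> N" if "transpose s = s" "lower_unip s ** A \<in> N" for s A
    by (rule reduce[OF lower lower _ that(2), of "- s"])
      (simp_all add: that(1) transpose_minus lower_unip_add unip_0)
  have levi_upper_red: "A \<in> N" if "c j = 0" "levi_upper j c ** A \<in> N" for A j and c :: "'k \<Rightarrow> 'p padic_int"
    by (rule reduce[OF levi(1)[of c j] levi(1)[of "\<lambda>b. - c b" j] _ that(2)])
      (simp_all add: that(1) levi_inverse)
  have levi_lower_red: "A \<in> N" if "c j = 0" "levi_lower j c ** A \<in> N" for A j and c :: "'k \<Rightarrow> 'p padic_int"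
    by (rule reduce[OF levi(2)[of c j] levi(2)[of "\<lambda>b. - c b" j] _ that(2)])
      (simp_all add: that(1) levi_inverse)
  have main: "A \<in> N" if "A \<in> Sp" "std_columns S A" "card (- S) = n" for A S n
    using that
  proof (induction n arbitrary: A S)
    case 0
    then have "- S = {}" by simp
    then have "S = UNIV" by blast
    then have "A = block_mat (mat 1) 0 0 (mat 1)"
      using 0(2) by (simp add: vec_eq_iff all_sum_iff std_columns_def mat_def)
    then show ?case using one by (simp add: block_mat_1)
  next
    case (Suc n)
    have "card (- S) \<noteq> 0" using Suc.prems(3) by simp
    then have "- S \<noteq> {}" by (metis card.empty)
    then obtain j where j: "j \<notin> S" by blast
    have sj: "s \<noteq> j" if "s \<in> S" for s using that j by blast
    have card: "card (- insert j S) = n"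
    proof -
      have "- insert j S = - S - {j}" by auto
      then show ?thesis using Suc.prems(3) j by simp
    qed
    \<comment> \<open>Once column \<open>Inl j\<close> is standard, its symplectic product with
      column \<open>Inr j\<close> supplies the pivot 1 at \<open>(Inr j, Inr j)\<close>;
      \<open>levi_lower\<close> and \<open>upper_unip\<close> then clear column \<open>Inr j\<close>
      and keep column \<open>Inl j\<close>.\<close>
    have second: "A \<in> N" if A: "A \<in> Sp" "std_columns S A"
      and col: "\<And>a. A $ Inl a $ Inl j = (if a = j then 1 else 0)" "\<And>a. A $ Inr a $ Inl j = 0" for A
    proof -
      note rows = std_columns_rows[OF A _ j]
      have wj: "A $ Inr j $ Inr j = 1"
        using Sp_columns[OF A(1), of "Inl j" "Inr j"]
        by (simp add: col if_distrib[of "\<lambda>x. x * _"] symplectic_J_block mat_def cong: if_cong)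
      define c where "c a = (if a = j then 0 else - A $ Inr a $ Inr j)" for a
      have cj: "c j = 0" by (simp add: c_def)
      define B where "B = levi_lower j c ** A"
      have B: "B \<in> Sp" unfolding B_def using levi(2)[of c j, OF cj] NSp A(1) by (intro mult_mem) auto
      have B_std: "std_columns S B"
        unfolding B_def by (rule std_columns_mult(4)[OF A(2) j]) (use sj rows in \<open>simp add: c_def\<close>)
      have Bl: "B $ Inl a $ Inl j = (if a = j then 1 else 0)" "B $ Inr a $ Inl j = 0" for a
        by (simp_all add: B_def levi_lower_mult col sum_negf if_distrib[of "\<lambda>x. _ * x"] cj cong: if_cong)
      have Br: "B $ Inr a $ Inr j = (if a = j then 1 else 0)" for a
        by (simp add: B_def levi_lower_mult c_def wj)
      note rowsB = std_columns_rows[OF B B_std _ j]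
      define m where "m = sym_row j (\<lambda>b. - B $ Inl b $ Inr j)"
      define C where "C = upper_unip m ** B"
      have mt: "transpose m = m" by (simp add: m_def)
      have C: "C \<in> Sp" unfolding C_def using upper[OF mt] NSp B by (intro mult_mem) auto
      have "std_columns S C"
        unfolding C_def by (rule std_columns_mult(1)[OF B_std j]) (use sj rowsB in \<open>simp add: m_def sym_row_def\<close>)
      moreover have "C $ Inl a $ Inl j = (if a = j then 1 else 0)" "C $ Inr a $ Inl j = 0"
        "C $ Inl a $ Inr j = 0" "C $ Inr a $ Inr j = (if a = j then 1 else 0)" for a
        by (simp_all add: C_def upper_unip_mult Bl Br if_distrib[of "\<lambda>x. _ * x"] m_def sym_row_def cong: if_cong)
      ultimately have "std_columns (insert j S) C" unfolding std_columns_def by blast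
      then have "C \<in> N" by (rule Suc.IH[OF C _ card])
      then have "B \<in> N" unfolding C_def by (rule upper_red[OF mt])
      then show "A \<in> N" unfolding B_def by (rule levi_lower_red[of c j, OF cj])
    qed
    \<comment> \<open>From the pivot, \<open>levi_upper\<close> clears the upper half of column
      \<open>Inl j\<close> and \<open>lower_unip\<close> the lower half.\<close>
    have first: "A \<in> N" if A: "A \<in> Sp" "std_columns S A" and pivot: "A $ Inl j $ Inl j = 1" for A
    proof -
      note rows = std_columns_rows[OF A _ j]
      define c where "c a = (if a = j then 0 else - A $ Inl a $ Inl j)" for a
      have cj: "c j = 0" by (simp add: c_def)
      define B where "B = levi_upper j c ** A"
      have B: "B \<in> Sp" unfolding B_def using levi(1)[of c j, OF cj] NSp A(1) by (intro mult_mem) auto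
      have B_std: "std_columns S B"
        unfolding B_def by (rule std_columns_mult(3)[OF A(2) j]) (use sj rows in \<open>simp add: c_def\<close>)
      have Bl: "B $ Inl a $ Inl j = (if a = j then 1 else 0)" for a
        by (simp add: B_def levi_upper_mult c_def pivot)
      note rowsB = std_columns_rows[OF B B_std _ j]
      define m where "m = sym_row j (\<lambda>b. - B $ Inr b $ Inl j)"
      define C where "C = lower_unip m ** B"
      have mt: "transpose m = m" by (simp add: m_def)
      have C: "C \<in> Sp" unfolding C_def using lower[OF mt] NSp B by (intro mult_mem) auto
      have C_std: "std_columns S C"
        unfolding C_def by (rule std_columns_mult(2)[OF B_std j]) (use sj rowsB in \<open>simp add: m_def sym_row_def\<close>)
      have "C \<in> N"
        by (rule second[OF C C_std])
          (simp_all add: C_def lower_unip_mult Bl if_distrib[of "\<lambda>x. _ * x"] m_def sym_row_def cong: if_cong)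
      then have "B \<in> N" unfolding C_def by (rule lower_red[OF mt])
      then show "A \<in> N" unfolding B_def by (rule levi_upper_red[of c j, OF cj])
    qed
    \<comment> \<open>A unit in row \<open>Inr a\<close> is added with a suitable factor to row
      \<open>Inl j\<close>, which creates the pivot 1.\<close>
    have unit_lower: "A \<in> N" if A: "A \<in> Sp" "std_columns S A" and a: "a \<notin> S" "padic_res (A $ Inr a $ Inl j) 1 \<noteq> 0" for A a
    proof -
      obtain u where u: "A $ Inr a $ Inl j * u = 1" using ex_padic_inverse[OF a(2)] by blast
      define r where "r = u * (1 - A $ Inl j $ Inl j)"
      have "r * A $ Inr a $ Inl j = (A $ Inr a $ Inl j * u) * (1 - A $ Inl j $ Inl j)"
        unfolding r_def by (simp only: ac_simps)
      then have r: "r * A $ Inr a $ Inl j = 1 - A $ Inl j $ Inl j" unfolding u by simp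
      \<comment> \<open>Symmetry forces a second entry at \<open>(a, j)\<close>; the disjunction
        avoids doubling \<open>r\<close> when \<open>a = j\<close>.\<close>
      define m :: "'p padic_int ^ 'k ^ 'k" where "m = (\<chi> b c. if b = j \<and> c = a \<or> b = a \<and> c = j then r else 0)"
      have mt: "transpose m = m" by (auto simp: m_def transpose_def vec_eq_iff)
      have mj: "m $ j $ b = (if b = a then r else 0)" for b by (auto simp: m_def)
      have "upper_unip m ** A \<in> N"
      proof (rule first)
        show "upper_unip m ** A \<in> Sp" using upper[OF mt] NSp A(1) by (intro mult_mem) auto
        show "std_columns S (upper_unip m ** A)"
          by (rule std_columns_mult(1)[OF A(2) j]) (use sj a(1) in \<open>auto simp: m_def\<close>)
        show "(upper_unip m ** A) $ Inl j $ Inl j = 1"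
          by (simp add: upper_unip_mult mj if_distrib[of "\<lambda>x. x * _"] r cong: if_cong)
      qed
      then show ?thesis by (rule upper_red[OF mt])
    qed
    \<comment> \<open>A unit in row \<open>Inl a\<close> first produces the entry 1 in row
      \<open>Inr a\<close>, which reduces to \<open>unit_lower\<close>.\<close>
    have unit_upper: "A \<in> N" if A: "A \<in> Sp" "std_columns S A" and a: "a \<notin> S" "padic_res (A $ Inl a $ Inl j) 1 \<noteq> 0" for A a
    proof -
      obtain u where u: "A $ Inl a $ Inl j * u = 1" using ex_padic_inverse[OF a(2)] by blast
      define r where "r = u * (1 - A $ Inr a $ Inl j)"
      have "r * A $ Inl a $ Inl j = (A $ Inl a $ Inl j * u) * (1 - A $ Inr a $ Inl j)"
        unfolding r_def by (simp only: ac_simps)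
      then have r: "r * A $ Inl a $ Inl j = 1 - A $ Inr a $ Inl j" unfolding u by simp
      define m where "m = sym_row a (\<lambda>b. if b = a then r else 0)"
      have mt: "transpose m = m" by (simp add: m_def)
      have ma: "m $ a $ b = (if b = a then r else 0)" for b by (simp add: m_def sym_row_def)
      have "lower_unip m ** A \<in> N"
      proof (rule unit_lower[OF _ _ a(1)])
        show "lower_unip m ** A \<in> Sp" using lower[OF mt] NSp A(1) by (intro mult_mem) auto
        show "std_columns S (lower_unip m ** A)"
          by (rule std_columns_mult(2)[OF A(2) j]) (use a(1) in \<open>auto simp: m_def sym_row_def\<close>)
        have "(lower_unip m ** A) $ Inr a $ Inl j = 1"
          by (simp add: lower_unip_mult ma if_distrib[of "\<lambda>x. x * _"] r cong: if_cong)
        then show "padic_res ((lower_unip m ** A) $ Inr a $ Inl j) 1 \<noteq> 0"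
          by (simp only: padic_res_one_1)
      qed
      then show ?thesis by (rule lower_red[OF mt])
    qed
    \<comment> \<open>A column of an invertible matrix cannot vanish modulo \<open>p\<close>. The
      row \<open>x\<close> found here has its index outside \<open>S\<close> by
      \<open>std_columns_rows\<close>.\<close>
    have "\<exists>x. padic_res (A $ x $ Inl j) 1 \<noteq> 0"
    proof (rule ccontr)
      assume *: "\<not> ?thesis"
      obtain A' where "A' ** A = mat 1" using inverse_ex[OF Suc.prems(1)] by blast
      then have "(\<Sum>x\<in>UNIV. A' $ Inl j $ x * A $ x $ Inl j) = 1"
        unfolding matrix_matrix_mult_def by (simp add: vec_eq_iff mat_def)
      then have "padic_res (\<Sum>x\<in>UNIV. A' $ Inl j $ x * A $ x $ Inl j) 1 = 1" by (simp only: padic_res_one_1)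
      then show False using * by (simp add: padic_res_sum times_padic_int.rep_eq)
    qed
    then obtain x where x: "padic_res (A $ x $ Inl j) 1 \<noteq> 0" by blast
    note rows = std_columns_rows[OF Suc.prems(1,2) _ j]
    show ?case
    proof (cases x)
      case (Inl a)
      have "a \<notin> S" using x rows(1)[of a] unfolding Inl by (auto simp: zero_padic_int.rep_eq)
      then show ?thesis using x unfolding Inl by (rule unit_upper[OF Suc.prems(1,2)])
    next
      case (Inr a)
      have "a \<notin> S" using x rows(2)[of a] unfolding Inr by (auto simp: zero_padic_int.rep_eq)
      then show ?thesis using x unfolding Inr by (rule unit_lower[OF Suc.prems(1,2)])
    qed
  qed
  show ?thesis
  proof
    fix A :: "'p padic_int ^ ('k + 'k) ^ ('k + 'k)" assume "A \<in> Sp"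
    then show "A \<in> N" by (rule main[of A "{}"]) (simp_all add: std_columns_def)
  qed
qed

text \<open>Conjugating a long root element by a Levi element gives a short root element times two
  long ones. Products then yield all upper unipotents, and conjugation by
  \<open>symplectic_J\<close> the lower ones.\<close>

lemma Sp_normally_generated:
  fixes N :: "('p :: prime_card padic_int ^ ('k :: finite + 'k) ^ ('k + 'k)) set"
  assumes p: "CARD('p) \<ge> 3"
    and N: "N \<subseteq> Sp" "mat 1 \<in> N" "\<And>A B. A \<in> N \<Longrightarrow> B \<in> N \<Longrightarrow> A ** B \<in> N"
    and conj: "\<And>A g g'. A \<in> N \<Longrightarrow> g \<in> Sp \<Longrightarrow> g' \<in> Sp \<Longrightarrow> g ** g' = mat 1 \<Longrightarrow> g' ** g = mat 1 \<Longrightarrow> g ** A ** g' \<in> N"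
    and long: "\<And>i x. upper_unip (sym_row i (\<lambda>j. if j = i then x else 0)) \<in> N"
  shows "Sp \<subseteq> N"
proof (rule Sp_elimination[OF N])
  define E where "E i x = sym_row i (\<lambda>j. if j = i then x else 0)" for i :: 'k and x :: "'p padic_int"
  \<comment> \<open>As a sum of two terms, \<open>F i i x\<close> has diagonal entry
    \<open>x + x\<close>, so that the weight \<open>hf\<close> used below for symmetric matrices is
    right on the diagonal too.\<close>
  define F where "F i j x = (\<chi> a b. (if a = i \<and> b = j then x else 0) + (if a = j \<and> b = i then x else 0))"
    for i j :: 'k and x :: "'p padic_int"
  have E: "E i x $ a $ b = (if a = i \<and> b = i then x else 0)" for i x a b
    by (simp add: E_def sym_row_def)
  have add: "upper_unip (s + t) \<in> N" if "upper_unip s \<in> N" "upper_unip t \<in> N" for s t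
    using N(3)[OF that] by (simp add: upper_unip_add)
  have F: "upper_unip (F i j x) \<in> N" for i j x
  proof (cases "i = j")
    case True
    then have "F i j x = E i (x + x)" by (auto simp: vec_eq_iff E F_def)
    then show ?thesis using long by (simp add: E_def)
  next
    case False
    define m :: "'k \<Rightarrow> 'p padic_int" where "m b = (if b = i then 1 else 0)" for b
    have mj: "m j = 0" using False by (simp add: m_def)
    let ?a = "row_mat j m" and ?a' = "transpose (row_mat j (\<lambda>b. - m b))"
    have R: "?a ** row_mat j (\<lambda>b. - m b) = mat 1" "row_mat j (\<lambda>b. - m b) ** ?a = mat 1"
      using mj by (simp_all add: row_mat_add row_mat_0)
    have tR: "transpose ?a ** ?a' = mat 1" "?a' ** transpose ?a = mat 1"
      unfolding matrix_transpose_mul[symmetric] R by (rule transpose_mat)+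
    let ?g = "block_mat ?a 0 0 ?a'" and ?g' = "block_mat (row_mat j (\<lambda>b. - m b)) 0 0 (transpose ?a)"
    have g: "?g \<in> Sp" "?g' \<in> Sp" "?g ** ?g' = mat 1" "?g' ** ?g = mat 1"
      using R tR by (auto intro!: levi_Sp simp: block_simps block_mat_1)
    have "?g ** upper_unip (E i x) ** ?g' \<in> N" using conj[OF long[of i x] g] by (simp add: E_def)
    also have "?g ** upper_unip (E i x) ** ?g' = upper_unip (?a ** E i x ** transpose ?a) ** (?g ** ?g')"
      unfolding levi_conj[OF tR(1)] by (simp only: matrix_mul_assoc)
    also have "\<dots> = upper_unip (?a ** E i x ** transpose ?a)" unfolding g(3) by simp
    \<comment> \<open>\<open>?a\<close> maps \<open>e_i\<close> to \<open>e_i + e_j\<close>, so the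
      result is \<open>x\<close> times the outer square of \<open>e_i + e_j\<close>.\<close>
    also have "?a ** E i x ** transpose ?a = F i j x + E i x + E j x"
    proof -
      have A: "(?a ** E i x) $ b $ c = (if (b = i \<or> b = j) \<and> c = i then x else 0)" for b c
        using False by (simp add: row_mat_mult m_def if_distrib[of "\<lambda>x. x * _"] E cong: if_cong)
      show ?thesis
        using False by (auto simp: vec_eq_iff mult_transpose_row_mat m_def if_distrib[of "\<lambda>x. x * _"] A F_def E cong: if_cong)
    qed
    finally have "upper_unip (F i j x + E i x + E j x) \<in> N" .
    from add[OF add[OF this long[of i "- x", folded E_def]] long[of j "- x", folded E_def]]
    have "upper_unip (F i j x + E i x + E j x + E i (- x) + E j (- x)) \<in> N" .
    moreover have "F i j x + E i x + E j x + E i (- x) + E j (- x) = F i j x"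
      by (auto simp: vec_eq_iff E)
    ultimately show ?thesis by simp
  qed
  have sum: "upper_unip (sum f I) \<in> N" if "finite I" "\<And>i. i \<in> I \<Longrightarrow> upper_unip (f i) \<in> N"
    for I :: "'k set" and f
    using that by (induction I) (auto simp: unip_0 N(2) intro: add)
  have "\<not> CARD('p) dvd 2" using p by (auto dest: dvd_imp_le)
  then obtain hf :: "'p padic_int" where hf: "of_nat 2 * hf = 1" using ex_padic_of_nat_inverse by blast
  show upper: "upper_unip s \<in> N" if s: "transpose s = s" for s
  proof -
    have sab: "s $ b $ a = s $ a $ b" for a b using s unfolding vec_eq_iff transpose_def by simp
    have "(\<Sum>i\<in>UNIV. \<Sum>j\<in>UNIV. F i j (hf * s $ i $ j)) $ a $ b = s $ a $ b" for a b
    proof -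
      have "(\<Sum>i\<in>UNIV. \<Sum>j\<in>UNIV. F i j (hf * s $ i $ j)) $ a $ b =
          (\<Sum>i\<in>UNIV. \<Sum>j\<in>UNIV. (if j = b then if i = a then hf * s $ a $ b else 0 else 0) + (if j = a then if i = b then hf * s $ b $ a else 0 else 0))"
        unfolding sum_component by (intro sum.cong refl) (auto simp: F_def)
      also have "\<dots> = hf * s $ a $ b + hf * s $ b $ a"
        by (simp add: sum.distrib cong: if_cong)
      also have "\<dots> = (of_nat 2 * hf) * s $ a $ b" by (simp add: sab algebra_simps)
      finally show ?thesis unfolding hf by simp
    qed
    then have "(\<Sum>i\<in>UNIV. \<Sum>j\<in>UNIV. F i j (hf * s $ i $ j)) = s" by (simp add: vec_eq_iff)
    moreover have "upper_unip (\<Sum>i\<in>UNIV. \<Sum>j\<in>UNIV. F i j (hf * s $ i $ j)) \<in> N"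
      using F by (intro sum) auto
    ultimately show ?thesis by simp
  qed
  show "lower_unip s \<in> N" if s: "transpose s = s" for s
  proof -
    let ?J = "symplectic_J :: 'p padic_int ^ ('k + 'k) ^ ('k + 'k)"
    have tJ: "transpose ?J = - ?J"
      unfolding symplectic_J_block by (simp add: block_simps vec_eq_iff all_sum_iff)
    have JJ: "?J ** (- ?J) = mat 1" "(- ?J) ** ?J = mat 1"
      by (simp_all add: matrix_minus_mult symplectic_J_sq)
    have J: "?J \<in> Sp" "- ?J \<in> Sp"
      using JJ by (auto intro!: Sp_memI[of ?J "- ?J"] Sp_memI[of "- ?J" ?J]
          simp: tJ transpose_minus matrix_minus_mult symplectic_J_sq)
    have "transpose (- s) = - s" using s by (simp add: transpose_minus)
    then have "?J ** upper_unip (- s) ** (- ?J) \<in> N"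
      by (rule conj[OF upper J JJ])
    moreover have "?J ** upper_unip (- s) ** (- ?J) = lower_unip s"
      unfolding matrix_minus_mult unfolding symplectic_J_block upper_unip_def lower_unip_def block_simps
      by (simp add: vec_eq_iff all_sum_iff)
    ultimately show ?thesis by simp
  qed
qed

theorem triple_product_Sp:
  fixes \<mu> :: "('p :: prime_card padic_int ^ ('k :: finite + 'k) ^ ('k + 'k)) measure"
  assumes p: "CARD('p) \<ge> 3" and haar: "normalized_haar_measure Sp \<mu>"
    and A: "A \<in> sets (completion \<mu>)" "measure (completion \<mu>) A > h_Sp CARD('k) CARD('p) powr (- 1 / 3)"
  shows "triple_product A = Sp"
proof -
  let ?p = "CARD('p)" and ?k = "CARD('k)"
  let ?Sp = "Sp :: ('p padic_int ^ ('k + 'k) ^ ('k + 'k)) set"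
  define h where "h = card {1..(?p - 1) div 2} * ?p ^ (?k - 1)"
  have "prime ?p" by (rule prime_card)
  then have "odd ?p" using p prime_odd_nat by auto
  then have "real ((?p - 1) div 2) = (real ?p - 1) / 2" using p by (auto elim!: oddE)
  then have h: "real h = h_Sp ?k ?p" by (simp add: h_def h_Sp_def)
  have hpos: "real h > 0" unfolding h h_Sp_def using p by simp
  show ?thesis
  proof (rule triple_product_of_levels[OF matrix_group_Sp closed_Sp _ haar A])
    fix n :: nat assume n: "n \<ge> 1"
    define U :: "('p padic_int ^ ('k + 'k) ^ ('k + 'k)) set"
      where "U = {upper_unip (sym_row i (\<lambda>j. if j = i then x else 0)) | i x. True}"
    show "finite_group.normally_generated_by_large_orbits (level_group n ?Sp) h"
    proof (rule normally_generated_level[OF matrix_group_Sp, where U = U])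
      show "U \<subseteq> ?Sp" by (auto simp: U_def intro!: upper_unip_Sp)
      show "finite_group.has_large_orbits (level_group n ?Sp) h (mat_res n u)" if u: "u \<in> U" for u
      proof -
        obtain i x where u: "u = upper_unip (sym_row i (\<lambda>j. if j = i then x else 0))"
          using u unfolding U_def by blast
        show ?thesis unfolding u h_def by (rule has_large_orbits_Sp[OF p n])
      qed
    next
      fix N assume N: "N \<subseteq> ?Sp" "mat 1 \<in> N" "\<And>A B. A \<in> N \<Longrightarrow> B \<in> N \<Longrightarrow> A ** B \<in> N"
        "\<And>A g g'. A \<in> N \<Longrightarrow> g \<in> ?Sp \<Longrightarrow> g' \<in> ?Sp \<Longrightarrow> g ** g' = mat 1 \<Longrightarrow> g' ** g = mat 1 \<Longrightarrow> g ** A ** g' \<in> N"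
        "U \<subseteq> N"
      show "?Sp \<subseteq> N"
      proof (rule Sp_normally_generated[OF p N(1-4)])
        show "upper_unip (sym_row i (\<lambda>j. if j = i then x else 0)) \<in> N" for i x
          using N(5) unfolding U_def by blast
      qed
    qed
  next
    show "1 \<le> real h * (h_Sp ?k ?p powr (- 1 / 3)) ^ 3"
      using mult_powr_cube[OF hpos] by (simp add: h)
  qed simp
qed

text \<open>Measurability refers to the completed Haar measure, so all Borel subsets of the group
  are covered together with their modifications by null sets.\<close>

theorem corollary2:
  fixes p :: nat
  assumes "p = CARD('p :: prime_card)" and "p \<ge> 3"
  shows "(CARD('n :: finite) \<ge> 2 \<longrightarrow>
      (\<forall>\<mu> :: ('p padic_int ^ 'n ^ 'n) measure. normalized_haar_measure SL \<mu> \<longrightarrow>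
        (\<forall>A \<in> sets (completion \<mu>).
          measure (completion \<mu>) A > h_SL CARD('n) p powr (- 1 / 3) \<longrightarrow>
          triple_product A = SL))) \<and>
    (CARD('k :: finite) \<ge> 2 \<longrightarrow>
      (\<forall>\<mu> :: ('p padic_int ^ ('k + 'k) ^ ('k + 'k)) measure. normalized_haar_measure Sp \<mu> \<longrightarrow>
        (\<forall>A \<in> sets (completion \<mu>).
          measure (completion \<mu>) A > h_Sp CARD('k) p powr (- 1 / 3) \<longrightarrow>
          triple_product A = Sp)))"
proof (intro conjI impI allI ballI)
  fix \<mu> :: "('p padic_int ^ 'n ^ 'n) measure" and A
  assume "CARD('n) \<ge> 2" "normalized_haar_measure SL \<mu>" "A \<in> sets (completion \<mu>)"
    "measure (completion \<mu>) A > h_SL CARD('n) p powr (- 1 / 3)"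
  then show "triple_product A = SL"
    using assms(2) unfolding assms(1) by (intro triple_product_SL)
next
  fix \<mu> :: "('p padic_int ^ ('k + 'k) ^ ('k + 'k)) measure" and A
  assume "normalized_haar_measure Sp \<mu>" "A \<in> sets (completion \<mu>)"
    "measure (completion \<mu>) A > h_Sp CARD('k) p powr (- 1 / 3)"
  then show "triple_product A = Sp"
    using assms(2) unfolding assms(1) by (intro triple_product_Sp)
qed

end
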